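(* Let $p\in(0,\infty)$ and, for $i=1,2$, let $\mathfrak M_i=\mathfrak N_i\otimes M_2(\mathbb C)$, where $\mathfrak N_i$ is a finite factor. If $\phi$ is a surjective $L^p$-isometry from $\mathscr P_{1/2}(\mathfrak M_1)$ to $\mathscr P_{1/2}(\mathfrak M_2)$ satisfying $\phi(I\otimes E_{11})=I\otimes E_{11}$, then there exists a surjective $L^p$-isometry $\psi:\mathscr U(\mathfrak N_1)\to\mathscr U(\mathfrak N_2)$ such that $$\phi\Big(\tfrac12\big(I\otimes(E_{11}+E_{22})+V\otimes E_{12}+V^*\otimes E_{21}\big)\Big)=\tfrac12\big(I\otimes(E_{11}+E_{22})+\psi(V)\otimes E_{12}+\psi(V)^*\otimes E_{21}\big)$$ for every unitary $V\in\mathfrak N_1$.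
   Context: $\{E_{ij}\}$ are the canonical matrix units of $M_2(\mathbb C)$. A finite factor is a von Neumann algebra factor admitting a (unique, faithful, normal) tracial state, i.e. $M_n(\mathbb C)$ or a $\mathrm{II}_1$ factor. For a finite factor with tracial state $\tau$, $\|A\|_p:=\tau(|A|^p)^{1/p}$, $\mathscr U(\cdot)$ denotes the unitary group, and $\mathscr P_{1/2}(\cdot)$ the set of projections of trace $1/2$. A map $f$ between subsets of finite factors is an $L^p$-isometry if $\|A-B\|_p=\|f(A)-f(B)\|_p$ for all $A,B$ in its domain, each side computed with the tracial state of the respective factor. *)

theory Defs
  imports "HOL-Analysis.Analysis" "HOL-Computational_Algebra.Polynomial"
begin

section \<open>Complex Hilbert spaces\<close>

text \<open>
  The complex inner product is linear in its first argument. Its real part is the inner product of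
  the underlying real Hilbert space, so that norm, topology and completeness are the library's.
\<close>

class complex_hilbert_space = real_inner + complete_space +
  fixes scaleC :: "complex \<Rightarrow> 'a \<Rightarrow> 'a" (infixr \<open>*\<^sub>C\<close> 75)
    and cinner :: "'a \<Rightarrow> 'a \<Rightarrow> complex"
  assumes scaleC_add_right: "c *\<^sub>C (x + y) = c *\<^sub>C x + c *\<^sub>C y"
    and scaleC_add_left: "(c + d) *\<^sub>C x = c *\<^sub>C x + d *\<^sub>C x"
    and scaleC_scaleC: "c *\<^sub>C d *\<^sub>C x = (c * d) *\<^sub>C x"
    and scaleC_of_real: "complex_of_real r *\<^sub>C x = r *\<^sub>R x"
    and cinner_commute: "cinner x y = cnj (cinner y x)"
    and cinner_add_left: "cinner (x + y) z = cinner x z + cinner y z"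
    and cinner_scaleC_left: "cinner (c *\<^sub>C x) y = c * cinner x y"
    and Re_cinner: "Re (cinner x y) = inner x y"

lemma norm_scaleC: "norm (c *\<^sub>C x) = cmod c * norm (x::'a::complex_hilbert_space)"
proof -
  have im: "Im (cinner x x) = 0"
    using cinner_commute[of x x] by (metis add.inverse_neutral cnj.simps(2) equal_neg_zero)
  have "cinner (c *\<^sub>C x) (c *\<^sub>C x) = c * cnj c * cinner x x"
    by (metis cinner_commute cinner_scaleC_left complex_cnj_mult mult.assoc)
  also have "c * cnj c = complex_of_real ((cmod c)\<^sup>2)"
    using complex_norm_square[of c] by simp
  finally have "inner (c *\<^sub>C x) (c *\<^sub>C x) = (cmod c)\<^sup>2 * inner x x"
    using im by (simp flip: Re_cinner)
  then show ?thesis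
    by (simp add: norm_eq_sqrt_inner real_sqrt_mult)
qed

lemma bounded_linear_scaleC: "bounded_linear (\<lambda>x::'a::complex_hilbert_space. c *\<^sub>C x)"
proof (rule bounded_linear_intro[where K = "cmod c"])
  fix r and x :: 'a
  show "c *\<^sub>C r *\<^sub>R x = r *\<^sub>R c *\<^sub>C x"
    by (metis scaleC_of_real scaleC_scaleC mult.commute)
qed (simp_all add: scaleC_add_right norm_scaleC mult.commute)

text \<open>For a Hilbert space \<open>H\<close>, the type \<open>H ^ 'n\<close> is the Hilbert space \<open>H \<otimes> \<complex>\<^sup>n\<close>.\<close>

instantiation vec :: (complex_hilbert_space, finite) complex_hilbert_space
begin

definition scaleC_vec :: "complex \<Rightarrow> 'a ^ 'b \<Rightarrow> 'a ^ 'b"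
  where "scaleC_vec c x = (\<chi> i. c *\<^sub>C x $ i)"

definition cinner_vec :: "'a ^ 'b \<Rightarrow> 'a ^ 'b \<Rightarrow> complex"
  where "cinner_vec x y = (\<Sum>i\<in>UNIV. cinner (x $ i) (y $ i))"

instance
proof
  fix c d :: complex and r :: real and x y z :: "'a ^ 'b"
  show "c *\<^sub>C (x + y) = c *\<^sub>C x + c *\<^sub>C y"
    by (simp add: scaleC_vec_def vec_eq_iff scaleC_add_right)
  show "(c + d) *\<^sub>C x = c *\<^sub>C x + d *\<^sub>C x"
    by (simp add: scaleC_vec_def vec_eq_iff scaleC_add_left)
  show "c *\<^sub>C d *\<^sub>C x = (c * d) *\<^sub>C x"
    by (simp add: scaleC_vec_def vec_eq_iff scaleC_scaleC)
  show "complex_of_real r *\<^sub>C x = r *\<^sub>R x"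
    by (simp add: scaleC_vec_def vec_eq_iff scaleC_of_real)
  show "cinner x y = cnj (cinner y x)"
    unfolding cinner_vec_def cnj_sum by (rule sum.cong[OF refl], rule cinner_commute)
  show "cinner (x + y) z = cinner x z + cinner y z"
    by (simp add: cinner_vec_def cinner_add_left sum.distrib)
  show "cinner (c *\<^sub>C x) y = c * cinner x y"
    by (simp add: cinner_vec_def scaleC_vec_def cinner_scaleC_left sum_distrib_left)
  show "Re (cinner x y) = inner x y"
    by (simp add: cinner_vec_def inner_vec_def Re_cinner)
qed

end


section \<open>Bounded operators\<close>

text \<open>
  The library's \<open>'a \<Rightarrow>\<^sub>L 'a\<close> is the type of bounded real-linear maps; \<open>bop\<close> singles out the
  complex-linear ones, that is, the algebra \<open>B(H)\<close>.
\<close>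

definition bop :: "('a::complex_hilbert_space \<Rightarrow>\<^sub>L 'a) set"
  where "bop = {T :: 'a \<Rightarrow>\<^sub>L 'a. \<forall>c x. T (c *\<^sub>C x) = c *\<^sub>C T x}"

lift_definition scale_op :: "complex \<Rightarrow> ('a::complex_hilbert_space \<Rightarrow>\<^sub>L 'a) \<Rightarrow> ('a \<Rightarrow>\<^sub>L 'a)"
  is "\<lambda>c T x. c *\<^sub>C T x"
  by (rule bounded_linear_compose[OF bounded_linear_scaleC])

definition adj :: "('a::complex_hilbert_space \<Rightarrow>\<^sub>L 'a) \<Rightarrow> ('a \<Rightarrow>\<^sub>L 'a)"
  where "adj A = (THE B :: 'a \<Rightarrow>\<^sub>L 'a. \<forall>x y. cinner (A x) y = cinner x (B y))"

definition selfadjoint :: "('a::complex_hilbert_space \<Rightarrow>\<^sub>L 'a) \<Rightarrow> bool"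
  where "selfadjoint A \<longleftrightarrow> A \<in> bop \<and> adj A = A"

definition pos_op :: "('a::complex_hilbert_space \<Rightarrow>\<^sub>L 'a) \<Rightarrow> bool"
  where "pos_op A \<longleftrightarrow> A \<in> bop \<and> (\<forall>x. cinner (A x) x \<in> \<real>\<^sub>\<ge>\<^sub>0)"

text \<open>The modulus \<open>\<bar>A\<bar>\<close>, i.e. the positive square root of \<open>A\<^sup>* A\<close>.\<close>

definition modulus :: "('a::complex_hilbert_space \<Rightarrow>\<^sub>L 'a) \<Rightarrow> ('a \<Rightarrow>\<^sub>L 'a)"
  where "modulus A = (THE S. pos_op S \<and> S o\<^sub>L S = adj A o\<^sub>L A)"

definition spectrum :: "('a::complex_hilbert_space \<Rightarrow>\<^sub>L 'a) \<Rightarrow> complex set"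
  where "spectrum A =
    {z. \<not> (\<exists>B\<in>bop. (A - scale_op z id_blinfun) o\<^sub>L B = id_blinfun \<and>
                  B o\<^sub>L (A - scale_op z id_blinfun) = id_blinfun)}"

definition poly_op :: "real poly \<Rightarrow> ('a::complex_hilbert_space \<Rightarrow>\<^sub>L 'a) \<Rightarrow> ('a \<Rightarrow>\<^sub>L 'a)"
  where "poly_op q A = (\<Sum>i\<le>degree q. coeff q i *\<^sub>R (((o\<^sub>L) A ^^ i) id_blinfun))"

text \<open>
  Continuous functional calculus \<open>f(A)\<close> of a self-adjoint \<open>A\<close>, for \<open>f\<close> real-valued and continuous
  on the spectrum: the norm limit of \<open>q\<^sub>n(A)\<close> for polynomials \<open>q\<^sub>n\<close> converging to \<open>f\<close> uniformly on
  the (real) spectrum.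
\<close>

definition cont_calculus ::
  "(real \<Rightarrow> real) \<Rightarrow> ('a::complex_hilbert_space \<Rightarrow>\<^sub>L 'a) \<Rightarrow> ('a \<Rightarrow>\<^sub>L 'a)"
  where "cont_calculus f A =
    (THE T. \<forall>q. uniform_limit {t. complex_of_real t \<in> spectrum A} (\<lambda>n. poly (q n)) f sequentially
              \<longrightarrow> (\<lambda>n. poly_op (q n) A) \<longlonglongrightarrow> T)"


section \<open>Finite factors\<close>

definition commutant :: "('a::complex_hilbert_space \<Rightarrow>\<^sub>L 'a) set \<Rightarrow> ('a \<Rightarrow>\<^sub>L 'a) set"
  where "commutant S = {T \<in> bop. \<forall>A\<in>S. T o\<^sub>L A = A o\<^sub>L T}"

definition von_neumann_algebra :: "('a::complex_hilbert_space \<Rightarrow>\<^sub>L 'a) set \<Rightarrow> bool"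
  where "von_neumann_algebra M \<longleftrightarrow>
    M \<subseteq> bop \<and> (\<forall>A\<in>M. adj A \<in> M) \<and> commutant (commutant M) = M"

definition factor :: "('a::complex_hilbert_space \<Rightarrow>\<^sub>L 'a) set \<Rightarrow> bool"
  where "factor M \<longleftrightarrow>
    von_neumann_algebra M \<and> M \<inter> commutant M = range (\<lambda>c. scale_op c id_blinfun)"

text \<open>
  Functionals on \<open>M\<close> are \<open>extensional\<close> (equal to \<open>undefined\<close> outside \<open>M\<close>), so that two of them
  are equal as soon as they agree on \<open>M\<close>.
\<close>

definition tracial_state ::
  "('a::complex_hilbert_space \<Rightarrow>\<^sub>L 'a) set \<Rightarrow> (('a \<Rightarrow>\<^sub>L 'a) \<Rightarrow> complex) \<Rightarrow> bool"
  where "tracial_state M \<tau> \<longleftrightarrow>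
    \<tau> \<in> extensional M \<and>
    (\<forall>A\<in>M. \<forall>B\<in>M. \<tau> (A + B) = \<tau> A + \<tau> B) \<and>
    (\<forall>c. \<forall>A\<in>M. \<tau> (scale_op c A) = c * \<tau> A) \<and>
    (\<forall>A\<in>M. pos_op A \<longrightarrow> \<tau> A \<in> \<real>\<^sub>\<ge>\<^sub>0) \<and>
    \<tau> id_blinfun = 1 \<and>
    (\<forall>A\<in>M. \<forall>B\<in>M. \<tau> (A o\<^sub>L B) = \<tau> (B o\<^sub>L A))"

definition faithful ::
  "('a::complex_hilbert_space \<Rightarrow>\<^sub>L 'a) set \<Rightarrow> (('a \<Rightarrow>\<^sub>L 'a) \<Rightarrow> complex) \<Rightarrow> bool"
  where "faithful M \<tau> \<longleftrightarrow> (\<forall>A\<in>M. pos_op A \<and> \<tau> A = 0 \<longrightarrow> A = 0)"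

text \<open>
  Supremum of a set \<open>D\<close> of self-adjoint elements of \<open>M\<close>, for the order \<open>A \<le> B\<close> iff \<open>B - A\<close> is
  positive.
\<close>

definition is_op_sup ::
  "('a::complex_hilbert_space \<Rightarrow>\<^sub>L 'a) set \<Rightarrow> ('a \<Rightarrow>\<^sub>L 'a) set \<Rightarrow> ('a \<Rightarrow>\<^sub>L 'a) \<Rightarrow> bool"
  where "is_op_sup M D S \<longleftrightarrow>
    S \<in> M \<and> selfadjoint S \<and> (\<forall>A\<in>D. pos_op (S - A)) \<and>
    (\<forall>B\<in>M. selfadjoint B \<and> (\<forall>A\<in>D. pos_op (B - A)) \<longrightarrow> pos_op (B - S))"

text \<open>
  Normality: suprema of upward directed bounded sets (equivalently, of bounded increasing nets) of
  self-adjoint elements are preserved. On self-adjoint elements a state is real-valued.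
\<close>

definition normal_functional ::
  "('a::complex_hilbert_space \<Rightarrow>\<^sub>L 'a) set \<Rightarrow> (('a \<Rightarrow>\<^sub>L 'a) \<Rightarrow> complex) \<Rightarrow> bool"
  where "normal_functional M \<tau> \<longleftrightarrow>
    (\<forall>D S. D \<noteq> {} \<and> D \<subseteq> {A \<in> M. selfadjoint A} \<and>
        (\<forall>A\<in>D. \<forall>B\<in>D. \<exists>C\<in>D. pos_op (C - A) \<and> pos_op (C - B)) \<and> is_op_sup M D S
      \<longrightarrow> Re (\<tau> S) = (SUP A\<in>D. Re (\<tau> A)))"

definition normal_trace ::
  "('a::complex_hilbert_space \<Rightarrow>\<^sub>L 'a) set \<Rightarrow> (('a \<Rightarrow>\<^sub>L 'a) \<Rightarrow> complex) \<Rightarrow> bool"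
  where "normal_trace M \<tau> \<longleftrightarrow> tracial_state M \<tau> \<and> faithful M \<tau> \<and> normal_functional M \<tau>"

text \<open>
  On a factor a tracial state is unique whenever it exists, so \<open>\<exists>!\<close> describes the same class of
  algebras as mere existence.
\<close>

definition finite_factor :: "('a::complex_hilbert_space \<Rightarrow>\<^sub>L 'a) set \<Rightarrow> bool"
  where "finite_factor M \<longleftrightarrow> factor M \<and> (\<exists>!\<tau>. normal_trace M \<tau>)"

definition factor_trace :: "('a::complex_hilbert_space \<Rightarrow>\<^sub>L 'a) set \<Rightarrow> ('a \<Rightarrow>\<^sub>L 'a) \<Rightarrow> complex"
  where "factor_trace M = (THE \<tau>. normal_trace M \<tau>)"

definition Lp_norm ::
  "real \<Rightarrow> ('a::complex_hilbert_space \<Rightarrow>\<^sub>L 'a) set \<Rightarrow> ('a \<Rightarrow>\<^sub>L 'a) \<Rightarrow> real"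
  where "Lp_norm p M A =
    Re (factor_trace M (cont_calculus (\<lambda>t. t powr p) (modulus A))) powr (1 / p)"

definition unitaries :: "('a::complex_hilbert_space \<Rightarrow>\<^sub>L 'a) set \<Rightarrow> ('a \<Rightarrow>\<^sub>L 'a) set"
  where "unitaries M = {U \<in> M. adj U o\<^sub>L U = id_blinfun \<and> U o\<^sub>L adj U = id_blinfun}"

definition half_projections :: "('a::complex_hilbert_space \<Rightarrow>\<^sub>L 'a) set \<Rightarrow> ('a \<Rightarrow>\<^sub>L 'a) set"
  where "half_projections M = {P \<in> M. adj P = P \<and> P o\<^sub>L P = P \<and> factor_trace M P = 1 / 2}"

definition Lp_isometry_on ::
  "real \<Rightarrow> ('a::complex_hilbert_space \<Rightarrow>\<^sub>L 'a) set \<Rightarrow> ('b::complex_hilbert_space \<Rightarrow>\<^sub>L 'b) set \<Rightarrow>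
    ('a \<Rightarrow>\<^sub>L 'a) set \<Rightarrow> (('a \<Rightarrow>\<^sub>L 'a) \<Rightarrow> ('b \<Rightarrow>\<^sub>L 'b)) \<Rightarrow> bool"
  where "Lp_isometry_on p M1 M2 X f \<longleftrightarrow>
    (\<forall>A\<in>X. \<forall>B\<in>X. Lp_norm p M1 (A - B) = Lp_norm p M2 (f A - f B))"


section \<open>Tensor products with matrix algebras\<close>

text \<open>The operator \<open>A \<otimes> m\<close> on \<open>H \<otimes> \<complex>\<^sup>n\<close>.\<close>

lift_definition op_tensor ::
  "('a::complex_hilbert_space \<Rightarrow>\<^sub>L 'a) \<Rightarrow> complex ^ 'n ^ 'n \<Rightarrow> (('a ^ 'n) \<Rightarrow>\<^sub>L ('a ^ 'n))"
  (infixl \<open>\<otimes>\<^sub>o\<close> 70)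
  is "\<lambda>A m x. \<chi> i. \<Sum>j\<in>UNIV. m $ i $ j *\<^sub>C A (x $ j)"
proof -
  fix A :: "'a \<Rightarrow> 'a" and m :: "complex ^ 'n ^ 'n"
  assume A: "bounded_linear A"
  have comp: "bounded_linear (\<lambda>x. \<Sum>j\<in>UNIV. m $ i $ j *\<^sub>C A (x $ j))" for i
    by (intro bounded_linear_sum bounded_linear_compose[OF bounded_linear_scaleC]
        bounded_linear_compose[OF A] bounded_linear_vec_nth)
  have lin: "linear (\<lambda>x. \<chi> i. \<Sum>j\<in>UNIV. m $ i $ j *\<^sub>C A (x $ j))"
    using linear_add[OF bounded_linear.linear[OF comp]] linear_scale[OF bounded_linear.linear[OF comp]]
    by (intro linearI) (simp_all add: vec_eq_iff)
  have "norm (\<chi> i. \<Sum>j\<in>UNIV. m $ i $ j *\<^sub>C A (x $ j))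
      \<le> norm x * (\<Sum>i\<in>UNIV. onorm (\<lambda>x. \<Sum>j\<in>UNIV. m $ i $ j *\<^sub>C A (x $ j)))" for x
  proof -
    let ?y = "\<chi> i. \<Sum>j\<in>UNIV. m $ i $ j *\<^sub>C A (x $ j)"
    have "norm ?y \<le> (\<Sum>i\<in>UNIV. norm (?y $ i))"
      unfolding norm_vec_def by (rule L2_set_le_sum) simp
    also have "\<dots> \<le> (\<Sum>i\<in>UNIV. onorm (\<lambda>x. \<Sum>j\<in>UNIV. m $ i $ j *\<^sub>C A (x $ j)) * norm x)"
      by (rule sum_mono) (simp add: onorm[OF comp])
    finally show ?thesis
      by (simp add: sum_distrib_left mult.commute)
  qed
  then show "bounded_linear (\<lambda>x. \<chi> i. \<Sum>j\<in>UNIV. m $ i $ j *\<^sub>C A (x $ j))"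
    by (rule bounded_linear_intro[OF linear_add[OF lin] linear_scale[OF lin]])
qed

definition E :: "'n \<Rightarrow> 'n \<Rightarrow> complex ^ 'n ^ 'n"
  where "E a b = (\<chi> i j. if i = a \<and> j = b then 1 else 0)"

text \<open>
  \<open>N \<otimes> M\<^sub>n(\<complex>)\<close>. As the matrix algebra is finite-dimensional, the algebraic tensor product is already
  the von Neumann algebra tensor product.
\<close>

definition tensor_matrices ::
  "('a::complex_hilbert_space \<Rightarrow>\<^sub>L 'a) set \<Rightarrow> (('a ^ 'n) \<Rightarrow>\<^sub>L ('a ^ 'n)) set"
  where "tensor_matrices N =
    {\<Sum>a\<in>UNIV. \<Sum>b\<in>UNIV. A a b \<otimes>\<^sub>o E a b | A. \<forall>a b. A a b \<in> N}"

end

theory Submission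
  imports Defs "HOL-Computational_Algebra.Fundamental_Theorem_Algebra"
begin

text \<open>
  Let \<open>P\<close>, \<open>Q\<close> be projections of trace \<open>1/2\<close> and \<open>X = (P - Q)\<^sup>2\<close>, so that \<open>(P - (1 - Q))\<^sup>2 = 1 - X\<close> and
  \<open>\<parallel>P - Q\<parallel>\<^sub>p\<^sup>p = \<tau>(X\<^sup>q)\<close> with \<open>q = p/2\<close>. Comparing \<open>2 \<times> 2\<close> matrices, the projections of the form in the
  theorem are exactly those with \<open>X = 1/2\<close> for \<open>Q = I \<otimes> E\<^sub>1\<^sub>1\<close>, and this relation between \<open>P\<close> and \<open>Q\<close>
  is visible from distances alone. For \<open>p \<noteq> 2\<close> the function \<open>t\<^sup>q + (1 - t)\<^sup>q\<close> has a strict extremum at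
  \<open>1/2\<close>, so \<open>X = 1/2\<close> iff \<open>\<parallel>P - Q\<parallel>\<^sub>p\<^sup>p + \<parallel>P - (1 - Q)\<parallel>\<^sub>p\<^sup>p = 2 (1/2)\<^sup>q\<close>; and \<open>1 - Q\<close> is the only
  projection at distance \<open>1\<close> from \<open>Q\<close>. For \<open>p = 2\<close>, \<open>X = 1/2\<close> iff the normalised midpoint of the symmetries
  \<open>2P - 1\<close> and \<open>2Q - 1\<close> is again a symmetry, which is a condition on distances in the Hilbert space
  \<open>L\<^sup>2\<close>. Hence \<open>\<phi>\<close> permutes these projections and induces \<open>\<psi>\<close>; it is isometric because the square
  of the difference of two of them has the moments of \<open>\<bar>V - W\<bar>\<^sup>2 / 4\<close>.

  Values \<open>\<tau>(f(X))\<close> are handled as limits of \<open>\<tau>(q\<^sub>n(X))\<close> for polynomials \<open>q\<^sub>n\<close>. The uniqueness of the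
  normal trace on \<open>N \<otimes> M\<^sub>2\<close> is inherited from \<open>N\<close>; transferring normality between the two algebras
  needs that directed suprema are strong limits.
\<close>

section \<open>Operators on complex Hilbert spaces\<close>

lemmas blinfun_simps = blinfun.add_left blinfun.add_right blinfun.diff_left blinfun.diff_right
  blinfun.minus_left blinfun.minus_right blinfun.scaleR_left blinfun.scaleR_right

lemma cinner_scaleC_right: "cinner x (c *\<^sub>C y) = cnj c * cinner x y"
  by (metis cinner_scaleC_left cinner_commute complex_cnj_mult)

lemma scaleC_one [simp]: "1 *\<^sub>C x = x"
  using scaleC_of_real[of 1 x] by simp

lemma Im_cinner: "Im (cinner x y) = - ((\<i> *\<^sub>C x) \<bullet> y)"
  by (simp flip: Re_cinner add: cinner_scaleC_left)

lemma inner_scaleC_ii: "x \<bullet> (\<i> *\<^sub>C y) = - ((\<i> *\<^sub>C x) \<bullet> y)"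
  by (simp flip: Re_cinner add: cinner_scaleC_left cinner_scaleC_right)

lemma cinner_eqI:
  assumes "x \<bullet> y = z \<bullet> w" "(\<i> *\<^sub>C x) \<bullet> y = (\<i> *\<^sub>C z) \<bullet> w"
  shows "cinner x y = cinner z w"
  using assms by (simp add: complex_eq_iff Im_cinner Re_cinner)

lemma scaleR_scaleC: "r *\<^sub>R x = complex_of_real r *\<^sub>C x"
  by (simp add: scaleC_of_real)

lemma scaleC_scaleR_commute: "c *\<^sub>C r *\<^sub>R x = r *\<^sub>R c *\<^sub>C x"
  by (simp add: scaleR_scaleC scaleC_scaleC mult.commute)

lemma scaleC_zero_right [simp]: "c *\<^sub>C 0 = 0"
  using scaleC_scaleR_commute[of c 0 0] by simp

lemma scaleC_zero_left [simp]: "0 *\<^sub>C x = 0"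
  using scaleC_of_real[of 0 x] by simp

lemma scaleC_cartesian: "c *\<^sub>C x = Re c *\<^sub>R x + Im c *\<^sub>R \<i> *\<^sub>C x"
proof -
  have "c = of_real (Re c) + of_real (Im c) * \<i>"
    by (simp add: complex_eq_iff)
  then have "c *\<^sub>C x = (of_real (Re c) + of_real (Im c) * \<i>) *\<^sub>C x" by simp
  then show ?thesis
    by (simp only: scaleC_add_left scaleC_scaleC[symmetric] scaleC_of_real)
qed

lemma bop_iff_ii: "A \<in> bop \<longleftrightarrow> (\<forall>x. A (\<i> *\<^sub>C x) = \<i> *\<^sub>C A x)"
proof
  assume *: "\<forall>x. A (\<i> *\<^sub>C x) = \<i> *\<^sub>C A x"
  show "A \<in> bop"
    unfolding bop_def mem_Collect_eq
  proof (intro allI)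
    fix c x show "A (c *\<^sub>C x) = c *\<^sub>C A x"
      using * by (simp add: scaleC_cartesian[of c] blinfun_simps)
  qed
qed (simp add: bop_def)

lemma bop_scaleC: "A \<in> bop \<Longrightarrow> A (c *\<^sub>C x) = c *\<^sub>C A x"
  by (simp add: bop_def)

lemma bop_add: "A \<in> bop \<Longrightarrow> B \<in> bop \<Longrightarrow> A + B \<in> bop"
  by (simp add: bop_def blinfun_simps scaleC_add_right)

lemma bop_scaleR: "A \<in> bop \<Longrightarrow> r *\<^sub>R A \<in> bop"
  by (simp add: bop_def blinfun_simps scaleC_scaleR_commute)

lemma bop_uminus: "A \<in> bop \<Longrightarrow> - A \<in> bop"
  using bop_scaleR[of A "-1"] by simp

lemma bop_diff: "A \<in> bop \<Longrightarrow> B \<in> bop \<Longrightarrow> A - B \<in> bop"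
  using bop_add[of A "-B"] bop_uminus[of B] by simp

lemma bop_compose: "A \<in> bop \<Longrightarrow> B \<in> bop \<Longrightarrow> A o\<^sub>L B \<in> bop"
  by (simp add: bop_def)

lemma bop_id [simp]: "id_blinfun \<in> bop"
  by (simp add: bop_def)

lemma bop_zero [simp]: "0 \<in> bop"
  by (simp add: bop_def)

lemma bop_scale_op: "A \<in> bop \<Longrightarrow> scale_op c A \<in> bop"
  by (simp add: bop_def scale_op.rep_eq scaleC_scaleC mult.commute)

lemma scale_op_of_real: "scale_op (complex_of_real r) A = r *\<^sub>R A"
  by (rule blinfun_eqI) (simp add: scale_op.rep_eq scaleC_of_real blinfun_simps)

lemma bop_limit:
  assumes "\<And>n. A n \<in> bop" "A \<longlonglongrightarrow> B"
  shows "B \<in> bop"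
  unfolding bop_iff_ii
proof
  fix x
  have "(\<lambda>n. A n (\<i> *\<^sub>C x)) \<longlonglongrightarrow> B (\<i> *\<^sub>C x)"
    by (intro tendsto_intros assms)
  moreover have "(\<lambda>n. \<i> *\<^sub>C A n x) \<longlonglongrightarrow> \<i> *\<^sub>C B x"
    by (intro bounded_linear.tendsto[OF bounded_linear_scaleC] tendsto_intros assms)
  ultimately show "B (\<i> *\<^sub>C x) = \<i> *\<^sub>C B x"
    using assms(1) by (simp add: bop_scaleC LIMSEQ_unique)
qed

text \<open>Minimise \<open>\<parallel>x\<parallel>\<^sup>2 / 2 - f x\<close>: the parallelogram law makes minimising sequences Cauchy.\<close>

lemma riesz_representation:
  fixes f :: "'a::{real_inner, complete_space} \<Rightarrow> real"
  assumes "bounded_linear f"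
  shows "\<exists>y. \<forall>x. f x = x \<bullet> y"
proof -
  interpret f: bounded_linear f by fact
  define g where "g x = (norm x)\<^sup>2 / 2 - f x" for x
  obtain K where K: "\<And>x. \<bar>f x\<bar> \<le> norm x * K"
    using f.bounded by auto
  have gK: "- (K\<^sup>2 / 2) \<le> g x" for x
  proof -
    have "0 \<le> (norm x - K)\<^sup>2" by simp
    then show ?thesis using K[of x] by (simp add: g_def power2_eq_square algebra_simps)
  qed
  define m where "m = Inf (range g)"
  have bdd: "bdd_below (range g)"
    using gK by (auto simp: bdd_below_def)
  have m: "m \<le> g x" for x
    unfolding m_def by (rule cInf_lower[OF _ bdd]) simp
  have "\<exists>x. g x < m + inverse (Suc n)" for n
  proof -
    have "m < m + inverse (Suc n)" by simp
    then show ?thesis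
      unfolding m_def using cInf_lessD[of "range g"] by auto
  qed
  then obtain X where X: "\<And>n. g (X n) < m + inverse (Suc n)" by metis
  have par: "(norm (x - y))\<^sup>2 \<le> 4 * (g x - m) + 4 * (g y - m)" for x y
  proof -
    have "(norm (x - y))\<^sup>2 = 4 * g x + 4 * g y - 8 * g ((1/2) *\<^sub>R (x + y))"
      unfolding g_def power2_norm_eq_inner f.add f.scaleR
      by (simp add: inner_add_left inner_add_right inner_diff_left inner_diff_right inner_commute f.add
          field_simps)
    then show ?thesis using m[of "(1/2) *\<^sub>R (x + y)"] by simp
  qed
  have "Cauchy X"
  proof (rule metric_CauchyI)
    fix e :: real assume e: "0 < e"
    obtain N where N: "inverse (real (Suc N)) < e\<^sup>2 / 8"
      using reals_Archimedean[of "e\<^sup>2/8"] e by auto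
    have small: "g (X n) - m < e\<^sup>2 / 8" if "n \<ge> N" for n
    proof -
      have "inverse (real (Suc n)) \<le> inverse (real (Suc N))" using that by simp
      then show ?thesis using X[of n] N by linarith
    qed
    show "\<exists>M. \<forall>m\<ge>M. \<forall>n\<ge>M. dist (X m) (X n) < e"
    proof (intro exI allI impI)
      fix a b assume "a \<ge> N" "b \<ge> N"
      then have "(norm (X a - X b))\<^sup>2 < e\<^sup>2"
        using par[of "X a" "X b"] small[of a] small[of b] by simp
      then show "dist (X a) (X b) < e"
        using e unfolding dist_norm by (rule power_less_imp_less_base[OF _ less_imp_le])
    qed
  qed
  then obtain y where y: "X \<longlonglongrightarrow> y"
    using Cauchy_convergent convergent_def by blast
  have gy: "(\<lambda>n. g (X n)) \<longlonglongrightarrow> g y"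
    unfolding g_def by (intro tendsto_intros y f.tendsto) simp
  moreover have "(\<lambda>n. m + inverse (real (Suc n))) \<longlonglongrightarrow> m"
    using LIMSEQ_inverse_real_of_nat_add by simp
  ultimately have "g y \<le> m"
    by (intro LIMSEQ_le) (use X in \<open>auto intro!: exI less_imp_le\<close>)
  then have min: "g y \<le> g x" for x using m[of x] by linarith
  have "f h = h \<bullet> y" for h
  proof -
    define d where "d = h \<bullet> y - f h"
    define t where "t = - d / (1 + (norm h)\<^sup>2)"
    have pos: "1 + (norm h)\<^sup>2 > 0" by (simp add: add_pos_nonneg)
    have "t * (1 + (norm h)\<^sup>2) = - d"
      using pos by (simp add: t_def)
    then have t2: "t\<^sup>2 * (1 + (norm h)\<^sup>2) = - (d * t)"
      by (simp add: power2_eq_square[of t] mult.assoc)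
    have "g (y + t *\<^sub>R h) = g y + t * d + t\<^sup>2 * (norm h)\<^sup>2 / 2"
      unfolding g_def d_def power2_norm_eq_inner f.add f.scaleR
      by (simp add: inner_add_left inner_add_right inner_commute power2_eq_square field_simps)
    then have "0 \<le> t * d + t\<^sup>2 * (norm h)\<^sup>2 / 2" using min[of "y + t *\<^sub>R h"] by simp
    also have "\<dots> \<le> t * d + t\<^sup>2 * (1 + (norm h)\<^sup>2) / 2" by (simp add: algebra_simps)
    also have "\<dots> = - (d\<^sup>2 / (1 + (norm h)\<^sup>2)) / 2"
    proof -
      have "d\<^sup>2 / (1 + (norm h)\<^sup>2) = - (t * d)"
        by (simp add: t_def power2_eq_square)
      then show ?thesis by (simp add: t2)
    qed
    finally have "0 \<le> - (d\<^sup>2 / (1 + (norm h)\<^sup>2)) / 2" .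
    moreover have "w \<le> 0" if "0 \<le> - w / 2" for w :: real
      using that by simp
    ultimately have "d\<^sup>2 / (1 + (norm h)\<^sup>2) \<le> 0" by blast
    then have "d\<^sup>2 \<le> 0" using pos by (simp add: divide_le_0_iff)
    then show ?thesis by (simp add: d_def)
  qed
  then show ?thesis by blast
qed

lemma adjoint_exists:
  fixes A :: "'a::{real_inner, complete_space} \<Rightarrow>\<^sub>L 'a"
  shows "\<exists>B :: 'a \<Rightarrow>\<^sub>L 'a. \<forall>x y. A x \<bullet> y = x \<bullet> B y"
proof -
  have "\<exists>z. \<forall>x. A x \<bullet> y = x \<bullet> z" for y
    by (rule riesz_representation)
      (intro bounded_linear_compose[OF bounded_linear_inner_left] blinfun.bounded_linear_right)
  then obtain b where b: "\<And>x y. A x \<bullet> y = x \<bullet> b y" by metis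
  have "bounded_linear b"
  proof (rule bounded_linear_intro[where K = "norm A"])
    show "b (x + y) = b x + b y" for x y
      by (rule vector_eq_rdot[THEN iffD1]) (metis b inner_add_right inner_commute)
    show "b (r *\<^sub>R x) = r *\<^sub>R b x" for r x
      by (rule vector_eq_rdot[THEN iffD1]) (metis b inner_scaleR_right inner_commute)
    show "norm (b x) \<le> norm x * norm A" for x
    proof -
      have "norm (b x) * norm (b x) = A (b x) \<bullet> x"
        by (simp add: b dot_square_norm power2_eq_square)
      also have "\<dots> \<le> norm A * norm (b x) * norm x"
        using norm_cauchy_schwarz[of "A (b x)" x] norm_blinfun[of A "b x"]
        by (meson mult_right_mono norm_ge_zero order_trans)
      finally show ?thesis
        by (cases "b x = 0") (simp_all add: mult.assoc mult.left_commute, simp add: mult.commute)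
    qed
  qed
  then show ?thesis
    using b by (intro exI[of _ "Blinfun b"]) (simp add: bounded_linear_Blinfun_apply)
qed

lemma adj_unique:
  fixes A B :: "'a::complex_hilbert_space \<Rightarrow>\<^sub>L 'a"
  assumes "\<And>x y. cinner (A x) y = cinner x (B y)"
  shows "adj A = B"
  unfolding adj_def
proof (rule the_equality)
  show "\<forall>x y. cinner (A x) y = cinner x (B y)" using assms by blast
  fix C :: "'a \<Rightarrow>\<^sub>L 'a" assume C: "\<forall>x y. cinner (A x) y = cinner x (C y)"
  show "C = B"
  proof (rule blinfun_eqI)
    fix y
    have "x \<bullet> C y = x \<bullet> B y" for x
      using assms C by (metis Re_cinner)
    then show "C y = B y"
      using vector_eq_ldot by blast
  qed
qed

lemma adj_uniqueI:
  fixes A B :: "'a::complex_hilbert_space \<Rightarrow>\<^sub>L 'a"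
  assumes "A \<in> bop" "\<And>x y. A x \<bullet> y = x \<bullet> B y"
  shows "adj A = B"
proof (rule adj_unique)
  fix x y show "cinner (A x) y = cinner x (B y)"
    by (rule cinner_eqI) (simp_all add: assms(2) flip: bop_scaleC[OF assms(1)])
qed

lemma inner_adj: "A \<in> bop \<Longrightarrow> A x \<bullet> y = x \<bullet> adj A y"
  using adjoint_exists[of A] adj_uniqueI[of A] by blast

lemma inner_adj': "A \<in> bop \<Longrightarrow> adj A x \<bullet> y = x \<bullet> A y"
  by (metis inner_adj inner_commute)

lemma bop_adj:
  assumes "A \<in> bop"
  shows "adj A \<in> bop"
  unfolding bop_iff_ii
proof
  fix y
  have "x \<bullet> adj A (\<i> *\<^sub>C y) = x \<bullet> \<i> *\<^sub>C adj A y" for x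
    using assms by (simp add: inner_adj[symmetric] inner_scaleC_ii flip: bop_scaleC)
  then show "adj A (\<i> *\<^sub>C y) = \<i> *\<^sub>C adj A y"
    using vector_eq_ldot by blast
qed

lemma adj_adj: "A \<in> bop \<Longrightarrow> adj (adj A) = A"
  by (rule adj_uniqueI) (simp_all add: bop_adj inner_adj')

lemma adj_compose: "A \<in> bop \<Longrightarrow> B \<in> bop \<Longrightarrow> adj (A o\<^sub>L B) = adj B o\<^sub>L adj A"
  by (rule adj_uniqueI) (simp_all add: bop_compose inner_adj)

lemma adj_diff: "A \<in> bop \<Longrightarrow> B \<in> bop \<Longrightarrow> adj (A - B) = adj A - adj B"
  by (rule adj_uniqueI) (simp_all add: bop_diff inner_adj blinfun_simps inner_diff_left inner_diff_right)

lemma adj_scaleR: "A \<in> bop \<Longrightarrow> adj (r *\<^sub>R A) = r *\<^sub>R adj A"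
  by (rule adj_uniqueI) (simp_all add: bop_scaleR inner_adj blinfun_simps)

lemma adj_id [simp]: "adj id_blinfun = id_blinfun"
  by (rule adj_uniqueI) simp_all

lemma adj_zero [simp]: "adj 0 = 0"
  by (rule adj_uniqueI) simp_all

definition symmetric_op :: "('a::real_inner \<Rightarrow>\<^sub>L 'a) \<Rightarrow> bool"
  where "symmetric_op A \<longleftrightarrow> (\<forall>x y. A x \<bullet> y = x \<bullet> A y)"

lemma selfadjoint_iff: "selfadjoint A \<longleftrightarrow> A \<in> bop \<and> symmetric_op A"
  unfolding selfadjoint_def symmetric_op_def
  using adj_uniqueI inner_adj by metis

lemma symmetric_op_id [simp]: "symmetric_op id_blinfun"
  by (simp add: symmetric_op_def)

lemma symmetric_op_zero [simp]: "symmetric_op 0"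
  by (simp add: symmetric_op_def)

lemma symmetric_op_add: "symmetric_op A \<Longrightarrow> symmetric_op B \<Longrightarrow> symmetric_op (A + B)"
  by (simp add: symmetric_op_def blinfun_simps inner_add_left inner_add_right)

lemma symmetric_op_diff: "symmetric_op A \<Longrightarrow> symmetric_op B \<Longrightarrow> symmetric_op (A - B)"
  by (simp add: symmetric_op_def blinfun_simps inner_diff_left inner_diff_right)

lemma symmetric_op_scaleR: "symmetric_op A \<Longrightarrow> symmetric_op (r *\<^sub>R A)"
  by (simp add: symmetric_op_def blinfun_simps)

lemma symmetric_op_limit:
  assumes "\<And>n. symmetric_op (A n)" "A \<longlonglongrightarrow> B"
  shows "symmetric_op B"
  unfolding symmetric_op_def
proof (intro allI)
  fix x y
  have "(\<lambda>n. A n x \<bullet> y) \<longlonglongrightarrow> B x \<bullet> y" "(\<lambda>n. x \<bullet> A n y) \<longlonglongrightarrow> x \<bullet> B y"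
    by (intro tendsto_intros assms)+
  then show "B x \<bullet> y = x \<bullet> B y"
    using assms(1) by (simp add: symmetric_op_def LIMSEQ_unique)
qed

lemma pos_op_iff:
  "pos_op G \<longleftrightarrow> G \<in> bop \<and> symmetric_op G \<and> (\<forall>x. 0 \<le> G x \<bullet> x)"
proof
  assume G: "pos_op G"
  then have b: "G \<in> bop" and re: "\<And>x. 0 \<le> G x \<bullet> x" and im: "\<And>x. G (\<i> *\<^sub>C x) \<bullet> x = 0"
    by (auto simp: pos_op_def complex_nonneg_Reals_iff Re_cinner Im_cinner bop_scaleC)
  have skew: "G (\<i> *\<^sub>C x) \<bullet> y = - (G (\<i> *\<^sub>C y) \<bullet> x)" for x y
    using im[of "x + y"] im[of x] im[of y]
    by (simp add: scaleC_add_right blinfun_simps inner_add_left inner_add_right)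
  have "G x \<bullet> y = x \<bullet> G y" for x y
  proof -
    have "G x = - G (\<i> *\<^sub>C \<i> *\<^sub>C x)"
      using scaleC_of_real[of "-1" x] by (simp add: scaleC_scaleC blinfun_simps)
    then have "G x \<bullet> y = G (\<i> *\<^sub>C y) \<bullet> (\<i> *\<^sub>C x)"
      using skew[of "\<i> *\<^sub>C x" y] by simp
    also have "\<dots> = G y \<bullet> x"
      using b by (simp add: bop_scaleC inner_scaleC_ii scaleC_scaleC scaleC_of_real[of "-1", simplified])
    finally show ?thesis by (simp add: inner_commute)
  qed
  then show "G \<in> bop \<and> symmetric_op G \<and> (\<forall>x. 0 \<le> G x \<bullet> x)"
    using b re by (simp add: symmetric_op_def)
next
  assume G: "G \<in> bop \<and> symmetric_op G \<and> (\<forall>x. 0 \<le> G x \<bullet> x)"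
  have "(\<i> *\<^sub>C G x) \<bullet> x = 0" for x
  proof -
    have "(\<i> *\<^sub>C G x) \<bullet> x = (\<i> *\<^sub>C x) \<bullet> G x"
      using G by (metis bop_scaleC symmetric_op_def)
    moreover have "(\<i> *\<^sub>C x) \<bullet> G x = - ((\<i> *\<^sub>C G x) \<bullet> x)"
      using inner_scaleC_ii by (metis inner_commute)
    ultimately show ?thesis by simp
  qed
  then show "pos_op G"
    using G by (auto simp: pos_op_def complex_nonneg_Reals_iff Re_cinner Im_cinner)
qed

lemma pos_op_bop: "pos_op G \<Longrightarrow> G \<in> bop"
  and pos_op_symmetric: "pos_op G \<Longrightarrow> symmetric_op G"
  and pos_op_nonneg: "pos_op G \<Longrightarrow> 0 \<le> G x \<bullet> x"
  by (simp_all add: pos_op_iff)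

lemma pos_op_adj_compose: "A \<in> bop \<Longrightarrow> pos_op (adj A o\<^sub>L A)"
  by (simp add: pos_op_iff bop_compose bop_adj symmetric_op_def inner_adj' inner_adj[symmetric])

lemma pos_op_square: "A \<in> bop \<Longrightarrow> symmetric_op A \<Longrightarrow> pos_op (A o\<^sub>L A)"
  by (simp add: pos_op_iff bop_compose symmetric_op_def) (metis inner_ge_zero)

lemma pos_op_add: "pos_op A \<Longrightarrow> pos_op B \<Longrightarrow> pos_op (A + B)"
  by (simp add: pos_op_iff bop_add symmetric_op_add blinfun_simps inner_add_left)

lemma pos_op_limit:
  assumes "\<And>n. pos_op (A n)" "A \<longlonglongrightarrow> B"
  shows "pos_op B"
  unfolding pos_op_iff
proof (intro conjI allI)
  show "B \<in> bop" "symmetric_op B"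
    using assms by (auto intro: bop_limit symmetric_op_limit simp: pos_op_iff)
  fix x
  have "(\<lambda>n. A n x \<bullet> x) \<longlonglongrightarrow> B x \<bullet> x"
    by (intro tendsto_intros assms)
  then show "0 \<le> B x \<bullet> x"
    using assms(1) by (auto intro!: LIMSEQ_le_const simp: pos_op_iff)
qed

lemma pos_op_antisym:
  assumes "pos_op (A - B)" "pos_op (B - A)"
  shows "A = B"
proof -
  let ?G = "A - B"
  have z: "?G x \<bullet> x = 0" for x
    using pos_op_nonneg[OF assms(1), of x] pos_op_nonneg[OF assms(2), of x]
    by (simp add: blinfun_simps inner_diff_left)
  have s: "symmetric_op ?G" using assms pos_op_symmetric by blast
  have "?G x \<bullet> y = 0" for x y
  proof -
    have "?G y \<bullet> x = ?G x \<bullet> y"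
      using s by (metis inner_commute symmetric_op_def)
    moreover have "?G x \<bullet> x + ?G x \<bullet> y + (?G y \<bullet> x + ?G y \<bullet> y) = 0"
      using z[of "x + y"] unfolding blinfun.add_right inner_add_left inner_add_right by linarith
    ultimately show ?thesis using z[of x] z[of y] by linarith
  qed
  then have "?G x = 0" for x
    by (metis inner_eq_zero_iff)
  then show ?thesis
    by (intro blinfun_eqI) (simp add: blinfun_simps)
qed

lemma pos_op_cauchy_schwarz:
  assumes "pos_op G"
  shows "(G x \<bullet> y)\<^sup>2 \<le> (G x \<bullet> x) * (G y \<bullet> y)"
proof -
  let ?a = "G x \<bullet> x" and ?b = "G x \<bullet> y" and ?c = "G y \<bullet> y"
  have sym: "G y \<bullet> x = ?b"
    using assms by (metis inner_commute pos_op_symmetric symmetric_op_def)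
  have q: "0 \<le> ?a + 2 * t * ?b + t\<^sup>2 * ?c" for t
    using pos_op_nonneg[OF assms, of "x + t *\<^sub>R y"] sym
    by (simp add: blinfun_simps inner_add_left inner_add_right power2_eq_square algebra_simps)
  show ?thesis
  proof (cases "?c = 0")
    case True
    have "?b = 0"
    proof (rule ccontr)
      assume "?b \<noteq> 0"
      then show False
        using q[of "- (?a + 1) / (2 * ?b)"] True by (simp add: field_simps)
    qed
    then show ?thesis using True by simp
  next
    case False
    then have "?c > 0" using pos_op_nonneg[OF assms, of y] by simp
    then show ?thesis
      using q[of "- ?b / ?c"] by (simp add: field_simps power2_eq_square)
  qed
qed

lemma norm_le_of_pos_op_le:
  assumes "pos_op G" "pos_op (S - G)"
  shows "(norm (G x))\<^sup>2 \<le> norm S * (G x \<bullet> x)"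
proof -
  have le: "G y \<bullet> y \<le> norm S * (norm y)\<^sup>2" for y
  proof -
    have "G y \<bullet> y \<le> S y \<bullet> y"
      using pos_op_nonneg[OF assms(2), of y] by (simp add: blinfun_simps inner_diff_left)
    also have "\<dots> \<le> norm (S y) * norm y" by (rule norm_cauchy_schwarz)
    also have "\<dots> \<le> norm S * norm y * norm y" by (intro mult_right_mono norm_blinfun) simp
    finally show ?thesis by (simp add: power2_eq_square)
  qed
  let ?n = "(norm (G x))\<^sup>2"
  have "?n\<^sup>2 = (G x \<bullet> G x)\<^sup>2" by (simp add: power2_norm_eq_inner)
  also have "\<dots> \<le> (G x \<bullet> x) * (G (G x) \<bullet> G x)" by (rule pos_op_cauchy_schwarz[OF assms(1)])
  also have "\<dots> \<le> (G x \<bullet> x) * (norm S * ?n)"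
    by (intro mult_left_mono le pos_op_nonneg[OF assms(1)])
  finally have "?n * ?n \<le> (norm S * (G x \<bullet> x)) * ?n" by (simp add: power2_eq_square mult_ac)
  then show ?thesis
    using pos_op_nonneg[OF assms(1), of x] mult_right_le_imp_le[of ?n ?n "norm S * (G x \<bullet> x)"]
    by (cases "?n = 0") auto
qed

lemma norm_square_adj:
  assumes "A \<in> bop"
  shows "norm (adj A o\<^sub>L A) \<le> (norm A)\<^sup>2"
proof -
  have "norm (adj A) \<le> norm A"
  proof (rule norm_blinfun_bound)
    fix x
    have "norm (adj A x) * norm (adj A x) = A (adj A x) \<bullet> x"
      using assms by (simp add: inner_adj dot_square_norm power2_eq_square)
    also have "\<dots> \<le> norm A * norm (adj A x) * norm x"
      using norm_cauchy_schwarz[of "A (adj A x)" x] norm_blinfun[of A "adj A x"]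
      by (meson mult_right_mono norm_ge_zero order_trans)
    finally show "norm (adj A x) \<le> norm A * norm x"
      by (cases "adj A x = 0") (simp_all add: mult.assoc mult.left_commute)
  qed simp
  then have "norm (adj A) * norm A \<le> norm A * norm A"
    by (rule mult_right_mono) simp
  then show ?thesis
    using norm_blinfun_compose[of "adj A" A] by (simp add: power2_eq_square)
qed

section \<open>Polynomials in a symmetric operator\<close>

lemma blinfun_compose_id_left [simp]: "id_blinfun o\<^sub>L A = A"
  and blinfun_compose_id_right [simp]: "A o\<^sub>L id_blinfun = A"
  by (rule blinfun_eqI, simp)+

lemma blinfun_compose_assoc: "(A o\<^sub>L B) o\<^sub>L C = A o\<^sub>L (B o\<^sub>L C)"
  by (rule blinfun_eqI) simp

interpretation blinfun_compose: bounded_bilinear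
  "(o\<^sub>L) :: ('b::real_normed_vector \<Rightarrow>\<^sub>L 'c::real_normed_vector) \<Rightarrow> ('a::real_normed_vector \<Rightarrow>\<^sub>L 'b) \<Rightarrow> _"
  by (rule bounded_bilinear_blinfun_compose)

lemmas compose_simps = blinfun_compose.add_left blinfun_compose.add_right
  blinfun_compose.diff_left blinfun_compose.diff_right blinfun_compose.minus_left
  blinfun_compose.minus_right blinfun_compose.scaleR_left blinfun_compose.scaleR_right

lemma poly_op_eq_sum:
  assumes "degree q \<le> n"
  shows "poly_op q A = (\<Sum>i\<le>n. coeff q i *\<^sub>R (((o\<^sub>L) A ^^ i) id_blinfun))"
  unfolding poly_op_def
  by (rule sum.mono_neutral_left) (use assms in \<open>auto simp: coeff_eq_0\<close>)

lemma poly_op_0 [simp]: "poly_op 0 A = 0"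
  by (simp add: poly_op_def)

lemma poly_op_pCons [simp]: "poly_op (pCons a q) A = a *\<^sub>R id_blinfun + (A o\<^sub>L poly_op q A)"
proof -
  have "poly_op (pCons a q) A =
      (\<Sum>i\<le>Suc (degree q). coeff (pCons a q) i *\<^sub>R (((o\<^sub>L) A ^^ i) id_blinfun))"
    by (rule poly_op_eq_sum) (simp add: degree_pCons_le)
  also have "\<dots> = a *\<^sub>R id_blinfun + (A o\<^sub>L poly_op q A)"
    by (subst sum.atMost_Suc_shift)
      (simp add: poly_op_def blinfun_compose.sum_right blinfun_compose.scaleR_right)
  finally show ?thesis .
qed

lemma poly_op_1 [simp]: "poly_op 1 A = id_blinfun"
  by (simp add: one_pCons)

lemma poly_op_add: "poly_op (p + q) A = poly_op p A + poly_op q A"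
  by (induction p q rule: poly_induct2) (simp_all add: scaleR_add_left compose_simps)

lemma poly_op_smult: "poly_op (smult c p) A = c *\<^sub>R poly_op p A"
  by (induction p) (simp_all add: scaleR_add_right compose_simps)

lemma poly_op_minus: "poly_op (- p) A = - poly_op p A"
  using poly_op_smult[of "-1" p A] by simp

lemma poly_op_diff: "poly_op (p - q) A = poly_op p A - poly_op q A"
  using poly_op_add[of p "- q" A] by (simp add: poly_op_minus)

lemma poly_op_mult: "poly_op (p * q) A = poly_op p A o\<^sub>L poly_op q A"
  by (induction p) (simp_all add: poly_op_add poly_op_smult compose_simps blinfun_compose_assoc)

lemma poly_op_pcompose: "poly_op (p \<circ>\<^sub>p q) A = poly_op p (poly_op q A)"
  by (induction p) (simp_all add: pcompose_pCons poly_op_add poly_op_mult)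

lemma poly_op_commute: "A o\<^sub>L poly_op p A = poly_op p A o\<^sub>L A"
  using poly_op_mult[of "[:0, 1:]" p A] poly_op_mult[of p "[:0, 1:]" A] by (simp add: mult.commute)

lemma poly_op_bop: "A \<in> bop \<Longrightarrow> poly_op p A \<in> bop"
  by (induction p) (simp_all add: bop_add bop_scaleR bop_compose)

lemma symmetric_op_poly:
  assumes "symmetric_op A"
  shows "symmetric_op (poly_op p A)"
proof (induction p)
  case (pCons a p)
  have "symmetric_op (A o\<^sub>L poly_op p A)"
    unfolding symmetric_op_def
  proof (intro allI)
    fix x y
    have "(A o\<^sub>L poly_op p A) x \<bullet> y = x \<bullet> (poly_op p A o\<^sub>L A) y"
      using assms pCons.IH by (simp add: symmetric_op_def)
    then show "(A o\<^sub>L poly_op p A) x \<bullet> y = x \<bullet> (A o\<^sub>L poly_op p A) y"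
      by (simp only: poly_op_commute)
  qed
  then show ?case by (simp add: symmetric_op_add symmetric_op_scaleR)
qed simp

lemma poly_op_id: "poly_op p (c *\<^sub>R id_blinfun) = poly p c *\<^sub>R id_blinfun"
  by (induction p) (simp_all add: scaleR_add_left compose_simps mult.commute)

definition approx_point_spectrum :: "('a::real_normed_vector \<Rightarrow>\<^sub>L 'a) \<Rightarrow> real set"
  where "approx_point_spectrum A = {t. \<forall>e>0. \<exists>x. norm (A x - t *\<^sub>R x) < e * norm x}"

definition complex_poly_apply ::
  "('a::complex_hilbert_space \<Rightarrow>\<^sub>L 'a) \<Rightarrow> complex poly \<Rightarrow> 'a \<Rightarrow> 'a"
  where "complex_poly_apply A p x = fold_coeffs (\<lambda>a y. a *\<^sub>C x + A y) p 0"

lemma complex_poly_apply_pCons [simp]: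
  "complex_poly_apply A (pCons a p) x = a *\<^sub>C x + A (complex_poly_apply A p x)"
  by (cases "p = 0 \<and> a = 0") (auto simp: complex_poly_apply_def)

lemma complex_poly_apply_0 [simp]: "complex_poly_apply A 0 x = 0"
  by (simp add: complex_poly_apply_def)

lemma complex_poly_apply_add:
  "complex_poly_apply A (p + q) x = complex_poly_apply A p x + complex_poly_apply A q x"
  by (induction p q rule: poly_induct2) (simp_all add: scaleC_add_left blinfun_simps)

lemma complex_poly_apply_smult:
  "A \<in> bop \<Longrightarrow> complex_poly_apply A (smult c p) x = c *\<^sub>C complex_poly_apply A p x"
  by (induction p) (simp_all add: scaleC_add_right scaleC_scaleC bop_scaleC)

lemma complex_poly_apply_factor:
  "A \<in> bop \<Longrightarrow> complex_poly_apply A ([:- z, 1:] * p) x =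
    A (complex_poly_apply A p x) - z *\<^sub>C complex_poly_apply A p x"
  using scaleC_add_left[of "-z" z "complex_poly_apply A p x"]
  by (simp add: complex_poly_apply_add complex_poly_apply_smult eq_neg_iff_add_eq_0[symmetric]
      del: add_uminus_conv_diff smult_minus_left)

lemma complex_poly_apply_of_real:
  "complex_poly_apply A (map_poly complex_of_real p) x = poly_op p A x"
  by (induction p) (simp_all add: map_poly_pCons scaleC_of_real blinfun_simps)

lemma poly_map_of_real: "poly (map_poly complex_of_real p) (of_real t) = of_real (poly p t)"
  by (induction p) (simp_all add: map_poly_pCons)

lemma norm_diff_scaleC_ge:
  assumes A: "A \<in> bop" "symmetric_op A"
  shows "\<bar>Im z\<bar> * norm x \<le> norm (A x - z *\<^sub>C x)"
    and "norm (A x - Re z *\<^sub>R x) \<le> norm (A x - z *\<^sub>C x)"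
proof -
  let ?u = "A x - Re z *\<^sub>R x"
  have "(\<i> *\<^sub>C x) \<bullet> A x = 0"
  proof -
    have "(\<i> *\<^sub>C x) \<bullet> A x = (\<i> *\<^sub>C A x) \<bullet> x"
      using A by (metis bop_scaleC symmetric_op_def)
    then show ?thesis
      using inner_scaleC_ii[of "A x" x] by (simp add: inner_commute)
  qed
  moreover have "(\<i> *\<^sub>C x) \<bullet> x = 0"
    using inner_scaleC_ii[of x x] by (simp add: inner_commute)
  ultimately have orth: "?u \<bullet> (Im z *\<^sub>R \<i> *\<^sub>C x) = 0"
    by (simp add: inner_diff_left inner_diff_right inner_commute[of _ "\<i> *\<^sub>C x"])
  have "(norm (A x - z *\<^sub>C x))\<^sup>2 = (norm ?u)\<^sup>2 + (norm (Im z *\<^sub>R \<i> *\<^sub>C x))\<^sup>2"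
  proof -
    have "A x - z *\<^sub>C x = ?u - Im z *\<^sub>R \<i> *\<^sub>C x"
      by (simp add: scaleC_cartesian[of z])
    moreover have "(norm (u - v))\<^sup>2 = (norm u)\<^sup>2 + (norm v)\<^sup>2" if "u \<bullet> v = 0" for u v :: 'a
      using that by (simp add: power2_norm_eq_inner inner_diff_left inner_diff_right inner_commute)
    ultimately show ?thesis using orth by (metis (no_types, lifting))
  qed
  moreover have "norm (Im z *\<^sub>R \<i> *\<^sub>C x) = \<bar>Im z\<bar> * norm x"
    by (simp add: norm_scaleC)
  ultimately have eq: "(norm (A x - z *\<^sub>C x))\<^sup>2 = (norm ?u)\<^sup>2 + (\<bar>Im z\<bar> * norm x)\<^sup>2"
    by simp
  show "\<bar>Im z\<bar> * norm x \<le> norm (A x - z *\<^sub>C x)" "norm ?u \<le> norm (A x - z *\<^sub>C x)"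
    by (rule power2_le_imp_le; simp add: eq)+
qed

text \<open>Factor \<open>p\<close> over \<open>\<complex>\<close>: each \<open>A - z\<close> with \<open>z\<close> not in the approximate point spectrum is bounded
  below.\<close>

lemma complex_poly_apply_bounded_below:
  assumes A: "A \<in> bop" "symmetric_op A"
    and "p \<noteq> 0" "\<And>t. t \<in> approx_point_spectrum A \<Longrightarrow> poly p (of_real t) \<noteq> 0"
  shows "\<exists>e>0. \<forall>x. e * norm x \<le> norm (complex_poly_apply A p x)"
  using assms(3,4)
proof (induction "degree p" arbitrary: p)
  case 0
  then obtain c where p: "p = [:c:]" by (metis degree_eq_zeroE)
  then have "c \<noteq> 0" using "0.prems" by simp
  then show ?case
    by (intro exI[of _ "cmod c"]) (simp add: p norm_scaleC blinfun_simps blinfun.zero_right)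
next
  case (Suc n)
  then have "\<not> constant (poly p)" by (simp add: constant_degree)
  then obtain z where "poly p z = 0" using fundamental_theorem_of_algebra by blast
  then obtain q where p: "p = [:- z, 1:] * q" by (metis dvdE poly_eq_0_iff_dvd)
  have q0: "q \<noteq> 0" using p Suc.prems by auto
  have dq: "n = degree q"
    using Suc.hyps(2) q0 by (simp add: p degree_mult_eq del: mult_pCons_left)
  obtain e where e: "e > 0" "\<And>x. e * norm x \<le> norm (complex_poly_apply A q x)"
    using Suc.hyps(1)[OF dq q0] Suc.prems(2) by (auto simp: p)
  have "\<exists>d>0. \<forall>y. d * norm y \<le> norm (A y - z *\<^sub>C y)"
  proof (cases "Im z = 0")
    case False
    then show ?thesis
      using norm_diff_scaleC_ge(1)[OF A] by (intro exI[of _ "\<bar>Im z\<bar>"]) simp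
  next
    case True
    then have "z = of_real (Re z)" by (simp add: complex_eq_iff)
    moreover have "poly p z = 0" by (simp add: p)
    ultimately have "Re z \<notin> approx_point_spectrum A" using Suc.prems(2) by metis
    then obtain d where "d > 0" "\<And>y. d * norm y \<le> norm (A y - Re z *\<^sub>R y)"
      by (auto simp: approx_point_spectrum_def not_less)
    then show ?thesis
      using norm_diff_scaleC_ge(2)[OF A] order_trans by meson
  qed
  then obtain d where d: "d > 0" "\<And>y. d * norm y \<le> norm (A y - z *\<^sub>C y)" by blast
  have "d * e * norm x \<le> norm (complex_poly_apply A p x)" for x
  proof -
    have "d * (e * norm x) \<le> d * norm (complex_poly_apply A q x)"
      using d(1) e(2) by (simp add: mult_left_mono)
    also have "\<dots> \<le> norm (complex_poly_apply A p x)"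
      unfolding p complex_poly_apply_factor[OF A(1)] by (rule d(2))
    finally show ?thesis by (simp add: mult.assoc)
  qed
  then show ?case
    using d(1) e(1) by (intro exI[of _ "d * e"]) simp
qed

lemma poly_op_root_in_approx_point_spectrum:
  assumes A: "A \<in> bop" "symmetric_op A"
    and "p \<noteq> 0" "\<And>e. e > 0 \<Longrightarrow> \<exists>x. norm (poly_op p A x) < e * norm x"
  shows "\<exists>t\<in>approx_point_spectrum A. poly p t = 0"
proof (rule ccontr)
  assume no: "\<not> ?thesis"
  have "map_poly complex_of_real p \<noteq> 0"
    using \<open>p \<noteq> 0\<close> by (simp add: map_poly_eq_0_iff)
  then obtain e where "e > 0" "\<And>x. e * norm x \<le> norm (complex_poly_apply A (map_poly of_real p) x)"
    using complex_poly_apply_bounded_below[OF A, of "map_poly of_real p"] no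
    by (auto simp: poly_map_of_real)
  then show False
    using assms(4)[of e] by (auto simp: complex_poly_apply_of_real not_less[symmetric])
qed

lemma norm_square_in_approx_point_spectrum:
  assumes B: "symmetric_op B" and "norm B > 0" "e > 0"
  shows "\<exists>x. norm (B (B x) - (norm B)\<^sup>2 *\<^sub>R x) < e * norm x"
proof -
  let ?m = "norm B"
  define d where "d = min (?m\<^sup>2) (e\<^sup>2 / (2 * ?m\<^sup>2))"
  have d: "d > 0" "d \<le> ?m\<^sup>2" "?m\<^sup>2 * d < e\<^sup>2"
  proof -
    show "d > 0" "d \<le> ?m\<^sup>2" using assms by (simp_all add: d_def)
    have "?m\<^sup>2 * d \<le> ?m\<^sup>2 * (e\<^sup>2 / (2 * ?m\<^sup>2))"
      unfolding d_def by (intro mult_left_mono) simp_all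
    also have "\<dots> < e\<^sup>2" using assms by simp
    finally show "?m\<^sup>2 * d < e\<^sup>2" .
  qed
  define k where "k = sqrt (?m\<^sup>2 - d)"
  have k: "k\<^sup>2 = ?m\<^sup>2 - d" "0 \<le> k" using d by (simp_all add: k_def)
  have "k < ?m" using k d by (metis diff_less_eq less_add_same_cancel1 norm_ge_zero power_less_imp_less_base)
  then obtain x where x: "k * norm x < norm (B x)"
    using norm_blinfun_bound[OF k(2), of B] by (meson not_less)
  then have x0: "norm x > 0" by (cases "x = 0") auto
  have k2: "k\<^sup>2 * (norm x)\<^sup>2 \<le> (norm (B x))\<^sup>2"
    using x k by (metis less_imp_le mult_nonneg_nonneg norm_ge_zero power_mono power_mult_distrib)
  have "(norm (B (B x) - ?m\<^sup>2 *\<^sub>R x))\<^sup>2 = (norm (B (B x)))\<^sup>2 - 2 * ?m\<^sup>2 * (norm (B x))\<^sup>2 + ?m^4 * (norm x)\<^sup>2"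
  proof -
    have *: "(norm (v - c *\<^sub>R x))\<^sup>2 = (norm v)\<^sup>2 - 2 * c * (v \<bullet> x) + c\<^sup>2 * (norm x)\<^sup>2" for v c
      unfolding power2_norm_eq_inner
      by (simp add: inner_diff_left inner_diff_right inner_commute power2_eq_square algebra_simps)
    have "B (B x) \<bullet> x = (norm (B x))\<^sup>2" using B by (simp add: symmetric_op_def power2_norm_eq_inner)
    then show ?thesis by (simp add: *)
  qed
  also have "(norm (B (B x)))\<^sup>2 \<le> ?m\<^sup>2 * (norm (B x))\<^sup>2"
    using norm_blinfun[of B "B x"] by (metis norm_ge_zero power_mono power_mult_distrib)
  finally have "(norm (B (B x) - ?m\<^sup>2 *\<^sub>R x))\<^sup>2 \<le> ?m\<^sup>2 * (?m\<^sup>2 * (norm x)\<^sup>2 - (norm (B x))\<^sup>2)"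
    by (simp add: algebra_simps power4_eq_xxxx power2_eq_square)
  also have "\<dots> \<le> ?m\<^sup>2 * (d * (norm x)\<^sup>2)"
    using k2 k(1) by (intro mult_left_mono) (simp_all add: algebra_simps)
  also have "\<dots> < e\<^sup>2 * (norm x)\<^sup>2" using d(3) x0 by (simp add: mult.assoc[symmetric])
  finally have "(norm (B (B x) - ?m\<^sup>2 *\<^sub>R x))\<^sup>2 < (e * norm x)\<^sup>2" by (simp add: power_mult_distrib)
  then have "norm (B (B x) - ?m\<^sup>2 *\<^sub>R x) < e * norm x"
    by (rule power_less_imp_less_base) (use assms in simp)
  then show ?thesis by blast
qed

text \<open>If \<open>\<parallel>q(A)\<parallel> = m\<close>, then \<open>q(A)\<^sup>2 - m\<^sup>2\<close> is not bounded below, so \<open>q\<^sup>2 - m\<^sup>2\<close> has a root in the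
  approximate point spectrum.\<close>

lemma norm_poly_op_le:
  assumes A: "A \<in> bop" "symmetric_op A"
    and "0 \<le> c" "\<And>t. t \<in> approx_point_spectrum A \<Longrightarrow> \<bar>poly q t\<bar> \<le> c"
  shows "norm (poly_op q A) \<le> c"
proof (rule ccontr)
  let ?B = "poly_op q A"
  assume "\<not> norm ?B \<le> c"
  then have m: "norm ?B > c" by simp
  have root: "\<exists>t\<in>approx_point_spectrum A. (poly r t)\<^sup>2 = (norm (poly_op r A))\<^sup>2"
    if r: "r\<^sup>2 - [:(norm (poly_op r A))\<^sup>2:] \<noteq> 0" "norm (poly_op r A) > 0" for r
  proof -
    have "\<exists>t\<in>approx_point_spectrum A. poly (r\<^sup>2 - [:(norm (poly_op r A))\<^sup>2:]) t = 0"
      by (rule poly_op_root_in_approx_point_spectrum[OF A r(1)])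
        (use norm_square_in_approx_point_spectrum[OF symmetric_op_poly[OF A(2)] r(2)] in
          \<open>simp add: power2_eq_square[of r] poly_op_diff poly_op_mult blinfun_simps\<close>)
    then show ?thesis by simp
  qed
  have "\<exists>t\<in>approx_point_spectrum A. (poly q t)\<^sup>2 = (norm ?B)\<^sup>2"
  proof (cases "q\<^sup>2 - [:(norm ?B)\<^sup>2:] = 0")
    case True
    have *: "(poly q t)\<^sup>2 = (norm ?B)\<^sup>2" for t
    proof -
      have "poly (q\<^sup>2 - [:(norm ?B)\<^sup>2:]) t = 0" by (simp only: True poly_0)
      then show ?thesis by simp
    qed
    have "approx_point_spectrum A \<noteq> {}"
    proof (cases "norm A = 0")
      case True
      obtain x :: 'a where "x \<noteq> 0"
      proof -
        have "?B \<noteq> 0" using m \<open>0 \<le> c\<close> by auto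
        then show ?thesis using that by (metis blinfun_eqI blinfun.zero_right)
      qed
      then have "0 \<in> approx_point_spectrum A"
        using True by (auto simp: approx_point_spectrum_def intro!: exI[of _ x])
      then show ?thesis by blast
    next
      case False
      have "\<exists>t\<in>approx_point_spectrum A. (poly [:0, 1:] t)\<^sup>2 = (norm (poly_op [:0, 1:] A))\<^sup>2"
        by (rule root) (use False in \<open>simp_all add: power2_eq_square\<close>)
      then show ?thesis by blast
    qed
    then show ?thesis using * by blast
  next
    case False
    then show ?thesis using m \<open>0 \<le> c\<close> by (intro root) auto
  qed
  then obtain t where t: "t \<in> approx_point_spectrum A" "(poly q t)\<^sup>2 = (norm ?B)\<^sup>2" by blast
  then have "\<bar>poly q t\<bar> = norm ?B" by (metis abs_norm_cancel power2_eq_iff abs_minus_cancel)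
  then show False using assms(4)[OF t(1)] m by simp
qed

section \<open>Continuous functions of a positive operator\<close>

instance complex_hilbert_space \<subseteq> banach ..

lemma weierstrass_poly:
  fixes f :: "real \<Rightarrow> real"
  assumes "continuous_on {a..b} f"
  shows "\<exists>q. uniform_limit {a..b} (\<lambda>n. poly (q n)) f sequentially"
proof -
  have "\<exists>q. \<forall>t\<in>{a..b}. \<bar>f t - poly q t\<bar> < inverse (Suc n)" for n
  proof -
    obtain g where g: "real_polynomial_function g" "\<And>t. t \<in> {a..b} \<Longrightarrow> \<bar>f t - g t\<bar> < inverse (Suc n)"
      using Stone_Weierstrass_real_polynomial_function[of "{a..b}" f "inverse (Suc n)"] assms by auto
    obtain c m where c: "g = (\<lambda>x. \<Sum>i\<le>m. c i * x ^ i)"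
      using g(1) by (auto simp: real_polynomial_function_iff_sum)
    have "g = poly (\<Sum>i\<le>m. monom (c i) i)"
      by (simp add: c poly_sum poly_monom fun_eq_iff)
    then show ?thesis using g(2) by blast
  qed
  then obtain q where q: "\<And>n t. t \<in> {a..b} \<Longrightarrow> \<bar>f t - poly (q n) t\<bar> < inverse (Suc n)"
    by metis
  have "uniform_limit {a..b} (\<lambda>n. poly (q n)) f sequentially"
  proof (rule uniform_limitI)
    fix e :: real assume "e > 0"
    then have "\<forall>\<^sub>F n in sequentially. inverse (real (Suc n)) < e"
      using LIMSEQ_inverse_real_of_nat by (rule order_tendstoD(2)[rotated])
    then show "\<forall>\<^sub>F n in sequentially. \<forall>t\<in>{a..b}. dist (poly (q n) t) (f t) < e"
    proof eventually_elim
      case (elim n)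
      have "dist (poly (q n) t) (f t) < inverse (Suc n)" if "t \<in> {a..b}" for t
        using q[OF that, of n] by (simp add: dist_real_def abs_minus_commute)
      then show ?case using elim by force
    qed
  qed
  then show ?thesis by blast
qed

lemma approx_point_spectrum_pos:
  assumes "pos_op T" "norm T \<le> R"
  shows "approx_point_spectrum T \<subseteq> {0..R}"
proof
  fix t assume "t \<in> approx_point_spectrum T"
  then have ex: "\<exists>x. norm (T x - t *\<^sub>R x) < e * norm x" if "e > 0" for e
    using that by (simp add: approx_point_spectrum_def)
  show "t \<in> {0..R}"
  proof (rule ccontr)
    assume "t \<notin> {0..R}"
    then consider "t < 0" | "t > R" by force
    then show False
    proof cases
      case 1
      then obtain x where x: "norm (T x - t *\<^sub>R x) < - t * norm x" using ex[of "- t"] by auto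
      have "- t * norm x * norm x \<le> (T x - t *\<^sub>R x) \<bullet> x"
        using pos_op_nonneg[OF assms(1), of x]
        by (simp add: inner_diff_left dot_square_norm power2_eq_square)
      also have "\<dots> \<le> norm (T x - t *\<^sub>R x) * norm x" by (rule norm_cauchy_schwarz)
      finally have "- t * norm x \<le> norm (T x - t *\<^sub>R x)" if "x \<noteq> 0"
        using that by (simp only: mult_le_cancel_right) simp
      then show False using x by (cases "x = 0") auto
    next
      case 2
      then obtain x where x: "norm (T x - t *\<^sub>R x) < (t - R) * norm x" using ex[of "t - R"] by auto
      have "t \<ge> 0" using 2 assms(2) norm_ge_zero[of T] by linarith
      then have "t * norm x - norm (T x) \<le> norm (T x - t *\<^sub>R x)"
        using norm_triangle_ineq2[of "t *\<^sub>R x" "T x"] by (simp add: norm_minus_commute)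
      moreover have "norm (T x) \<le> R * norm x"
        using norm_blinfun[of T x] assms(2) by (meson mult_right_mono norm_ge_zero order_trans)
      ultimately show False using x by (simp add: algebra_simps)
    qed
  qed
qed

lemma norm_poly_op_pos_le:
  assumes "pos_op T" "norm T \<le> R" "0 \<le> c" "\<And>t. t \<in> {0..R} \<Longrightarrow> \<bar>poly q t\<bar> \<le> c"
  shows "norm (poly_op q T) \<le> c"
  using assms approx_point_spectrum_pos[OF assms(1,2)]
  by (intro norm_poly_op_le) (auto dest: pos_op_bop pos_op_symmetric)

lemma pos_op_poly:
  assumes T: "pos_op T" "norm T \<le> R" and nn: "\<And>t. t \<in> {0..R} \<Longrightarrow> 0 \<le> poly q t"
  shows "pos_op (poly_op q T)"
  unfolding pos_op_iff
proof (intro conjI allI)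
  show "poly_op q T \<in> bop" "symmetric_op (poly_op q T)"
    using T by (auto intro: poly_op_bop symmetric_op_poly dest: pos_op_bop pos_op_symmetric)
  fix x
  have "bounded (poly q ` {0..R})"
    by (intro compact_imp_bounded compact_continuous_image continuous_intros) simp
  then obtain m where m: "\<And>t. t \<in> {0..R} \<Longrightarrow> \<bar>poly q t\<bar> \<le> m"
    unfolding bounded_iff by (metis image_eqI real_norm_def)
  have "0 \<le> R" using T(2) norm_ge_zero[of T] by linarith
  then have m0: "0 \<le> m" using m[of 0] by simp
  have "norm (poly_op ([:m:] - q) T) \<le> m"
    by (rule norm_poly_op_pos_le[OF T m0]) (use m nn in \<open>force simp: abs_le_iff\<close>)
  then have "norm (poly_op ([:m:] - q) T x) \<le> m * norm x"
    by (meson mult_right_mono norm_blinfun norm_ge_zero order_trans)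
  then have "poly_op ([:m:] - q) T x \<bullet> x \<le> m * norm x * norm x"
    by (meson mult_right_mono norm_cauchy_schwarz norm_ge_zero order_trans)
  then show "0 \<le> poly_op q T x \<bullet> x"
    by (simp add: poly_op_diff blinfun_simps inner_diff_left dot_square_norm power2_eq_square)
qed

lemma poly_op_convergent:
  assumes T: "pos_op T" "norm T \<le> R"
    and q: "uniform_limit {0..R} (\<lambda>n. poly (q n)) f sequentially"
  shows "convergent (\<lambda>n. poly_op (q n) T)"
proof -
  have "Cauchy (\<lambda>n. poly_op (q n) T)"
  proof (rule metric_CauchyI)
    fix e :: real assume e: "e > 0"
    then have "\<forall>\<^sub>F n in sequentially. \<forall>t\<in>{0..R}. dist (poly (q n) t) (f t) < e / 3"
      using uniform_limitD[OF q, of "e / 3"] by simp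
    then obtain N where N: "\<And>n t. n \<ge> N \<Longrightarrow> t \<in> {0..R} \<Longrightarrow> dist (poly (q n) t) (f t) < e / 3"
      unfolding eventually_sequentially by blast
    show "\<exists>M. \<forall>m\<ge>M. \<forall>n\<ge>M. dist (poly_op (q m) T) (poly_op (q n) T) < e"
    proof (intro exI allI impI)
      fix m n assume mn: "m \<ge> N" "n \<ge> N"
      have "norm (poly_op (q m - q n) T) \<le> 2 * (e / 3)"
      proof (rule norm_poly_op_pos_le[OF T])
        fix t assume "t \<in> {0..R}"
        then show "\<bar>poly (q m - q n) t\<bar> \<le> 2 * (e / 3)"
          using N[OF mn(1), of t] N[OF mn(2), of t] unfolding dist_real_def poly_diff by linarith
      qed (use e in simp)
      then show "dist (poly_op (q m) T) (poly_op (q n) T) < e"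
        using e by (simp add: dist_norm poly_op_diff)
    qed
  qed
  then show ?thesis by (simp add: Cauchy_convergent_iff)
qed

lemma poly_op_tendsto_unique:
  assumes A: "A \<in> bop" "symmetric_op A"
    and q: "uniform_limit (approx_point_spectrum A) (\<lambda>n. poly (q n)) f sequentially"
    and r: "uniform_limit (approx_point_spectrum A) (\<lambda>n. poly (r n)) f sequentially"
    and B: "(\<lambda>n. poly_op (q n) A) \<longlonglongrightarrow> B"
  shows "(\<lambda>n. poly_op (r n) A) \<longlonglongrightarrow> B"
proof -
  have "(\<lambda>n. poly_op (r n) A - poly_op (q n) A) \<longlonglongrightarrow> 0"
  proof (rule tendstoI)
    fix e :: real assume e: "e > 0"
    have "\<forall>\<^sub>F n in sequentially. \<forall>t\<in>approx_point_spectrum A. dist (poly (q n) t) (f t) < e / 3"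
      "\<forall>\<^sub>F n in sequentially. \<forall>t\<in>approx_point_spectrum A. dist (poly (r n) t) (f t) < e / 3"
      using q r e by (auto dest!: uniform_limitD[where e = "e / 3"])
    then show "\<forall>\<^sub>F n in sequentially. dist (poly_op (r n) A - poly_op (q n) A) 0 < e"
    proof eventually_elim
      case (elim n)
      have "norm (poly_op (r n - q n) A) \<le> 2 * (e / 3)"
      proof (rule norm_poly_op_le[OF A])
        fix t assume "t \<in> approx_point_spectrum A"
        then have "dist (poly (q n) t) (f t) < e / 3" "dist (poly (r n) t) (f t) < e / 3"
          using elim by blast+
        then show "\<bar>poly (r n - q n) t\<bar> \<le> 2 * (e / 3)"
          unfolding dist_real_def poly_diff by linarith
      qed (use e in simp)
      then show ?case using e by (simp add: poly_op_diff)
    qed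
  qed
  from tendsto_add[OF B this] show ?thesis by simp
qed

lemma poly_op_tendsto_unique_pos:
  assumes T: "pos_op T" "norm T \<le> R"
    and q: "uniform_limit {0..R} (\<lambda>n. poly (q n)) f sequentially"
    and r: "uniform_limit {0..R} (\<lambda>n. poly (r n)) f sequentially"
    and B: "(\<lambda>n. poly_op (q n) T) \<longlonglongrightarrow> B"
  shows "(\<lambda>n. poly_op (r n) T) \<longlonglongrightarrow> B"
  by (rule poly_op_tendsto_unique[OF _ _ _ _ B])
    (use T q r approx_point_spectrum_pos[OF T] in
      \<open>auto intro: uniform_limit_on_subset dest: pos_op_bop pos_op_symmetric\<close>)

lemma uniform_limit_poly_mult:
  fixes f g :: "real \<Rightarrow> real"
  assumes "uniform_limit {a..b} (\<lambda>n. poly (q n)) f sequentially" "continuous_on {a..b} f"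
    and "uniform_limit {a..b} (\<lambda>n. poly (r n)) g sequentially" "continuous_on {a..b} g"
  shows "uniform_limit {a..b} (\<lambda>n. poly (q n * r n)) (\<lambda>t. f t * g t) sequentially"
  unfolding poly_mult
  by (intro uniform_lim_mult assms compact_imp_bounded compact_continuous_image) simp_all

lemma poly_op_tendsto_mult:
  assumes T: "pos_op T" "norm T \<le> R"
    and q: "uniform_limit {0..R} (\<lambda>n. poly (q n)) f sequentially" "continuous_on {0..R} f"
    and r: "uniform_limit {0..R} (\<lambda>n. poly (r n)) g sequentially" "continuous_on {0..R} g"
    and s: "uniform_limit {0..R} (\<lambda>n. poly (s n)) (\<lambda>t. f t * g t) sequentially"
    and B: "(\<lambda>n. poly_op (q n) T) \<longlonglongrightarrow> B" and C: "(\<lambda>n. poly_op (r n) T) \<longlonglongrightarrow> C"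
  shows "(\<lambda>n. poly_op (s n) T) \<longlonglongrightarrow> (B o\<^sub>L C)"
proof (rule poly_op_tendsto_unique_pos[OF T _ s])
  show "uniform_limit {0..R} (\<lambda>n. poly (q n * r n)) (\<lambda>t. f t * g t) sequentially"
    by (rule uniform_limit_poly_mult[OF q r])
  show "(\<lambda>n. poly_op (q n * r n) T) \<longlonglongrightarrow> (B o\<^sub>L C)"
    unfolding poly_op_mult by (intro blinfun_compose.tendsto B C)
qed

lemma pos_op_sqrt_exists:
  assumes T: "pos_op T"
  shows "\<exists>S. pos_op S \<and> S o\<^sub>L S = T"
proof -
  let ?R = "norm T" and ?f = "\<lambda>t. sqrt (sqrt t)"
  have c: "continuous_on {0..?R} ?f" "continuous_on {0..?R} sqrt" by (intro continuous_intros)+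
  obtain r where r: "uniform_limit {0..?R} (\<lambda>n. poly (r n)) ?f sequentially"
    using weierstrass_poly[OF c(1)] by blast
  have r2: "uniform_limit {0..?R} (\<lambda>n. poly (r n * r n)) sqrt sequentially"
    by (rule uniform_limit_cong'[THEN iffD1, OF _ _ uniform_limit_poly_mult[OF r c(1) r c(1)]])
      simp_all
  then obtain S where S: "(\<lambda>n. poly_op (r n * r n) T) \<longlonglongrightarrow> S"
    using poly_op_convergent[OF T order_refl r2] convergent_def by blast
  have "pos_op S"
  proof (rule pos_op_limit[OF _ S])
    show "pos_op (poly_op (r n * r n) T)" for n
      unfolding poly_op_mult using T
      by (intro pos_op_square poly_op_bop symmetric_op_poly) (auto dest: pos_op_bop pos_op_symmetric)
  qed
  moreover have "(\<lambda>n. poly_op [:0, 1:] T) \<longlonglongrightarrow> (S o\<^sub>L S)"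
  proof (rule poly_op_tendsto_mult[OF T order_refl r2 c(2) r2 c(2) _ S S])
    show "uniform_limit {0..?R} (\<lambda>n. poly [:0, 1:]) (\<lambda>t. sqrt t * sqrt t) sequentially"
      by (intro uniform_limitI always_eventually) (simp add: abs_of_nonneg)
  qed
  then have "S o\<^sub>L S = T" by (simp add: LIMSEQ_const_iff)
  ultimately show ?thesis by blast
qed

lemma poly_op_square_tendsto:
  assumes S: "pos_op S" "norm S \<le> R"
    and q: "uniform_limit {0..R\<^sup>2} (\<lambda>n. poly (q n)) (\<lambda>t. f (sqrt t)) sequentially"
    and r: "uniform_limit {0..R} (\<lambda>n. poly (r n)) f sequentially"
    and B: "(\<lambda>n. poly_op (r n) S) \<longlonglongrightarrow> B"
  shows "(\<lambda>n. poly_op (q n) (S o\<^sub>L S)) \<longlonglongrightarrow> B"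
proof -
  have "uniform_limit {0..R} (\<lambda>n. poly (q n \<circ>\<^sub>p [:0, 0, 1:])) f sequentially"
  proof (rule uniform_limitI)
    fix e :: real assume "e > 0"
    from uniform_limitD[OF q this]
    show "\<forall>\<^sub>F n in sequentially. \<forall>t\<in>{0..R}. dist (poly (q n \<circ>\<^sub>p [:0, 0, 1:]) t) (f t) < e"
    proof eventually_elim
      case (elim n)
      show ?case
      proof
        fix t assume t: "t \<in> {0..R}"
        then have "t * t \<in> {0..R\<^sup>2}" by (auto simp: power2_eq_square mult_mono)
        then have "dist (poly (q n) (t * t)) (f (sqrt (t * t))) < e" using elim by blast
        then show "dist (poly (q n \<circ>\<^sub>p [:0, 0, 1:]) t) (f t) < e"
          using t by (simp add: poly_pcompose)
      qed
    qed
  qed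
  from poly_op_tendsto_unique_pos[OF S r this B]
  show ?thesis by (simp add: poly_op_pcompose)
qed

lemma pos_op_sqrt_unique:
  assumes S: "pos_op S" and S': "pos_op S'" and eq: "S o\<^sub>L S = S' o\<^sub>L S'"
  shows "S = S'"
proof -
  define R where "R = max (norm S) (norm S')"
  obtain q where q: "uniform_limit {0..R\<^sup>2} (\<lambda>n. poly (q n)) sqrt sequentially"
    using weierstrass_poly[of 0 "R\<^sup>2" sqrt] continuous_on_real_sqrt[OF continuous_on_id] by blast
  have id: "uniform_limit {0..R} (\<lambda>n. poly [:0, 1:]) (\<lambda>t. t) sequentially"
    by (intro uniform_limitI always_eventually) simp
  have "(\<lambda>n. poly_op (q n) (S o\<^sub>L S)) \<longlonglongrightarrow> S" "(\<lambda>n. poly_op (q n) (S' o\<^sub>L S')) \<longlonglongrightarrow> S'"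
    by (rule poly_op_square_tendsto[OF _ _ q id]; simp add: S S' R_def)+
  then show ?thesis unfolding eq by (rule LIMSEQ_unique)
qed

lemma modulus_works:
  assumes "A \<in> bop"
  shows "pos_op (modulus A)" "modulus A o\<^sub>L modulus A = adj A o\<^sub>L A"
proof -
  have "\<exists>!S. pos_op S \<and> S o\<^sub>L S = adj A o\<^sub>L A"
    using pos_op_sqrt_exists[OF pos_op_adj_compose[OF assms]] pos_op_sqrt_unique by metis
  from theI'[OF this] show "pos_op (modulus A)" "modulus A o\<^sub>L modulus A = adj A o\<^sub>L A"
    by (simp_all add: modulus_def)
qed

lemma norm_modulus_le:
  assumes "A \<in> bop"
  shows "norm (modulus A) \<le> norm A"
proof (rule norm_blinfun_bound)
  fix x
  have "(norm (modulus A x))\<^sup>2 = (modulus A o\<^sub>L modulus A) x \<bullet> x"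
    using pos_op_symmetric[OF modulus_works(1)[OF assms]]
    by (simp add: symmetric_op_def power2_norm_eq_inner)
  also have "\<dots> = (norm (A x))\<^sup>2"
    by (simp add: modulus_works[OF assms] inner_adj'[OF assms] power2_norm_eq_inner)
  finally show "norm (modulus A x) \<le> norm A * norm x"
    using norm_blinfun[of A x] by simp
qed simp

lemma spectrum_pos:
  assumes S: "pos_op S" and t: "complex_of_real t \<in> spectrum S"
  shows "t \<in> {0..norm S}"
proof (rule ccontr)
  assume no: "t \<notin> {0..norm S}"
  let ?R = "norm S" and ?f = "\<lambda>s. inverse (s - t)" and ?g = "\<lambda>s. s - t"
  have c: "continuous_on {0..?R} ?f" "continuous_on {0..?R} ?g"
    using no by (auto intro!: continuous_intros)
  obtain q where q: "uniform_limit {0..?R} (\<lambda>n. poly (q n)) ?f sequentially"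
    using weierstrass_poly[OF c(1)] by blast
  obtain B where B: "(\<lambda>n. poly_op (q n) S) \<longlonglongrightarrow> B"
    using poly_op_convergent[OF S order_refl q] convergent_def by blast
  let ?A = "S - scale_op (complex_of_real t) id_blinfun"
  have g: "uniform_limit {0..?R} (\<lambda>n. poly [:- t, 1:]) ?g sequentially"
    by (intro uniform_limitI always_eventually) simp
  have A: "(\<lambda>n. poly_op [:- t, 1:] S) \<longlonglongrightarrow> ?A"
    by (simp add: scale_op_of_real)
  have one: "uniform_limit {0..?R} (\<lambda>n. poly 1) (\<lambda>s. ?f s * ?g s) sequentially"
    "uniform_limit {0..?R} (\<lambda>n. poly 1) (\<lambda>s. ?g s * ?f s) sequentially"
    by (intro uniform_limitI always_eventually; use no in force)+
  have "(\<lambda>n::nat. poly_op 1 S) \<longlonglongrightarrow> (B o\<^sub>L ?A)"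
    by (rule poly_op_tendsto_mult[OF S order_refl q c(1) g c(2) one(1) B A])
  moreover have "(\<lambda>n::nat. poly_op 1 S) \<longlonglongrightarrow> (?A o\<^sub>L B)"
    by (rule poly_op_tendsto_mult[OF S order_refl g c(2) q c(1) one(2) A B])
  ultimately have "B o\<^sub>L ?A = id_blinfun" "?A o\<^sub>L B = id_blinfun"
    by (simp_all add: LIMSEQ_const_iff)
  moreover have "B \<in> bop"
    by (rule bop_limit[OF _ B]) (intro poly_op_bop pos_op_bop S)
  ultimately show False using t by (auto simp: spectrum_def)
qed

lemma approx_point_spectrum_subset_spectrum:
  assumes "t \<in> approx_point_spectrum A"
  shows "complex_of_real t \<in> spectrum A"
proof (rule ccontr)
  assume "complex_of_real t \<notin> spectrum A"
  then obtain B where "B o\<^sub>L (A - t *\<^sub>R id_blinfun) = id_blinfun"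
    by (auto simp: spectrum_def scale_op_of_real)
  then have B: "B (A x - t *\<^sub>R x) = x" for x
    by (metis blinfun_apply_blinfun_compose blinfun_apply_id_blinfun blinfun.diff_left blinfun.scaleR_left)
  define e where "e = inverse (norm B + 1)"
  have "norm B + 1 > 0" by (simp add: add_nonneg_pos)
  then have e: "e > 0" "(norm B + 1) * e = 1" by (simp_all add: e_def)
  then obtain x where x: "norm (A x - t *\<^sub>R x) < e * norm x"
    using assms by (auto simp: approx_point_spectrum_def)
  have "norm x \<le> norm B * norm (A x - t *\<^sub>R x)"
    using norm_blinfun[of B "A x - t *\<^sub>R x"] by (simp add: B)
  also have "\<dots> \<le> (norm B + 1) * norm (A x - t *\<^sub>R x)" by (simp add: mult_right_mono)
  also have "\<dots> < (norm B + 1) * (e * norm x)"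
    using x \<open>norm B + 1 > 0\<close> by simp
  finally show False using e(2) by (simp add: mult.assoc[symmetric])
qed

lemma cont_calculus_tendsto:
  assumes S: "pos_op S" "norm S \<le> R" and f: "continuous_on {0..R} f"
    and q: "uniform_limit {0..R} (\<lambda>n. poly (q n)) f sequentially"
  shows "(\<lambda>n. poly_op (q n) S) \<longlonglongrightarrow> cont_calculus f S"
proof -
  let ?sp = "{t. complex_of_real t \<in> spectrum S}"
  obtain T where T: "(\<lambda>n. poly_op (q n) S) \<longlonglongrightarrow> T"
    using poly_op_convergent[OF S q] convergent_def by blast
  have sub: "approx_point_spectrum S \<subseteq> ?sp" "?sp \<subseteq> {0..R}"
    using approx_point_spectrum_subset_spectrum spectrum_pos[OF S(1)] S(2) by force+
  have all: "(\<lambda>n. poly_op (r n) S) \<longlonglongrightarrow> T"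
    if "uniform_limit ?sp (\<lambda>n. poly (r n)) f sequentially" for r
    by (rule poly_op_tendsto_unique[OF pos_op_bop pos_op_symmetric _ _ T])
      (use S sub q that in \<open>auto intro: uniform_limit_on_subset\<close>)
  have "cont_calculus f S = T"
    unfolding cont_calculus_def
  proof (rule the_equality)
    show "\<forall>r. uniform_limit ?sp (\<lambda>n. poly (r n)) f sequentially \<longrightarrow> (\<lambda>n. poly_op (r n) S) \<longlonglongrightarrow> T"
      using all by blast
    fix T' assume "\<forall>r. uniform_limit ?sp (\<lambda>n. poly (r n)) f sequentially \<longrightarrow>
      (\<lambda>n. poly_op (r n) S) \<longlonglongrightarrow> T'"
    then show "T' = T"
      using T LIMSEQ_unique uniform_limit_on_subset[OF q sub(2)] by blast
  qed
  then show ?thesis using T by simp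
qed

lemma modulus_powr_tendsto:
  assumes A: "A \<in> bop" "norm A \<le> R" and "0 < p"
    and q: "uniform_limit {0..R\<^sup>2} (\<lambda>n. poly (q n)) (\<lambda>t. t powr (p / 2)) sequentially"
  shows "(\<lambda>n. poly_op (q n) (adj A o\<^sub>L A)) \<longlonglongrightarrow> cont_calculus (\<lambda>t. t powr p) (modulus A)"
proof -
  have S: "pos_op (modulus A)" "norm (modulus A) \<le> R"
    using modulus_works[OF A(1)] norm_modulus_le[OF A(1)] A(2) by simp_all
  have c: "continuous_on {0..R} (\<lambda>t. t powr p)"
    using \<open>0 < p\<close> by (intro continuous_on_powr' continuous_intros) auto
  then obtain r where r: "uniform_limit {0..R} (\<lambda>n. poly (r n)) (\<lambda>t. t powr p) sequentially"
    using weierstrass_poly by blast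
  have q': "uniform_limit {0..R\<^sup>2} (\<lambda>n. poly (q n)) (\<lambda>t. sqrt t powr p) sequentially"
  proof (rule uniform_limit_cong'[THEN iffD1, OF _ _ q])
    fix t assume "t \<in> {0..R\<^sup>2}"
    then show "t powr (p / 2) = sqrt t powr p"
      by (simp add: powr_half_sqrt[symmetric] powr_powr)
  qed simp
  show ?thesis
    using poly_op_square_tendsto[OF S q' r cont_calculus_tendsto[OF S c r]]
    by (simp add: modulus_works[OF A(1)])
qed

section \<open>Real inequalities\<close>

lemma powr_le_affine:
  fixes q t :: real
  assumes "0 < q" "q \<le> 1" "0 \<le> t"
  shows "t powr q \<le> 1 + q * (t - 1)"
  using Youngs_inequality_0[of q "1 - q" t 1] assms by (cases "t = 0") (simp_all add: algebra_simps)

lemma powr_ge_affine: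
  fixes q t :: real
  assumes "1 \<le> q" "0 \<le> t"
  shows "1 + q * (t - 1) \<le> t powr q"
  using powr_le_affine[of "1 / q" "t powr q"] assms by (simp add: powr_powr field_simps)

lemma powr_le_one_minus:
  fixes q :: real
  assumes "0 < q"
  shows "\<exists>c>0. \<forall>t\<in>{0..1}. t powr q \<le> 1 - c * (1 - t)"
proof (cases "q \<le> 1")
  case True
  have "t powr q \<le> 1 - q * (1 - t)" if "t \<in> {0..1}" for t
    using powr_le_affine[OF assms True, of t] that by (simp add: algebra_simps)
  then show ?thesis using assms by blast
next
  case False
  have "t powr q \<le> 1 - 1 * (1 - t)" if "t \<in> {0..1}" for t
    using powr_mono'[of 1 q t] that False by simp
  then show ?thesis by (intro exI[of _ 1]) simp
qed

lemma powr_add_powr_strict_midpoint: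
  fixes q :: real
  assumes "0 < q" "q \<noteq> 1"
  shows "\<exists>c>0. \<forall>t\<in>{0..1}.
    c * (t - 1/2)\<^sup>2 \<le> sgn (q - 1) * (t powr q + (1 - t) powr q - 2 * (1/2) powr q)"
proof (cases "2 \<le> q")
  case True
  let ?c = "4 * q * (1/2) powr q"
  have "?c * (t - 1/2)\<^sup>2 \<le> sgn (q - 1) * (t powr q + (1 - t) powr q - 2 * (1/2) powr q)"
    if "t \<in> {0..1}" for t
  proof -
    have *: "(1/2) powr q * (1 + q / 2 * (4 * s\<^sup>2 - 1)) \<le> s powr q" if "0 \<le> s" for s
    proof -
      have "1 + q / 2 * (4 * s\<^sup>2 - 1) \<le> (4 * s\<^sup>2) powr (q / 2)"
        by (rule powr_ge_affine) (use True in simp_all)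
      also have "\<dots> = (2 * s) powr q"
      proof (cases "s = 0")
        case False
        then have "4 * s\<^sup>2 = (2 * s) powr 2" using that by (simp add: power2_eq_square powr_mult)
        then show ?thesis by (simp only: powr_powr) simp
      qed simp
      finally have "(1/2) powr q * (1 + q / 2 * (4 * s\<^sup>2 - 1)) \<le> (1/2) powr q * (2 * s) powr q"
        by (intro mult_left_mono) simp_all
      also have "\<dots> = s powr q" using that by (simp flip: powr_mult)
      finally show ?thesis .
    qed
    have "?c * (t - 1/2)\<^sup>2 = (1/2) powr q * (1 + q / 2 * (4 * t\<^sup>2 - 1))
        + (1/2) powr q * (1 + q / 2 * (4 * (1 - t)\<^sup>2 - 1)) - 2 * (1/2) powr q"
      by (simp add: power2_eq_square algebra_simps)
    also have "\<dots> \<le> t powr q + (1 - t) powr q - 2 * (1/2) powr q"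
      using *[of t] *[of "1 - t"] that by simp
    finally show ?thesis using True by simp
  qed
  then show ?thesis using assms by (intro exI[of _ ?c]) simp
next
  case False
  let ?a = "sgn (q - 1)" and ?k = "q * (q - 1) / 2"
  have apos: "?a * (q - 1) > 0" using assms by (simp add: sgn_if)
  let ?c = "2 * ?a * ?k"
  let ?G = "\<lambda>t. ?a * (t powr q - ?k * t\<^sup>2)"
  have conv: "convex_on {0<..<1} ?G"
  proof (rule f''_ge0_imp_convex)
    fix t :: real assume t: "t \<in> {0<..<1}"
    then show "DERIV ?G t :> ?a * (q * t powr (q - 1) - ?k * (2 * t))"
      by (auto intro!: derivative_eq_intros)
    show "DERIV (\<lambda>t. ?a * (q * t powr (q - 1) - ?k * (2 * t))) t :>
        ?a * (q * ((q - 1) * t powr (q - 2)) - ?k * 2)"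
      using t by (auto intro!: derivative_eq_intros)
    have "1 \<le> t powr (q - 2)"
      using t False powr_mono'[of "q - 2" 0 t] by simp
    then have "0 \<le> (?a * (q - 1)) * (q * (t powr (q - 2) - 1))"
      using assms by (intro mult_nonneg_nonneg[OF less_imp_le[OF apos]]) simp
    then show "0 \<le> ?a * (q * ((q - 1) * t powr (q - 2)) - ?k * 2)"
      by (simp add: field_simps)
  qed simp
  let ?D = "\<lambda>t. ?a * (t powr q + (1 - t) powr q - 2 * (1/2) powr q) - ?c * (t - 1/2)\<^sup>2"
  have "0 \<le> ?D t" if t: "t \<in> {0<..<1}" for t
  proof -
    have "?G ((1 - 1/2) *\<^sub>R t + (1/2) *\<^sub>R (1 - t)) \<le> (1 - 1/2) * ?G t + 1/2 * ?G (1 - t)"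
      by (rule convex_onD[OF conv]) (use t in auto)
    moreover have "(1 - 1/2) *\<^sub>R t + (1/2) *\<^sub>R (1 - t) = 1/2" by (simp add: field_simps)
    ultimately have "?G (1/2) \<le> (1 - 1/2) * ?G t + 1/2 * ?G (1 - t)" by (simp only:)
    then show ?thesis by (simp add: power2_eq_square field_simps)
  qed
  moreover have "continuous_on {0..1} ?D"
    using assms by (intro continuous_intros continuous_on_powr') auto
  ultimately have "0 \<le> ?D t" if "t \<in> {0..1}" for t
    using continuous_ge_on_closure[of "{0<..<1}" ?D t 0] that by simp
  moreover have "?c > 0" using apos assms by (simp add: mult_ac zero_less_mult_iff)
  ultimately show ?thesis by (intro exI[of _ ?c]) force
qed

section \<open>Algebras with a faithful trace\<close>

lemma powr_approx:
  fixes p R :: real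
  assumes "0 < p"
  obtains q where "uniform_limit {0..R} (\<lambda>n. poly (q n)) (\<lambda>t. t powr (p / 2)) sequentially"
proof -
  have "continuous_on {0..R} (\<lambda>t. t powr (p / 2))"
    using assms by (intro continuous_on_powr' continuous_intros) auto
  then show ?thesis using that weierstrass_poly by blast
qed

lemma pos_op_norm_plus:
  assumes "A \<in> bop" "symmetric_op A"
  shows "pos_op (norm A *\<^sub>R id_blinfun + A)"
  unfolding pos_op_iff
proof (intro conjI allI)
  show "norm A *\<^sub>R id_blinfun + A \<in> bop" "symmetric_op (norm A *\<^sub>R id_blinfun + A)"
    using assms by (simp_all add: bop_add bop_scaleR symmetric_op_add symmetric_op_scaleR)
  fix x
  have "\<bar>A x \<bullet> x\<bar> \<le> norm A * norm x * norm x"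
    by (meson Cauchy_Schwarz_ineq2 mult_right_mono norm_blinfun norm_ge_zero order_trans)
  then show "0 \<le> (norm A *\<^sub>R id_blinfun + A) x \<bullet> x"
    by (simp add: blinfun_simps inner_add_left dot_square_norm power2_eq_square abs_le_iff)
qed

locale traced_algebra =
  fixes M :: "('a::complex_hilbert_space \<Rightarrow>\<^sub>L 'a) set"
  assumes M_bop: "A \<in> M \<Longrightarrow> A \<in> bop"
    and M_id [simp]: "id_blinfun \<in> M"
    and M_add [simp]: "A \<in> M \<Longrightarrow> B \<in> M \<Longrightarrow> A + B \<in> M"
    and M_compose [simp]: "A \<in> M \<Longrightarrow> B \<in> M \<Longrightarrow> A o\<^sub>L B \<in> M"
    and M_scale_op: "A \<in> M \<Longrightarrow> scale_op c A \<in> M"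
    and M_adj [simp]: "A \<in> M \<Longrightarrow> adj A \<in> M"
    and M_limit: "(\<And>n. S n \<in> M) \<Longrightarrow> S \<longlonglongrightarrow> A \<Longrightarrow> A \<in> M"
    and M_trace: "normal_trace M (factor_trace M)"
begin

definition tr :: "('a \<Rightarrow>\<^sub>L 'a) \<Rightarrow> real"
  where "tr A = Re (factor_trace M A)"

definition tr_powr :: "real \<Rightarrow> ('a \<Rightarrow>\<^sub>L 'a) \<Rightarrow> real"
  where "tr_powr p A = tr (cont_calculus (\<lambda>t. t powr p) (modulus A))"

lemma M_scaleR [simp]: "A \<in> M \<Longrightarrow> r *\<^sub>R A \<in> M"
  using M_scale_op[of A "complex_of_real r"] by (simp add: scale_op_of_real)

lemma M_diff [simp]: "A \<in> M \<Longrightarrow> B \<in> M \<Longrightarrow> A - B \<in> M"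
  using M_add[of A "-1 *\<^sub>R B"] M_scaleR[of B "-1"] by simp

lemma M_zero [simp]: "0 \<in> M"
  using M_scaleR[OF M_id, of 0] by simp

lemma M_poly [simp]: "A \<in> M \<Longrightarrow> poly_op q A \<in> M"
  by (induction q) simp_all

lemma tracial: "tracial_state M (factor_trace M)" and faithful: "faithful M (factor_trace M)"
  using M_trace by (auto simp: normal_trace_def)

lemma tr_add [simp]: "A \<in> M \<Longrightarrow> B \<in> M \<Longrightarrow> tr (A + B) = tr A + tr B"
  using tracial by (simp add: tracial_state_def tr_def)

lemma tr_scaleR [simp]: "A \<in> M \<Longrightarrow> tr (r *\<^sub>R A) = r * tr A"
  using tracial by (simp add: tracial_state_def tr_def flip: scale_op_of_real)

lemma tr_diff [simp]: "A \<in> M \<Longrightarrow> B \<in> M \<Longrightarrow> tr (A - B) = tr A - tr B"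
  using tr_add[of A "-1 *\<^sub>R B"] tr_scaleR[of B "-1"] M_scaleR[of B "-1"] by simp

lemma tr_id [simp]: "tr id_blinfun = 1"
  using tracial by (simp add: tracial_state_def tr_def)

lemma tr_nonneg: "A \<in> M \<Longrightarrow> pos_op A \<Longrightarrow> 0 \<le> tr A"
  using tracial by (simp add: tracial_state_def tr_def complex_nonneg_Reals_iff)

lemma tr_eq_0: "A \<in> M \<Longrightarrow> pos_op A \<Longrightarrow> tr A = 0 \<Longrightarrow> A = 0"
  using faithful tracial
  by (simp add: tracial_state_def tr_def complex_nonneg_Reals_iff faithful_def complex_eq_iff)

lemma tr_lower: "A \<in> M \<Longrightarrow> symmetric_op A \<Longrightarrow> - norm A \<le> tr A"
  using tr_nonneg[OF _ pos_op_norm_plus[OF M_bop]] by force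

lemma tr_bound:
  assumes "A \<in> M" "symmetric_op A"
  shows "\<bar>tr A\<bar> \<le> norm A"
  using tr_lower[OF assms] tr_lower[of "-1 *\<^sub>R A"] assms M_scaleR[of A "-1"]
    symmetric_op_scaleR[of A "-1"] tr_scaleR[of A "-1"] by simp

lemma factor_trace_symmetric:
  assumes "A \<in> M" "symmetric_op A"
  shows "factor_trace M A = complex_of_real (tr A)"
proof -
  have "Im (factor_trace M (norm A *\<^sub>R id_blinfun + A)) = 0"
  proof -
    have "\<forall>B\<in>M. pos_op B \<longrightarrow> factor_trace M B \<in> \<real>\<^sub>\<ge>\<^sub>0"
      using tracial by (simp add: tracial_state_def)
    then show ?thesis
      using assms pos_op_norm_plus[OF M_bop] M_scaleR[OF M_id] M_add
      by (metis complex_nonneg_Reals_iff)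
  qed
  moreover have "factor_trace M (norm A *\<^sub>R id_blinfun + A) = complex_of_real (norm A) + factor_trace M A"
    using tracial assms M_scaleR[OF M_id]
    by (simp add: tracial_state_def flip: scale_op_of_real)
  ultimately show ?thesis by (simp add: complex_eq_iff tr_def)
qed

lemma tr_tendsto:
  assumes "\<And>n. S n \<in> M" "\<And>n. symmetric_op (S n)" "S \<longlonglongrightarrow> A"
  shows "(\<lambda>n. tr (S n)) \<longlonglongrightarrow> tr A"
proof -
  have A: "A \<in> M" "symmetric_op A"
    using M_limit[OF assms(1,3)] symmetric_op_limit[OF assms(2,3)] by auto
  have lim: "(\<lambda>n. norm (S n - A)) \<longlonglongrightarrow> 0"
    using assms(3) by (simp add: LIM_zero tendsto_norm_zero)
  have "\<bar>tr (S n) - tr A\<bar> \<le> norm (S n - A)" for n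
    using tr_bound[of "S n - A"] A assms(1,2)[of n] by (simp add: symmetric_op_diff)
  then have "\<forall>\<^sub>F n in sequentially. norm (tr (S n) - tr A) \<le> norm (S n - A)"
    by simp
  then have "(\<lambda>n. tr (S n) - tr A) \<longlonglongrightarrow> 0"
    by (rule Lim_null_comparison[OF _ lim])
  then show ?thesis by (rule LIM_zero_cancel)
qed

lemma tr_poly_tendsto:
  assumes "A \<in> M" "norm A \<le> R" "0 < p"
    and q: "uniform_limit {0..R\<^sup>2} (\<lambda>n. poly (q n)) (\<lambda>t. t powr (p / 2)) sequentially"
  shows "(\<lambda>n. tr (poly_op (q n) (adj A o\<^sub>L A))) \<longlonglongrightarrow> tr_powr p A"
  unfolding tr_powr_def
  using assms pos_op_symmetric[OF pos_op_adj_compose]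
  by (intro tr_tendsto modulus_powr_tendsto[OF M_bop _ _ q]) (auto intro: symmetric_op_poly M_bop)

lemma tr_poly_le_limit:
  assumes H: "H \<in> M" "pos_op H" "norm H \<le> R"
    and q: "uniform_limit {0..R} (\<lambda>n. poly (q n)) f sequentially"
    and L: "(\<lambda>n. tr (poly_op (q n) H)) \<longlonglongrightarrow> L"
    and g: "\<And>t. t \<in> {0..R} \<Longrightarrow> poly g t \<le> f t"
  shows "tr (poly_op g H) \<le> L"
proof (rule field_le_epsilon)
  fix e :: real assume e: "e > 0"
  have ev: "\<forall>\<^sub>F n in sequentially. tr (poly_op g H) - e \<le> tr (poly_op (q n) H)"
    using uniform_limitD[OF q e]
  proof eventually_elim
    case (elim n)
    have "pos_op (poly_op (q n + [:e:] - g) H)"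
    proof (rule pos_op_poly[OF H(2,3)])
      fix t assume t: "t \<in> {0..R}"
      then have "dist (poly (q n) t) (f t) < e" using elim by blast
      then show "0 \<le> poly (q n + [:e:] - g) t"
        using g[OF t] by (simp add: dist_real_def)
    qed
    from tr_nonneg[OF _ this] show ?case
      using H(1) by (simp add: poly_op_add poly_op_diff)
  qed
  have "tr (poly_op g H) - e \<le> L"
    by (rule tendsto_lowerbound[OF L ev]) simp
  then show "tr (poly_op g H) \<le> L + e" by simp
qed

lemma tr_powr_nonneg:
  assumes "A \<in> M" "0 < p"
  shows "0 \<le> tr_powr p A"
proof -
  obtain q where q: "uniform_limit {0..(norm A)\<^sup>2} (\<lambda>n. poly (q n)) (\<lambda>t. t powr (p / 2)) sequentially"
    using powr_approx[OF assms(2)] .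
  have "tr (poly_op 0 (adj A o\<^sub>L A)) \<le> tr_powr p A"
    by (rule tr_poly_le_limit[OF _ _ norm_square_adj q tr_poly_tendsto[OF assms(1) order_refl assms(2) q]])
      (use assms in \<open>auto intro: M_bop pos_op_adj_compose\<close>)
  then show ?thesis using tr_scaleR[OF M_zero, of 0] by simp
qed

lemma Lp_norm_eq: "Lp_norm p M A = tr_powr p A powr (1 / p)"
  by (simp add: Lp_norm_def tr_powr_def tr_def)

lemma tr_powr_eq:
  assumes "A \<in> M" "0 < p"
  shows "tr_powr p A = Lp_norm p M A powr p"
  using tr_powr_nonneg[OF assms] assms(2) by (simp add: Lp_norm_eq powr_powr)

lemma tr_powr_2:
  assumes "A \<in> M"
  shows "tr_powr 2 A = tr (adj A o\<^sub>L A)"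
proof -
  have "uniform_limit {0..(norm A)\<^sup>2} (\<lambda>n. poly [:0, 1:]) (\<lambda>t. t powr (2 / 2)) sequentially"
    by (intro uniform_limitI always_eventually) simp
  from tr_poly_tendsto[OF assms order_refl _ this] show ?thesis
    by (simp add: LIMSEQ_const_iff)
qed

end

section \<open>Distances between projections of trace one half\<close>

definition equiangular :: "('a::real_normed_vector \<Rightarrow>\<^sub>L 'a) \<Rightarrow> ('a \<Rightarrow>\<^sub>L 'a) \<Rightarrow> bool"
  where "equiangular P Q \<longleftrightarrow> (P - Q) o\<^sub>L (P - Q) = (1/2) *\<^sub>R id_blinfun"

lemma norm_le_1_of_square:
  assumes "symmetric_op A" "pos_op (id_blinfun - (A o\<^sub>L A))"
  shows "norm A \<le> 1"
proof (rule norm_blinfun_bound)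
  fix x
  have "A x \<bullet> A x \<le> x \<bullet> x"
    using pos_op_nonneg[OF assms(2), of x] assms(1)
    by (simp add: blinfun_simps inner_diff_left symmetric_op_def)
  then show "norm (A x) \<le> 1 * norm x" by (simp add: norm_le)
qed simp

context traced_algebra
begin

lemma tr_commute: "A \<in> M \<Longrightarrow> B \<in> M \<Longrightarrow> tr (A o\<^sub>L B) = tr (B o\<^sub>L A)"
  using tracial by (simp add: tracial_state_def tr_def)

lemma half_projections_iff:
  "P \<in> half_projections M \<longleftrightarrow> P \<in> M \<and> symmetric_op P \<and> P o\<^sub>L P = P \<and> tr P = 1/2"
proof -
  have "adj P = P \<longleftrightarrow> symmetric_op P" if "P \<in> M"
    using M_bop[OF that] selfadjoint_iff[of P] by (simp add: selfadjoint_def)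
  moreover have "factor_trace M P = 1/2 \<longleftrightarrow> tr P = 1/2" if "P \<in> M" "symmetric_op P"
    using factor_trace_symmetric[OF that] by (simp add: complex_eq_iff)
  ultimately show ?thesis
    by (auto simp: half_projections_def)
qed

lemma half_projections_compl: "Q \<in> half_projections M \<Longrightarrow> id_blinfun - Q \<in> half_projections M"
  by (simp add: half_projections_iff symmetric_op_diff compose_simps)

lemma half_projectionD:
  assumes "P \<in> half_projections M"
  shows "P \<in> M" "symmetric_op P" "P o\<^sub>L P = P" "tr P = 1/2"
  using assms by (simp_all add: half_projections_iff)

lemma symmetric_square_eq_0:
  assumes "Z \<in> M" "symmetric_op Z" "tr (Z o\<^sub>L Z) = 0"
  shows "Z = 0"
proof (rule blinfun_eqI)
  fix x
  have "Z o\<^sub>L Z = 0"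
    using assms by (intro tr_eq_0 pos_op_square) (simp_all add: M_bop)
  then have "(Z o\<^sub>L Z) x \<bullet> x = 0" by simp
  then show "Z x = blinfun_apply 0 x"
    using assms(2) unfolding symmetric_op_def
    by (metis blinfun.zero_left blinfun_apply_blinfun_compose inner_eq_zero_iff)
qed

context
  fixes P Q
  assumes P: "P \<in> half_projections M" and Q: "Q \<in> half_projections M"
begin

abbreviation (input) "dist_sq \<equiv> (P - Q) o\<^sub>L (P - Q)"

abbreviation (input) "Q' \<equiv> id_blinfun - Q"

lemmas PQ = half_projectionD[OF P] half_projectionD[OF Q]

lemma adj_PQ: "adj (P - Q) = P - Q" "adj (P - Q') = P - Q'"
  using PQ M_bop by (auto intro!: selfadjoint_iff[THEN iffD2, unfolded selfadjoint_def, THEN conjunct2]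
      simp: symmetric_op_diff)

lemma dist_sq_compl: "(P - Q') o\<^sub>L (P - Q') = id_blinfun - dist_sq"
  using PQ by (simp add: compose_simps algebra_simps)

lemma dist_sq_pos: "pos_op dist_sq" "pos_op (id_blinfun - dist_sq)"
proof -
  show "pos_op dist_sq" using PQ by (intro pos_op_square) (simp_all add: symmetric_op_diff M_bop)
  have "pos_op ((P - Q') o\<^sub>L (P - Q'))"
    using PQ by (intro pos_op_square) (simp_all add: symmetric_op_diff M_bop)
  then show "pos_op (id_blinfun - dist_sq)" by (simp add: dist_sq_compl)
qed

lemma dist_sq_mem: "dist_sq \<in> M" using PQ by simp

lemma norm_PQ: "norm (P - Q) \<le> 1" "norm (P - Q') \<le> 1" "norm dist_sq \<le> 1"
proof -
  show *: "norm (P - Q) \<le> 1"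
    by (rule norm_le_1_of_square) (use PQ dist_sq_pos in \<open>simp_all add: symmetric_op_diff\<close>)
  show "norm (P - Q') \<le> 1"
    by (rule norm_le_1_of_square) (use PQ dist_sq_pos in \<open>simp_all add: symmetric_op_diff dist_sq_compl\<close>)
  show "norm dist_sq \<le> 1"
    using norm_blinfun_compose[of "P - Q" "P - Q"] * by (meson mult_le_one norm_ge_zero order_trans)
qed

lemma tr_poly_dist_sq_tendsto:
  assumes "0 < p" "uniform_limit {0..1} (\<lambda>n. poly (q n)) (\<lambda>t. t powr (p / 2)) sequentially"
  shows "(\<lambda>n. tr (poly_op (q n) dist_sq)) \<longlonglongrightarrow> tr_powr p (P - Q)"
    and "(\<lambda>n. tr (poly_op (q n) (id_blinfun - dist_sq))) \<longlonglongrightarrow> tr_powr p (P - Q')"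
  using tr_poly_tendsto[of "P - Q" 1 p q] tr_poly_tendsto[of "P - Q'" 1 p q] assms norm_PQ PQ
  by (simp_all add: adj_PQ dist_sq_compl)

lemma tr_powr_eq_1_iff:
  assumes "0 < p"
  shows "tr_powr p (P - Q) = 1 \<longleftrightarrow> P = Q'"
proof
  obtain q where q: "uniform_limit {0..1} (\<lambda>n. poly (q n)) (\<lambda>t. t powr (p / 2)) sequentially"
    using powr_approx[OF assms] .
  note lim = tr_poly_dist_sq_tendsto(1)[OF assms q]
  show "P = Q'" if *: "tr_powr p (P - Q) = 1"
  proof -
    obtain c where c: "c > 0" "\<And>t. t \<in> {0..1} \<Longrightarrow> t powr (p / 2) \<le> 1 - c * (1 - t)"
      using powr_le_one_minus[of "p / 2"] assms by auto
    have "tr (poly_op [:c - 1, - c:] dist_sq) \<le> - tr_powr p (P - Q)"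
    proof (rule tr_poly_le_limit[OF dist_sq_mem dist_sq_pos(1) norm_PQ(3)])
      show "uniform_limit {0..1} (\<lambda>n. poly (- q n)) (\<lambda>t. - (t powr (p / 2))) sequentially"
        by (rule uniform_limit_cong'[THEN iffD1, OF _ _ uniform_limit_uminus[OF q]]) simp_all
      show "(\<lambda>n. tr (poly_op (- q n) dist_sq)) \<longlonglongrightarrow> - tr_powr p (P - Q)"
        using tendsto_minus[OF lim] tr_scaleR[of _ "-1"] dist_sq_mem by (simp add: poly_op_minus)
      show "poly [:c - 1, - c:] t \<le> - (t powr (p / 2))" if "t \<in> {0..1}" for t
        using c(2)[OF that] by (simp add: algebra_simps)
    qed
    moreover have "poly_op [:c - 1, - c:] Y = (c - 1) *\<^sub>R id_blinfun - c *\<^sub>R Y" for Y :: "'a \<Rightarrow>\<^sub>L 'a"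
      by (rule blinfun_eqI) (simp add: blinfun_simps)
    ultimately have "c * (1 - tr dist_sq) \<le> 0"
      using * tr_diff[OF M_scaleR[OF M_id] M_scaleR[OF dist_sq_mem]] tr_scaleR[OF M_id] tr_scaleR[OF dist_sq_mem]
      by (simp add: right_diff_distrib)
    then have "tr (id_blinfun - dist_sq) \<le> 0"
      using c(1) dist_sq_mem by (simp add: mult_le_0_iff)
    then have "tr ((P - Q') o\<^sub>L (P - Q')) = 0"
      using tr_nonneg[OF _ dist_sq_pos(2)] dist_sq_mem M_diff[OF M_id dist_sq_mem] unfolding dist_sq_compl by (intro antisym) auto
    then have "P - Q' = 0"
      using PQ by (intro symmetric_square_eq_0) (simp_all add: symmetric_op_diff)
    then show ?thesis by simp
  qed
  show "tr_powr p (P - Q) = 1" if "P = Q'"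
  proof -
    have "P - Q' = 0" using that by (simp only: diff_self)
    then have "id_blinfun - dist_sq = 0"
      using dist_sq_compl by (simp only: blinfun_compose_zero)
    then have "dist_sq = id_blinfun" by (metis eq_iff_diff_eq_0)
    then have "(\<lambda>n. poly (q n) 1) \<longlonglongrightarrow> tr_powr p (P - Q)"
      using lim by (simp add: poly_op_id[of _ 1, simplified])
    moreover have "(\<lambda>n. poly (q n) 1) \<longlonglongrightarrow> 1"
      using tendsto_uniform_limitI[OF q, of 1] by simp
    ultimately show ?thesis by (rule LIMSEQ_unique)
  qed
qed

lemma equiangular_iff_tr_powr:
  assumes "0 < p" "p \<noteq> 2"
  shows "equiangular P Q \<longleftrightarrow>
    tr_powr p (P - Q) + tr_powr p (P - Q') = 2 * (1/2) powr (p / 2)"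
proof
  obtain q where q: "uniform_limit {0..1} (\<lambda>n. poly (q n)) (\<lambda>t. t powr (p / 2)) sequentially"
    using powr_approx[OF assms(1)] .
  note lim = tr_poly_dist_sq_tendsto[OF assms(1) q]
  show "tr_powr p (P - Q) + tr_powr p (P - Q') = 2 * (1/2) powr (p / 2)" if "equiangular P Q"
  proof -
    have dist_sq: "dist_sq = (1/2) *\<^sub>R id_blinfun" using that by (simp add: equiangular_def)
    then have dist_sq': "id_blinfun - dist_sq = (1/2) *\<^sub>R id_blinfun"
      by (simp add: scaleR_left_diff_distrib[of 1 "1/2", simplified, symmetric])
    have half: "(\<lambda>n. poly (q n) (1/2)) \<longlonglongrightarrow> (1/2) powr (p / 2)"
      using tendsto_uniform_limitI[OF q, of "1/2"] by simp
    have "(\<lambda>n. poly (q n) (1/2)) \<longlonglongrightarrow> tr_powr p (P - Q)"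
      using lim(1) unfolding dist_sq poly_op_id by simp
    moreover have "(\<lambda>n. poly (q n) (1/2)) \<longlonglongrightarrow> tr_powr p (P - Q')"
      using lim(2) unfolding dist_sq' poly_op_id by simp
    ultimately have "tr_powr p (P - Q) = (1/2) powr (p / 2)" "tr_powr p (P - Q') = (1/2) powr (p / 2)"
      using LIMSEQ_unique[OF _ half] by blast+
    then show ?thesis by simp
  qed
  show "equiangular P Q" if *: "tr_powr p (P - Q) + tr_powr p (P - Q') = 2 * (1/2) powr (p / 2)"
  proof -
    let ?a = "sgn (p / 2 - 1)" and ?k = "2 * (1/2) powr (p / 2)" and ?T = "dist_sq - (1/2) *\<^sub>R id_blinfun"
    obtain c where c: "c > 0" "\<And>t. t \<in> {0..1} \<Longrightarrow>
        c * (t - 1/2)\<^sup>2 \<le> ?a * (t powr (p / 2) + (1 - t) powr (p / 2) - ?k)"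
      using powr_add_powr_strict_midpoint[of "p / 2"] assms by auto
    let ?r = "\<lambda>n. smult ?a (q n + q n \<circ>\<^sub>p [:1, -1:] - [:?k:])"
    let ?f = "\<lambda>t. ?a * (t powr (p / 2) + (1 - t) powr (p / 2) - ?k)"
    let ?g = "smult c ([:-1/2, 1:] * [:-1/2, 1:])"
    have gen: "tr (poly_op (?r n) Y) =
        ?a * (tr (poly_op (q n) Y) + tr (poly_op (q n) (id_blinfun - Y)) - ?k)" if "Y \<in> M" for Y n
      using that by (simp add: poly_op_smult poly_op_add poly_op_diff poly_op_pcompose compose_simps)
    have "tr (poly_op ?g dist_sq) \<le> ?a * (tr_powr p (P - Q) + tr_powr p (P - Q') - ?k)"
    proof (rule tr_poly_le_limit[OF dist_sq_mem dist_sq_pos(1) norm_PQ(3)])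
      have "uniform_limit {0..1} (\<lambda>n t. poly (q n) (1 - t)) (\<lambda>t. (1 - t) powr (p / 2)) sequentially"
        by (rule uniform_limit_compose'[OF q, of "\<lambda>t. 1 - t"]) auto
      then have "uniform_limit {0..1} (\<lambda>n t. ?a * (poly (q n) t + poly (q n) (1 - t) - ?k)) ?f sequentially"
        by (intro uniform_limit_intros q)
      then show "uniform_limit {0..1} (\<lambda>n. poly (?r n)) ?f sequentially"
        by (rule uniform_limit_cong'[THEN iffD1, rotated -1]) (simp_all add: poly_pcompose)
      have "(\<lambda>n. ?a * (tr (poly_op (q n) dist_sq) + tr (poly_op (q n) (id_blinfun - dist_sq)) - ?k)) \<longlonglongrightarrow>
          ?a * (tr_powr p (P - Q) + tr_powr p (P - Q') - ?k)"
        by (intro tendsto_intros lim)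
      then show "(\<lambda>n. tr (poly_op (?r n) dist_sq)) \<longlonglongrightarrow>
          ?a * (tr_powr p (P - Q) + tr_powr p (P - Q') - ?k)"
        unfolding gen[OF dist_sq_mem] .
      show "poly ?g t \<le> ?f t" if "t \<in> {0..1}" for t
      proof -
        have "poly ?g t = c * (t - 1/2)\<^sup>2" by (simp add: power2_eq_square algebra_simps)
        then show ?thesis using c(2)[OF that] by simp
      qed
    qed
    also have "\<dots> = 0" using * by simp
    also have "poly_op ?g dist_sq = c *\<^sub>R (?T o\<^sub>L ?T)"
      by (simp add: poly_op_smult poly_op_mult compose_simps del: mult_pCons_left mult_pCons_right)
    finally have "tr (?T o\<^sub>L ?T) \<le> 0"
      using c(1) dist_sq_mem by (simp add: mult_le_0_iff del: tr_diff tr_add)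
    moreover have T: "?T \<in> M" "symmetric_op ?T"
      using dist_sq_mem by (simp, intro symmetric_op_diff symmetric_op_scaleR symmetric_op_id
          pos_op_symmetric[OF dist_sq_pos(1)])
    moreover have "0 \<le> tr (?T o\<^sub>L ?T)"
      using T by (intro tr_nonneg pos_op_square M_bop) auto
    ultimately have "?T = 0" by (intro symmetric_square_eq_0) auto
    then show ?thesis by (simp add: equiangular_def)
  qed
qed

lemma tr_powr_2_diff: "tr_powr 2 (P - Q) = 1 - tr (P o\<^sub>L Q) - tr (Q o\<^sub>L P)"
  using PQ by (simp add: tr_powr_2 adj_PQ compose_simps)

end

text \<open>The Hilbert-Schmidt case: \<open>P\<close> is equiangular to \<open>Q\<close> iff the normalised midpoint
  \<open>R = (1 + \<surd>2 (P + Q - 1)) / 2\<close> is again a projection, and this \<open>R\<close> is characterised by its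
  distances to \<open>P\<close> and \<open>Q\<close>.\<close>

lemma equiangular_iff_midpoint:
  assumes P: "P \<in> half_projections M" and Q: "Q \<in> half_projections M"
  shows "equiangular P Q \<longleftrightarrow> tr_powr 2 (P - Q) = 1/2 \<and>
    (\<exists>R\<in>half_projections M. tr_powr 2 (R - P) = (2 - sqrt 2) / 4 \<and> tr_powr 2 (R - Q) = (2 - sqrt 2) / 4)"
proof -
  note PQ = half_projectionD[OF P] half_projectionD[OF Q]
  define s where "s = sqrt 2 / 2"
  have ss: "s * s = 1/2" by (simp add: s_def)
  define N where "N = P - (id_blinfun - Q)"
  define R where "R = (1/2) *\<^sub>R id_blinfun + s *\<^sub>R N"
  have N: "N \<in> M" "symmetric_op N" "tr N = 0"
    using PQ by (auto intro!: symmetric_op_diff simp: N_def)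
  have NP: "tr (N o\<^sub>L P) = tr (P o\<^sub>L Q)" and PN: "tr (P o\<^sub>L N) = tr (P o\<^sub>L Q)"
    and NQ: "tr (N o\<^sub>L Q) = tr (P o\<^sub>L Q)" and QN: "tr (Q o\<^sub>L N) = tr (P o\<^sub>L Q)"
    using PQ tr_commute[of P Q] by (simp_all add: N_def compose_simps)
  have R: "R \<in> M" "symmetric_op R" "tr R = 1/2"
    using N by (auto intro!: symmetric_op_add symmetric_op_scaleR simp: R_def)
  have NN: "N o\<^sub>L N = id_blinfun - ((P - Q) o\<^sub>L (P - Q))"
    unfolding N_def by (rule dist_sq_compl[OF P Q])
  have RR: "(R o\<^sub>L R) - R = (1/2) *\<^sub>R ((1/2) *\<^sub>R id_blinfun - ((P - Q) o\<^sub>L (P - Q)))"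
  proof -
    have dbl: "s *\<^sub>R N = (s / 2) *\<^sub>R N + (s / 2) *\<^sub>R N"
      "(1/2) *\<^sub>R id_blinfun = (1/4) *\<^sub>R id_blinfun + (1/4) *\<^sub>R (id_blinfun :: 'a \<Rightarrow>\<^sub>L 'a)"
      by (simp_all flip: scaleR_add_left)
    have "R o\<^sub>L R = (1/4) *\<^sub>R id_blinfun + s *\<^sub>R N + (1/2) *\<^sub>R (N o\<^sub>L N)"
      by (simp add: R_def compose_simps scaleR_add_right ss) (simp add: dbl(1))
    then have "(R o\<^sub>L R) - R = (1/2) *\<^sub>R (id_blinfun - ((P - Q) o\<^sub>L (P - Q))) - (1/4) *\<^sub>R id_blinfun"
      unfolding NN by (simp only: R_def) (simp add: dbl(2))
    then show ?thesis
      by (simp add: scaleR_diff_right) (simp add: dbl(2))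
  qed
  have eq: "equiangular P Q \<longleftrightarrow> R o\<^sub>L R = R"
  proof -
    have "R o\<^sub>L R = R \<longleftrightarrow> (R o\<^sub>L R) - R = 0" by simp
    also have "\<dots> \<longleftrightarrow> equiangular P Q"
      unfolding RR equiangular_def by auto
    finally show ?thesis by simp
  qed
  have PQtr: "tr_powr 2 (P - Q) = 1 - 2 * tr (P o\<^sub>L Q)"
    using tr_powr_2_diff[OF P Q] PQ tr_commute[of P Q] by simp
  show ?thesis
  proof (intro iffI)
    assume e: "equiangular P Q"
    then have d: "tr_powr 2 (P - Q) = 1/2"
      using PQ by (simp add: tr_powr_2 adj_PQ[OF P Q] equiangular_def)
    have Rh: "R \<in> half_projections M"
      using R eq e unfolding half_projections_iff by blast
    have c: "tr (P o\<^sub>L Q) = 1/4" using d PQtr by simp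
    have "tr_powr 2 (R - P) = (2 - sqrt 2) / 4" "tr_powr 2 (R - Q) = (2 - sqrt 2) / 4"
      unfolding tr_powr_2_diff[OF Rh P] tr_powr_2_diff[OF Rh Q]
      using PQ N NP PN NQ QN c by (simp_all add: R_def compose_simps s_def field_simps)
    then show "tr_powr 2 (P - Q) = 1/2 \<and>
      (\<exists>R\<in>half_projections M. tr_powr 2 (R - P) = (2 - sqrt 2) / 4 \<and> tr_powr 2 (R - Q) = (2 - sqrt 2) / 4)"
      using d Rh by blast
  next
    assume "tr_powr 2 (P - Q) = 1/2 \<and>
      (\<exists>R\<in>half_projections M. tr_powr 2 (R - P) = (2 - sqrt 2) / 4 \<and> tr_powr 2 (R - Q) = (2 - sqrt 2) / 4)"
    then obtain S where d: "tr_powr 2 (P - Q) = 1/2" and S: "S \<in> half_projections M"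
      and SPQ: "tr_powr 2 (S - P) = (2 - sqrt 2) / 4" "tr_powr 2 (S - Q) = (2 - sqrt 2) / 4" by blast
    note S' = half_projectionD[OF S]
    have c: "tr (P o\<^sub>L Q) = 1/4" using d PQtr by simp
    have SP: "tr (S o\<^sub>L P) = (2 + sqrt 2) / 8" "tr (P o\<^sub>L S) = (2 + sqrt 2) / 8"
      using SPQ(1) tr_powr_2_diff[OF S P] tr_commute[OF S'(1) PQ(1)] by (simp_all add: field_simps)
    have SQ: "tr (S o\<^sub>L Q) = (2 + sqrt 2) / 8" "tr (Q o\<^sub>L S) = (2 + sqrt 2) / 8"
      using SPQ(2) tr_powr_2_diff[OF S Q] tr_commute[OF S'(1) PQ(5)] by (simp_all add: field_simps)
    have SN: "tr (S o\<^sub>L N) = sqrt 2 / 4" "tr (N o\<^sub>L S) = sqrt 2 / 4"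
      using PQ S' SP SQ by (simp_all add: N_def compose_simps field_simps)
    have NNtr: "tr (N o\<^sub>L N) = 1/2"
      unfolding NN using d PQ by (simp add: tr_powr_2 adj_PQ[OF P Q])
    have "tr (S o\<^sub>L R) = 1/2 * tr S + s * tr (S o\<^sub>L N)" "tr (R o\<^sub>L S) = 1/2 * tr S + s * tr (N o\<^sub>L S)"
      using S' N by (simp_all add: R_def compose_simps)
    moreover have "s * (sqrt 2 / 4) = 1/4" by (simp add: s_def)
    ultimately have SR: "tr (S o\<^sub>L R) = 1/2" "tr (R o\<^sub>L S) = 1/2"
      unfolding SN S'(4) by simp_all
    have RRtr: "tr (R o\<^sub>L R) = 1/2"
    proof -
      have "tr (R o\<^sub>L R) = 1/4 + s * s * tr (N o\<^sub>L N)"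
        using N by (simp add: R_def compose_simps)
      then show ?thesis unfolding ss NNtr by simp
    qed
    have "S - R = 0"
      using S' R SR RRtr by (intro symmetric_square_eq_0) (simp_all add: symmetric_op_diff compose_simps)
    then have "R o\<^sub>L R = R" using half_projectionD(3)[OF S] by simp
    then show "equiangular P Q" using eq by simp
  qed
qed

end

lemma Lp_isometry_equiangular:
  assumes M1: "traced_algebra M1" and M2: "traced_algebra M2" and p: "0 < p"
    and iso: "Lp_isometry_on p M1 M2 (half_projections M1) \<phi>"
    and onto: "\<phi> ` half_projections M1 = half_projections M2"
    and P: "P \<in> half_projections M1" and Q: "Q \<in> half_projections M1"
  shows "equiangular (\<phi> P) (\<phi> Q) \<longleftrightarrow> equiangular P Q"
proof -
  interpret M1: traced_algebra M1 by fact
  interpret M2: traced_algebra M2 by fact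
  have \<phi>: "\<phi> A \<in> half_projections M2" if "A \<in> half_projections M1" for A
    using that onto by blast
  have dist: "M1.tr_powr p (A - B) = M2.tr_powr p (\<phi> A - \<phi> B)"
    if "A \<in> half_projections M1" "B \<in> half_projections M1" for A B
    using that \<phi>[OF that(1)] \<phi>[OF that(2)] iso p
    by (simp add: Lp_isometry_on_def M1.tr_powr_eq M2.tr_powr_eq half_projections_def)
  show ?thesis
  proof (cases "p = 2")
    case False
    have Q': "id_blinfun - Q \<in> half_projections M1"
      by (rule M1.half_projections_compl[OF Q])
    have "M1.tr_powr p ((id_blinfun - Q) - Q) = 1"
      using M1.tr_powr_eq_1_iff[OF Q' Q p] by simp
    then have "\<phi> (id_blinfun - Q) = id_blinfun - \<phi> Q"
      using M2.tr_powr_eq_1_iff[OF \<phi>[OF Q'] \<phi>[OF Q] p] dist[OF Q' Q] by simp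
    then show ?thesis
      using M1.equiangular_iff_tr_powr[OF P Q p False] dist[OF P Q] dist[OF P Q']
        M2.equiangular_iff_tr_powr[OF \<phi>[OF P] \<phi>[OF Q] p False] by simp
  next
    case True
    have "(\<exists>R\<in>half_projections M2. M2.tr_powr 2 (R - \<phi> P) = k \<and> M2.tr_powr 2 (R - \<phi> Q) = k) \<longleftrightarrow>
        (\<exists>R\<in>half_projections M1. M1.tr_powr 2 (R - P) = k \<and> M1.tr_powr 2 (R - Q) = k)" for k
      unfolding onto[symmetric] using dist P Q by (simp add: True)
    then show ?thesis
      using M1.equiangular_iff_midpoint[OF P Q] M2.equiangular_iff_midpoint[OF \<phi>[OF P] \<phi>[OF Q]]
        dist[OF P Q] by (simp only: True)
  qed
qed

section \<open>Commutants and monotone limits\<close>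

definition up_filter :: "('a::complex_hilbert_space \<Rightarrow>\<^sub>L 'a) set \<Rightarrow> ('a \<Rightarrow>\<^sub>L 'a) filter"
  where "up_filter D = (INF A\<in>D. principal {B \<in> D. pos_op (B - A)})"

definition op_directed :: "('a::complex_hilbert_space \<Rightarrow>\<^sub>L 'a) set \<Rightarrow> bool"
  where "op_directed D \<longleftrightarrow> D \<noteq> {} \<and> (\<forall>A\<in>D. selfadjoint A) \<and>
    (\<forall>A\<in>D. \<forall>B\<in>D. \<exists>C\<in>D. pos_op (C - A) \<and> pos_op (C - B))"

definition op_monotone_limit :: "('a::complex_hilbert_space \<Rightarrow>\<^sub>L 'a) set \<Rightarrow> ('a \<Rightarrow>\<^sub>L 'a) \<Rightarrow> bool"
  where "op_monotone_limit D T \<longleftrightarrow> selfadjoint T \<and> (\<forall>A\<in>D. pos_op (T - A)) \<and>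
    (\<forall>x. \<forall>e>0. \<exists>A\<in>D. (T - A) x \<bullet> x < e)"

lemma pos_op_trans: "pos_op (C - B) \<Longrightarrow> pos_op (B - A) \<Longrightarrow> pos_op (C - A)"
  using pos_op_add[of "C - B" "B - A"] by simp

lemma eventually_up_filter:
  assumes "op_directed D"
  shows "eventually P (up_filter D) \<longleftrightarrow> (\<exists>A\<in>D. \<forall>B\<in>D. pos_op (B - A) \<longrightarrow> P B)"
  unfolding up_filter_def
proof (subst eventually_INF_base)
  show "D \<noteq> {}" using assms by (simp add: op_directed_def)
  show "\<exists>C\<in>D. principal {B \<in> D. pos_op (B - C)} \<le>
      inf (principal {B \<in> D. pos_op (B - A)}) (principal {B \<in> D. pos_op (B - A')})"
    if "A \<in> D" "A' \<in> D" for A A'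
  proof -
    obtain C where "C \<in> D" "pos_op (C - A)" "pos_op (C - A')"
      using assms \<open>A \<in> D\<close> \<open>A' \<in> D\<close> unfolding op_directed_def by meson
    then show ?thesis by (intro bexI[of _ C]) (auto intro: pos_op_trans)
  qed
qed (auto simp: eventually_principal)

lemma pos_op_0 [simp]: "pos_op 0"
  by (simp add: pos_op_iff)

lemma up_filter_neq_bot:
  assumes "op_directed D"
  shows "up_filter D \<noteq> bot"
  unfolding trivial_limit_def eventually_up_filter[OF assms]
  by (metis diff_self pos_op_0)

lemma vigier:
  assumes D: "op_directed D" and S: "\<And>A. A \<in> D \<Longrightarrow> pos_op (S - A)"
  shows "\<exists>T\<in>bop. \<forall>x. ((\<lambda>B. blinfun_apply B x) \<longlongrightarrow> T x) (up_filter D)"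
proof -
  let ?F = "up_filter D"
  note nb = up_filter_neq_bot[OF D] and ev = eventually_up_filter[OF D]
  obtain A0 where A0: "A0 \<in> D" using D by (auto simp: op_directed_def)
  let ?K = "norm (S - A0)"
  have sq: "(norm (C x - B x))\<^sup>2 \<le> ?K * (C x \<bullet> x - B x \<bullet> x)"
    if "B \<in> D" "C \<in> D" "pos_op (B - A0)" "pos_op (C - B)" for B C x
  proof -
    have "(norm ((C - B) x))\<^sup>2 \<le> ?K * ((C - B) x \<bullet> x)"
    proof (rule norm_le_of_pos_op_le[OF that(4)])
      show "pos_op (S - A0 - (C - B))"
        using pos_op_add[OF S[OF that(2)] that(3)] by (simp add: algebra_simps)
    qed
    then show ?thesis by (simp add: blinfun_simps inner_diff_left)
  qed
  have lim: "\<exists>y. ((\<lambda>B. blinfun_apply B x) \<longlongrightarrow> y) ?F" for x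
  proof -
    let ?s = "SUP A\<in>D. blinfun_apply A x \<bullet> x"
    have bdd: "bdd_above ((\<lambda>A. blinfun_apply A x \<bullet> x) ` D)"
    proof (rule bdd_aboveI2)
      show "A x \<bullet> x \<le> S x \<bullet> x" if "A \<in> D" for A
        using pos_op_nonneg[OF S[OF that], of x] by (simp add: blinfun_simps inner_diff_left)
    qed
    have "cauchy_filter (filtermap (\<lambda>B. blinfun_apply B x) ?F)"
      unfolding cauchy_filter_metric_filtermap
    proof (intro allI impI)
      fix e :: real assume e: "e > 0"
      define d where "d = e\<^sup>2 / (4 * (?K + 1))"
      have K: "?K + 1 > 0" by (simp add: add_nonneg_pos)
      then have d: "d > 0" using e by (simp add: d_def)
      have "?s - d < ?s" using d by simp
      then obtain A1 where A1: "A1 \<in> D" "?s - d < A1 x \<bullet> x"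
        using less_cSUP_iff[OF _ bdd] A0 by blast
      then obtain A2 where A2: "A2 \<in> D" "pos_op (A2 - A0)" "pos_op (A2 - A1)"
        using D A0 unfolding op_directed_def by meson
      have A2x: "?s - d < A2 x \<bullet> x"
        using A1(2) pos_op_nonneg[OF A2(3), of x] by (simp add: blinfun_simps inner_diff_left)
      have close: "norm (B x - A2 x) < e / 2" if B: "B \<in> D" "pos_op (B - A2)" for B
      proof -
        have "B x \<bullet> x \<le> ?s" by (rule cSUP_upper[OF B(1) bdd])
        then have "B x \<bullet> x - A2 x \<bullet> x \<le> d" using A2x by simp
        then have "(norm (B x - A2 x))\<^sup>2 \<le> ?K * d"
          using sq[OF A2(1) B(1) A2(2) B(2), of x] by (meson mult_left_mono norm_ge_zero order_trans)
        also have "\<dots> < (?K + 1) * d" using d by simp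
        also have "\<dots> = (e / 2)\<^sup>2"
        proof -
          have "k * (e\<^sup>2 / (4 * k)) = (e / 2)\<^sup>2" if "k > 0" for k
            using that by (simp add: power2_eq_square)
          then show ?thesis using K unfolding d_def by blast
        qed
        finally show ?thesis
          by (rule power_less_imp_less_base) (use e in simp)
      qed
      show "\<exists>P. eventually P ?F \<and> (\<forall>B C. P B \<and> P C \<longrightarrow> dist (blinfun_apply B x) (blinfun_apply C x) < e)"
      proof (intro exI conjI allI impI)
        show "eventually (\<lambda>B. norm (blinfun_apply B x - A2 x) < e / 2) ?F"
          unfolding ev using A2(1) close by blast
        show "dist (B x) (C x) < e" if "norm (blinfun_apply B x - A2 x) < e / 2 \<and> norm (blinfun_apply C x - A2 x) < e / 2" for B C
          using that dist_triangle_half_l[of "B x" "A2 x" e "C x"] by (simp add: dist_norm)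
      qed
    qed
    then show ?thesis
      using complete_UNIV nb unfolding complete_uniform filterlim_def
      by (metis filtermap_bot_iff principal_UNIV top_greatest UNIV_I)
  qed
  then obtain t where t: "\<And>x. ((\<lambda>B. blinfun_apply B x) \<longlongrightarrow> t x) ?F" by metis
  have bl: "bounded_linear t"
  proof (rule bounded_linear_intro[where K = "?K + norm A0"])
    show "t (x + y) = t x + t y" for x y
      by (rule tendsto_unique[OF nb t]) (unfold blinfun.add_right, intro tendsto_intros t)
    show "t (r *\<^sub>R x) = r *\<^sub>R t x" for r x
      by (rule tendsto_unique[OF nb t]) (unfold blinfun.scaleR_right, intro tendsto_intros t)
    show "norm (t x) \<le> norm x * (?K + norm A0)" for x
    proof (rule tendsto_upperbound[OF tendsto_norm[OF t] _ nb])
      have "norm (B x) \<le> norm x * (?K + norm A0)" if B: "B \<in> D" "pos_op (B - A0)" for B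
      proof -
        have "(norm (B x - A0 x))\<^sup>2 \<le> ?K * ((B x - A0 x) \<bullet> x)"
          using sq[OF A0 B(1) _ B(2), of x] by (simp add: inner_diff_left)
        also have "\<dots> \<le> ?K * (norm (B x - A0 x) * norm x)"
          by (intro mult_left_mono norm_cauchy_schwarz) simp
        finally have "norm (B x - A0 x) \<le> ?K * norm x"
          by (cases "B x = A0 x") (simp_all add: power2_eq_square mult.left_commute)
        moreover have "norm (B x) \<le> norm (B x - A0 x) + norm (A0 x)"
          using norm_triangle_ineq[of "B x - A0 x" "A0 x"] by simp
        moreover have "norm (A0 x) \<le> norm A0 * norm x" by (rule norm_blinfun)
        ultimately show ?thesis by (simp add: algebra_simps)
      qed
      then show "\<forall>\<^sub>F B in ?F. norm (blinfun_apply B x) \<le> norm x * (?K + norm A0)"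
        unfolding ev using A0 by blast
    qed
  qed
  have "t (\<i> *\<^sub>C x) = \<i> *\<^sub>C t x" for x
  proof (rule tendsto_unique[OF nb t])
    have "((\<lambda>B. \<i> *\<^sub>C blinfun_apply B x) \<longlongrightarrow> \<i> *\<^sub>C t x) ?F"
      by (rule bounded_linear.tendsto[OF bounded_linear_scaleC t])
    moreover have "\<forall>\<^sub>F B in ?F. \<i> *\<^sub>C blinfun_apply B x = blinfun_apply B (\<i> *\<^sub>C x)"
      unfolding ev using D A0 by (auto simp: op_directed_def selfadjoint_def bop_scaleC)
    ultimately show "((\<lambda>B. blinfun_apply B (\<i> *\<^sub>C x)) \<longlongrightarrow> \<i> *\<^sub>C t x) ?F"
      by (rule Lim_transform_eventually)
  qed
  then show ?thesis
    using t by (intro bexI[of _ "Blinfun t"]) (simp_all add: bop_iff_ii bounded_linear_Blinfun_apply[OF bl])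
qed

lemma strong_limit_imp_op_monotone_limit:
  fixes T :: "'a::complex_hilbert_space \<Rightarrow>\<^sub>L 'a"
  assumes D: "op_directed D" and T: "T \<in> bop"
    and lim: "\<And>x. ((\<lambda>B. blinfun_apply B x) \<longlongrightarrow> T x) (up_filter D)"
  shows "op_monotone_limit D T"
proof -
  note nb = up_filter_neq_bot[OF D] and ev = eventually_up_filter[OF D]
  obtain A0 where A0: "A0 \<in> D" using D by (auto simp: op_directed_def)
  have sym: "symmetric_op B" if "B \<in> D" for B
    using D that by (simp add: op_directed_def selfadjoint_iff)
  have "symmetric_op T"
    unfolding symmetric_op_def
  proof (intro allI)
    fix x y
    have "((\<lambda>B. blinfun_apply B x \<bullet> y) \<longlongrightarrow> T x \<bullet> y) (up_filter D)"
      by (intro tendsto_intros lim)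
    moreover have "\<forall>\<^sub>F B in up_filter D. blinfun_apply B x \<bullet> y = x \<bullet> blinfun_apply B y"
      unfolding ev using A0 sym by (auto simp: symmetric_op_def)
    ultimately have "((\<lambda>B. x \<bullet> blinfun_apply B y) \<longlongrightarrow> T x \<bullet> y) (up_filter D)"
      by (rule Lim_transform_eventually)
    moreover have "((\<lambda>B. x \<bullet> blinfun_apply B y) \<longlongrightarrow> x \<bullet> T y) (up_filter D)"
      by (intro tendsto_intros lim)
    ultimately show "T x \<bullet> y = x \<bullet> T y"
      by (rule tendsto_unique[OF nb])
  qed
  then have T': "selfadjoint T" using T by (simp add: selfadjoint_iff)
  have inner_lim: "((\<lambda>B. (B - A) x \<bullet> x) \<longlongrightarrow> (T - A) x \<bullet> x) (up_filter D)" for A :: "'a \<Rightarrow>\<^sub>L 'a" and x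
    unfolding blinfun.diff_left by (intro tendsto_intros lim)
  have "pos_op (T - A)" if A: "A \<in> D" for A
    unfolding pos_op_iff
  proof (intro conjI allI)
    show "T - A \<in> bop" "symmetric_op (T - A)"
      using T' A D by (auto intro: bop_diff symmetric_op_diff simp: op_directed_def selfadjoint_iff)
    show "0 \<le> (T - A) x \<bullet> x" for x
      by (rule tendsto_lowerbound[OF inner_lim _ nb]) (use A pos_op_nonneg in \<open>unfold ev, blast\<close>)
  qed
  moreover have "\<exists>A\<in>D. (T - A) x \<bullet> x < e" if "e > 0" for x e
  proof -
    have "\<forall>\<^sub>F B in up_filter D. (B - T) x \<bullet> x > - e"
      using inner_lim[of T x] that by (intro order_tendstoD) (auto simp: blinfun_simps)
    then obtain A where "A \<in> D" "(A - T) x \<bullet> x > - e"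
      unfolding ev by (metis diff_self pos_op_0)
    then show ?thesis
      by (intro bexI[of _ A]) (simp_all add: blinfun_simps inner_diff_left)
  qed
  ultimately show ?thesis using T' by (simp add: op_monotone_limit_def)
qed

lemma op_monotone_limit_least:
  assumes "op_monotone_limit D T" "selfadjoint B" "\<And>A. A \<in> D \<Longrightarrow> pos_op (B - A)"
  shows "pos_op (B - T)"
  unfolding pos_op_iff
proof (intro conjI allI)
  show "B - T \<in> bop" "symmetric_op (B - T)"
    using assms by (auto intro: bop_diff symmetric_op_diff simp: op_monotone_limit_def selfadjoint_iff)
  fix x show "0 \<le> (B - T) x \<bullet> x"
  proof (rule field_le_epsilon)
    fix e :: real assume "e > 0"
    then obtain A where "A \<in> D" "(T - A) x \<bullet> x < e"
      using assms(1) unfolding op_monotone_limit_def by meson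
    then show "0 \<le> (B - T) x \<bullet> x + e"
      using pos_op_nonneg[OF assms(3)[of A], of x] by (simp add: blinfun_simps inner_diff_left)
  qed
qed

lemma op_monotone_limit_is_op_sup:
  assumes "op_monotone_limit D T" "T \<in> M"
  shows "is_op_sup M D T"
  using assms op_monotone_limit_least[OF assms(1)]
  by (auto simp: is_op_sup_def op_monotone_limit_def)

lemma scale_op_compose_left: "scale_op c A o\<^sub>L B = scale_op c (A o\<^sub>L B)"
  by (rule blinfun_eqI) (simp add: scale_op.rep_eq)

lemma scale_op_compose_right: "B \<in> bop \<Longrightarrow> B o\<^sub>L scale_op c A = scale_op c (B o\<^sub>L A)"
  by (rule blinfun_eqI) (simp add: scale_op.rep_eq bop_scaleC)

locale commutant_algebra =
  fixes M K :: "('a::complex_hilbert_space \<Rightarrow>\<^sub>L 'a) set"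
  assumes M_eq: "M = commutant K" and K_bop: "K \<subseteq> bop" and K_adj: "\<And>A. A \<in> K \<Longrightarrow> adj A \<in> K"
begin

lemma mem_iff: "A \<in> M \<longleftrightarrow> A \<in> bop \<and> (\<forall>B\<in>K. A o\<^sub>L B = B o\<^sub>L A)"
  by (simp add: M_eq commutant_def)

lemma adj_mem:
  assumes "A \<in> M"
  shows "adj A \<in> M"
  unfolding mem_iff
proof (intro conjI ballI)
  show "adj A \<in> bop" using assms by (simp add: mem_iff bop_adj)
  fix B assume B: "B \<in> K"
  then have "A o\<^sub>L adj B = adj B o\<^sub>L A" using assms K_adj by (simp add: mem_iff)
  then have "adj (A o\<^sub>L adj B) = adj (adj B o\<^sub>L A)" by simp
  moreover have "A \<in> bop" "B \<in> bop" using assms B K_bop by (auto simp: mem_iff)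
  ultimately show "adj A o\<^sub>L B = B o\<^sub>L adj A" by (simp add: adj_compose bop_adj adj_adj)
qed

lemma traced_algebra:
  assumes "normal_trace M (factor_trace M)"
  shows "traced_algebra M"
proof
  fix A B
  show "id_blinfun \<in> M" by (simp add: mem_iff)
  show "A + B \<in> M" if "A \<in> M" "B \<in> M"
    using that by (auto simp: mem_iff bop_add compose_simps)
  show "A o\<^sub>L B \<in> M" if "A \<in> M" "B \<in> M"
    using that by (auto simp: mem_iff bop_compose blinfun_compose_assoc) (metis blinfun_compose_assoc)
  show "scale_op c A \<in> M" if "A \<in> M" for c
    using that K_bop
    by (auto simp: mem_iff bop_scale_op scale_op_compose_left scale_op_compose_right)
  show "A \<in> M" if "\<And>n. S n \<in> M" "S \<longlonglongrightarrow> A" for S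
    unfolding mem_iff
  proof (intro conjI ballI)
    show "A \<in> bop" using that by (auto intro: bop_limit simp: mem_iff)
    fix B assume B: "B \<in> K"
    have "(\<lambda>n. S n o\<^sub>L B) \<longlonglongrightarrow> (A o\<^sub>L B)" "(\<lambda>n. B o\<^sub>L S n) \<longlonglongrightarrow> (B o\<^sub>L A)"
      by (intro blinfun_compose.tendsto tendsto_const that)+
    then show "A o\<^sub>L B = B o\<^sub>L A"
      using that(1) B by (simp add: mem_iff LIMSEQ_unique)
  qed
qed (use assms adj_mem in \<open>auto simp: mem_iff\<close>)

lemma is_op_sup_imp_monotone_limit:
  assumes D: "op_directed D" "D \<subseteq> M" and S: "is_op_sup M D S"
  shows "op_monotone_limit D S"
proof -
  obtain T where T: "T \<in> bop" "\<And>x. ((\<lambda>B. blinfun_apply B x) \<longlongrightarrow> T x) (up_filter D)"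
    using vigier[OF D(1), of S] S by (auto simp: is_op_sup_def)
  have lim: "op_monotone_limit D T" by (rule strong_limit_imp_op_monotone_limit[OF D(1) T])
  have "T \<in> M"
    unfolding mem_iff
  proof (intro conjI ballI blinfun_eqI)
    fix B x assume B: "B \<in> K"
    have "((\<lambda>A. B (blinfun_apply A x)) \<longlongrightarrow> B (T x)) (up_filter D)"
      by (intro blinfun.tendsto tendsto_const T)
    moreover have "\<forall>\<^sub>F A in up_filter D. B (blinfun_apply A x) = blinfun_apply A (B x)"
      unfolding eventually_up_filter[OF D(1)]
    proof -
      have "B (A x) = A (B x)" if "A \<in> D" for A
        using that D(2) B unfolding mem_iff subset_iff by (metis blinfun_apply_blinfun_compose)
      then show "\<exists>A\<in>D. \<forall>A'\<in>D. pos_op (A' - A) \<longrightarrow> B (A' x) = A' (B x)"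
        using D(1) by (auto simp: op_directed_def)
    qed
    ultimately have "((\<lambda>A. blinfun_apply A (B x)) \<longlongrightarrow> B (T x)) (up_filter D)"
      by (rule Lim_transform_eventually)
    then show "(T o\<^sub>L B) x = (B o\<^sub>L T) x"
      using tendsto_unique[OF up_filter_neq_bot[OF D(1)] T(2)] by simp
  qed (rule T(1))
  then have "pos_op (T - S)"
    using S lim by (auto simp: is_op_sup_def op_monotone_limit_def)
  moreover have "pos_op (S - T)"
    using S by (intro op_monotone_limit_least[OF lim]) (auto simp: is_op_sup_def)
  ultimately show ?thesis using lim pos_op_antisym by blast
qed

end

section \<open>Two by two operator matrices\<close>

lift_definition vec_inj :: "'n::finite \<Rightarrow> 'a::complex_hilbert_space \<Rightarrow>\<^sub>L ('a ^ 'n)" is "\<lambda>i x. axis i x"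
proof -
  fix i :: 'n
  show "bounded_linear (\<lambda>x::'a. axis i x)"
    by (rule bounded_linear_intro[where K = 1])
      (auto simp: axis_def vec_eq_iff norm_eq_sqrt_inner inner_axis_axis[unfolded axis_def])
qed

lift_definition vec_proj :: "'n::finite \<Rightarrow> ('a::complex_hilbert_space ^ 'n) \<Rightarrow>\<^sub>L 'a" is "\<lambda>i x. x $ i"
  by (rule bounded_linear_vec_nth)

definition block :: "(('a::complex_hilbert_space ^ 'n) \<Rightarrow>\<^sub>L ('a ^ 'n)) \<Rightarrow> 'n \<Rightarrow> 'n \<Rightarrow> 'a \<Rightarrow>\<^sub>L 'a"
  where "block T i j = vec_proj i o\<^sub>L (T o\<^sub>L vec_inj j)"

definition mat2 ::
  "('a::complex_hilbert_space \<Rightarrow>\<^sub>L 'a) \<Rightarrow> ('a \<Rightarrow>\<^sub>L 'a) \<Rightarrow> ('a \<Rightarrow>\<^sub>L 'a) \<Rightarrow> ('a \<Rightarrow>\<^sub>L 'a) \<Rightarrow> (('a ^ 2) \<Rightarrow>\<^sub>L ('a ^ 2))"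
  where "mat2 A B C D = A \<otimes>\<^sub>o E 1 1 + B \<otimes>\<^sub>o E 1 2 + C \<otimes>\<^sub>o E 2 1 + D \<otimes>\<^sub>o E 2 2"

lemma block_apply: "block T i j x = T (axis j x) $ i"
  by (simp add: block_def vec_proj.rep_eq vec_inj.rep_eq)

lemma mat2_apply [simp]:
  "mat2 A B C D x $ 1 = A (x $ 1) + B (x $ 2)"
  "mat2 A B C D x $ 2 = C (x $ 1) + D (x $ 2)"
  by (simp_all add: mat2_def op_tensor.rep_eq E_def sum_2 blinfun_simps)

lemma blinfun_vec2_eqI:
  fixes S T :: "('a::complex_hilbert_space ^ 2) \<Rightarrow>\<^sub>L ('a ^ 2)"
  assumes "\<And>x. S x $ 1 = T x $ 1" "\<And>x. S x $ 2 = T x $ 2"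
  shows "S = T"
  by (rule blinfun_eqI) (simp add: vec_eq_iff forall_2 assms)

lemma block_mat2 [simp]:
  "block (mat2 A B C D) 1 1 = A" "block (mat2 A B C D) 1 2 = B"
  "block (mat2 A B C D) 2 1 = C" "block (mat2 A B C D) 2 2 = D"
  by (rule blinfun_eqI; simp add: block_apply axis_def blinfun.zero_right)+

lemma mat2_block: "mat2 (block T 1 1) (block T 1 2) (block T 2 1) (block T 2 2) = T"
proof (rule blinfun_vec2_eqI)
  fix x :: "'a ^ 2"
  have "T x = T (axis 1 (x $ 1) + axis 2 (x $ 2))"
    by (rule arg_cong[of _ _ T]) (simp add: vec_eq_iff forall_2 axis_def)
  then show "mat2 (block T 1 1) (block T 1 2) (block T 2 1) (block T 2 2) x $ 1 = T x $ 1"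
    "mat2 (block T 1 1) (block T 1 2) (block T 2 1) (block T 2 2) x $ 2 = T x $ 2"
    by (simp_all add: block_apply blinfun.add_right)
qed

lemma mat2_eq_iff: "mat2 A B C D = mat2 A' B' C' D' \<longleftrightarrow> A = A' \<and> B = B' \<and> C = C' \<and> D = D'"
  using block_mat2 by metis

lemma mat2_add: "mat2 A B C D + mat2 A' B' C' D' = mat2 (A + A') (B + B') (C + C') (D + D')"
  by (rule blinfun_vec2_eqI) (simp_all add: blinfun_simps)

lemma mat2_diff: "mat2 A B C D - mat2 A' B' C' D' = mat2 (A - A') (B - B') (C - C') (D - D')"
  by (rule blinfun_vec2_eqI) (simp_all add: blinfun_simps)

lemma mat2_scaleR: "r *\<^sub>R mat2 A B C D = mat2 (r *\<^sub>R A) (r *\<^sub>R B) (r *\<^sub>R C) (r *\<^sub>R D)"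
  by (rule blinfun_vec2_eqI) (simp_all add: blinfun_simps scaleR_add_right)

lemma mat2_scale_op:
  "scale_op c (mat2 A B C D) = mat2 (scale_op c A) (scale_op c B) (scale_op c C) (scale_op c D)"
  by (rule blinfun_vec2_eqI) (simp_all add: scale_op.rep_eq scaleC_vec_def scaleC_add_right)

lemma mat2_compose: "mat2 A B C D o\<^sub>L mat2 A' B' C' D' =
    mat2 ((A o\<^sub>L A') + (B o\<^sub>L C')) ((A o\<^sub>L B') + (B o\<^sub>L D'))
      ((C o\<^sub>L A') + (D o\<^sub>L C')) ((C o\<^sub>L B') + (D o\<^sub>L D'))"
  by (rule blinfun_vec2_eqI) (simp_all add: blinfun_simps)

lemma mat2_id: "mat2 id_blinfun 0 0 id_blinfun = id_blinfun"
  by (rule blinfun_vec2_eqI) simp_all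

lemma mat2_zero: "mat2 0 0 0 0 = 0"
  by (rule blinfun_vec2_eqI) simp_all

lemma scaleC_axis: "c *\<^sub>C axis i x = axis i (c *\<^sub>C x)"
  by (simp add: vec_eq_iff axis_def scaleC_vec_def)

lemma block_bop: "T \<in> bop \<Longrightarrow> block T i j \<in> bop"
  by (simp add: bop_def block_apply flip: scaleC_axis) (simp add: scaleC_vec_def)

lemma mat2_bop: "mat2 A B C D \<in> bop \<longleftrightarrow> A \<in> bop \<and> B \<in> bop \<and> C \<in> bop \<and> D \<in> bop"
proof
  assume "mat2 A B C D \<in> bop"
  from block_bop[OF this] show "A \<in> bop \<and> B \<in> bop \<and> C \<in> bop \<and> D \<in> bop"
    using block_mat2 by metis
next
  assume "A \<in> bop \<and> B \<in> bop \<and> C \<in> bop \<and> D \<in> bop"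
  then show "mat2 A B C D \<in> bop"
    by (simp add: bop_def vec_eq_iff forall_2 scaleC_vec_def scaleC_add_right)
qed

lemma inner_vec2: "(x :: 'a::complex_hilbert_space ^ 2) \<bullet> y = x $ 1 \<bullet> y $ 1 + x $ 2 \<bullet> y $ 2"
  by (simp add: inner_vec_def sum_2)

lemma adj_mat2:
  assumes "A \<in> bop" "B \<in> bop" "C \<in> bop" "D \<in> bop"
  shows "adj (mat2 A B C D) = mat2 (adj A) (adj C) (adj B) (adj D)"
  by (rule adj_uniqueI)
    (use assms in \<open>simp_all add: mat2_bop inner_vec2 inner_add_left inner_add_right inner_adj\<close>)

lemma inner_block: "block T i i x \<bullet> x = T (axis i x) \<bullet> axis i x"
  by (simp add: block_apply inner_axis)

lemma block_diff: "block (S - T) i j = block S i j - block T i j"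
  by (rule blinfun_eqI) (simp add: block_apply blinfun_simps)

lemma symmetric_op_block: "symmetric_op T \<Longrightarrow> symmetric_op (block T i i)"
  unfolding symmetric_op_def by (simp add: block_apply flip: inner_axis inner_axis')

lemma selfadjoint_block: "selfadjoint T \<Longrightarrow> selfadjoint (block T i i)"
  by (simp add: selfadjoint_iff block_bop symmetric_op_block)

lemma pos_op_block: "pos_op T \<Longrightarrow> pos_op (block T i i)"
  unfolding pos_op_iff by (simp add: block_bop symmetric_op_block inner_block)

lemma pos_op_mat2_zero_diagonal:
  assumes "pos_op (mat2 0 B C 0)"
  shows "mat2 0 B C 0 = 0"
proof (rule pos_op_antisym)
  show "pos_op (mat2 0 B C 0 - 0)" using assms by simp
  have flip: "(mat2 0 B C 0) x \<bullet> x = - ((mat2 0 B C 0) (axis 1 (x $ 1) - axis 2 (x $ 2)) \<bullet> (axis 1 (x $ 1) - axis 2 (x $ 2)))" for x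
    by (simp add: inner_vec2 axis_def blinfun_simps blinfun.zero_right)
  show "pos_op (0 - mat2 0 B C 0)"
    unfolding pos_op_iff
  proof (intro conjI allI)
    show "0 - mat2 0 B C 0 \<in> bop" "symmetric_op (0 - mat2 0 B C 0)"
      using pos_op_bop[OF assms] pos_op_symmetric[OF assms]
      by (auto intro: bop_diff symmetric_op_diff simp del: diff_0)
    fix x
    have "0 \<le> - ((mat2 0 B C 0) x \<bullet> x)"
      unfolding flip[of x] minus_minus by (rule pos_op_nonneg[OF assms])
    then show "0 \<le> (0 - mat2 0 B C 0) x \<bullet> x" by (simp add: blinfun_simps)
  qed
qed

definition corner :: "('a::complex_hilbert_space \<Rightarrow>\<^sub>L 'a) \<Rightarrow> (('a ^ 2) \<Rightarrow>\<^sub>L ('a ^ 2))"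
  where "corner A = mat2 A 0 0 0"

lemma inner_corner: "corner A x \<bullet> x = A (x $ 1) \<bullet> x $ 1"
  by (simp add: corner_def inner_vec2)

lemma symmetric_op_corner: "symmetric_op A \<Longrightarrow> symmetric_op (corner A)"
  by (simp add: symmetric_op_def corner_def inner_vec2)

lemma selfadjoint_corner: "selfadjoint A \<Longrightarrow> selfadjoint (corner A)"
  by (simp add: selfadjoint_iff symmetric_op_corner) (simp add: corner_def mat2_bop)

lemma pos_op_corner: "pos_op A \<Longrightarrow> pos_op (corner A)"
  unfolding pos_op_iff by (simp add: symmetric_op_corner inner_corner) (simp add: corner_def mat2_bop)

lemma corner_diff: "corner (A - B) = corner A - corner B"
  by (simp add: corner_def mat2_diff)

lemma tensor_matrices_eq: "tensor_matrices N = {mat2 A B C D | A B C D. A \<in> N \<and> B \<in> N \<and> C \<in> N \<and> D \<in> N}"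
proof (intro equalityI subsetI)
  fix T assume "T \<in> (tensor_matrices N :: (('a ^ 2) \<Rightarrow>\<^sub>L ('a ^ 2)) set)"
  then obtain A where A: "\<And>a b. A a b \<in> N" "T = (\<Sum>a\<in>UNIV. \<Sum>b\<in>UNIV. A a b \<otimes>\<^sub>o E a b)"
    by (auto simp: tensor_matrices_def)
  then have "T = mat2 (A 1 1) (A 1 2) (A 2 1) (A 2 2)"
    by (simp add: mat2_def sum_2 add.assoc)
  then show "T \<in> {mat2 A B C D | A B C D. A \<in> N \<and> B \<in> N \<and> C \<in> N \<and> D \<in> N}"
    using A(1) by blast
next
  fix T assume "T \<in> {mat2 A B C D | A B C D. A \<in> N \<and> B \<in> N \<and> C \<in> N \<and> D \<in> N}"
  then obtain A B C D where T: "T = mat2 A B C D" "A \<in> N" "B \<in> N" "C \<in> N" "D \<in> N" by blast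
  define F :: "2 \<Rightarrow> 2 \<Rightarrow> 'a \<Rightarrow>\<^sub>L 'a"
    where "F a b = (if a = 1 then if b = 1 then A else B else if b = 1 then C else D)" for a b
  have "T = (\<Sum>a\<in>UNIV. \<Sum>b\<in>UNIV. F a b \<otimes>\<^sub>o E a b)"
    by (simp add: T mat2_def sum_2 F_def add.assoc)
  moreover have "\<forall>a b. F a b \<in> N" by (simp add: F_def T)
  ultimately show "T \<in> tensor_matrices N" unfolding tensor_matrices_def by blast
qed

lemma mat2_mem_iff: "mat2 A B C D \<in> tensor_matrices N \<longleftrightarrow> A \<in> N \<and> B \<in> N \<and> C \<in> N \<and> D \<in> N"
  by (auto simp: tensor_matrices_eq mat2_eq_iff)

lemma block_mem: "T \<in> tensor_matrices N \<Longrightarrow> block T (i::2) j \<in> N"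
proof -
  assume "T \<in> tensor_matrices N"
  then have "\<forall>i j. block T i j \<in> N"
    using mat2_mem_iff[of "block T 1 1" "block T 1 2" "block T 2 1" "block T 2 2" N]
    by (simp add: mat2_block forall_2)
  then show ?thesis by blast
qed

lemma von_neumann_commutant_algebra:
  assumes "von_neumann_algebra N"
  shows "commutant_algebra N (commutant N)"
proof
  show "N = commutant (commutant N)" using assms by (simp add: von_neumann_algebra_def)
  show "commutant N \<subseteq> bop" by (auto simp: commutant_def)
  fix A assume A: "A \<in> commutant N"
  have "adj A o\<^sub>L B = B o\<^sub>L adj A" if B: "B \<in> N" for B
  proof -
    have b: "A \<in> bop" "B \<in> bop" "adj B \<in> N"
      using A B assms by (auto simp: commutant_def von_neumann_algebra_def)
    then have "adj (A o\<^sub>L adj B) = adj (adj B o\<^sub>L A)"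
      using A by (simp add: commutant_def)
    then show ?thesis using b by (simp add: adj_compose bop_adj adj_adj)
  qed
  then show "adj A \<in> commutant N"
    using A by (simp add: commutant_def bop_adj)
qed

lemma tensor_matrices_commutant_algebra:
  assumes "commutant_algebra N K"
  shows "commutant_algebra (tensor_matrices N) ((\<lambda>B. mat2 B 0 0 B) ` K)"
proof -
  interpret N: commutant_algebra N K by fact
  show ?thesis
  proof
    show "tensor_matrices N = commutant ((\<lambda>B. mat2 B 0 0 B) ` K)"
    proof (rule set_eqI)
      fix T :: "('a ^ 2) \<Rightarrow>\<^sub>L ('a ^ 2)"
      obtain A B C D where T: "T = mat2 A B C D" using mat2_block by metis
      show "T \<in> tensor_matrices N \<longleftrightarrow> T \<in> commutant ((\<lambda>B. mat2 B 0 0 B) ` K)"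
        by (auto simp: T mat2_mem_iff N.mem_iff commutant_def mat2_bop mat2_compose mat2_eq_iff)
    qed
    show "(\<lambda>B. mat2 B 0 0 B) ` K \<subseteq> bop"
      using N.K_bop by (auto simp: mat2_bop)
    fix T assume "T \<in> (\<lambda>B. mat2 B 0 0 B) ` K"
    then obtain B where "B \<in> K" "T = mat2 B 0 0 B" by blast
    then show "adj T \<in> (\<lambda>B. mat2 B 0 0 B) ` K"
      using N.K_bop N.K_adj by (auto simp: adj_mat2)
  qed
qed

section \<open>The trace on two by two matrices\<close>

lemma cSUP_double:
  fixes f :: "'i \<Rightarrow> real"
  assumes "I \<noteq> {}" "bdd_above (f ` I)"
  shows "2 * (SUP i\<in>I. f i) = (SUP i\<in>I. 2 * f i)"
proof (rule antisym)
  have le: "2 * f i \<le> 2 * (SUP i\<in>I. f i)" if "i \<in> I" for i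
    using cSUP_upper[OF that assms(2)] by simp
  then have "bdd_above ((\<lambda>i. 2 * f i) ` I)" by (rule bdd_aboveI2)
  then have "f i \<le> (SUP i\<in>I. 2 * f i) / 2" if "i \<in> I" for i
    using cSUP_upper[OF that, of "\<lambda>i. 2 * f i"] by simp
  then have "(SUP i\<in>I. f i) \<le> (SUP i\<in>I. 2 * f i) / 2"
    by (rule cSUP_least[OF assms(1)])
  then show "2 * (SUP i\<in>I. f i) \<le> (SUP i\<in>I. 2 * f i)" by simp
  show "(SUP i\<in>I. 2 * f i) \<le> 2 * (SUP i\<in>I. f i)"
    using le by (rule cSUP_least[OF assms(1)])
qed

lemma op_directed_image:
  assumes "op_directed D" "\<And>A. selfadjoint A \<Longrightarrow> selfadjoint (f A)" "\<And>A. pos_op A \<Longrightarrow> pos_op (f A)"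
    and "\<And>A B. f (A - B) = f A - f B"
  shows "op_directed (f ` D)"
proof -
  have "\<exists>C\<in>D. pos_op (f C - f A) \<and> pos_op (f C - f B)" if "A \<in> D" "B \<in> D" for A B
    using assms(1) that assms(3) unfolding op_directed_def assms(4)[symmetric] by meson
  then show ?thesis
    using assms(1,2) by (auto simp: op_directed_def)
qed

lemma op_monotone_limit_image:
  assumes "op_monotone_limit D T" "\<And>A. selfadjoint A \<Longrightarrow> selfadjoint (f A)"
    and "\<And>A. pos_op A \<Longrightarrow> pos_op (f A)" "\<And>A B. f (A - B) = f A - f B"
    and "\<And>A x. f A x \<bullet> x = A (g x) \<bullet> g x"
  shows "op_monotone_limit (f ` D) (f T)"
  using assms(1-3) unfolding op_monotone_limit_def by (simp add: assms(5) flip: assms(4))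

lemma normal_functional_monotone_limit:
  assumes "normal_functional M \<tau>" "op_directed D" "D \<subseteq> M" "S \<in> M" "op_monotone_limit D S"
  shows "Re (\<tau> S) = (SUP A\<in>D. Re (\<tau> A))"
  by (rule assms(1)[unfolded normal_functional_def, rule_format])
    (use assms(2,3) op_monotone_limit_is_op_sup[OF assms(5,4)] in \<open>auto simp: op_directed_def\<close>)

lemma finite_factor_trace:
  assumes "finite_factor N"
  shows "normal_trace N (factor_trace N)" "normal_trace N \<tau> \<Longrightarrow> \<tau> = factor_trace N"
  using assms theI'[of "normal_trace N"] unfolding finite_factor_def factor_trace_def by blast+

definition matrix_trace :: "('a::complex_hilbert_space \<Rightarrow>\<^sub>L 'a) set \<Rightarrow> (('a ^ 2) \<Rightarrow>\<^sub>L ('a ^ 2)) \<Rightarrow> complex"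
  where "matrix_trace N = restrict (\<lambda>T. (factor_trace N (block T 1 1) + factor_trace N (block T 2 2)) / 2)
    (tensor_matrices N)"

context
  fixes N :: "('a::complex_hilbert_space \<Rightarrow>\<^sub>L 'a) set"
  assumes N: "finite_factor N"
begin

lemma N_algebra: "commutant_algebra N (commutant N)"
  using N by (intro von_neumann_commutant_algebra) (simp add: finite_factor_def factor_def)

lemma N_traced: "traced_algebra N"
  by (rule commutant_algebra.traced_algebra[OF N_algebra finite_factor_trace(1)[OF N]])

interpretation N: traced_algebra N by (rule N_traced)

abbreviation (input) "MN \<equiv> (tensor_matrices N :: (('a ^ 2) \<Rightarrow>\<^sub>L ('a ^ 2)) set)"

lemma MN_algebra: "commutant_algebra MN ((\<lambda>B. mat2 B 0 0 B) ` commutant N)"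
  by (rule tensor_matrices_commutant_algebra[OF N_algebra])

lemma N_linear:
  "A \<in> N \<Longrightarrow> B \<in> N \<Longrightarrow> factor_trace N (A + B) = factor_trace N A + factor_trace N B"
  "A \<in> N \<Longrightarrow> factor_trace N (scale_op c A) = c * factor_trace N A"
  "A \<in> N \<Longrightarrow> B \<in> N \<Longrightarrow> factor_trace N (A o\<^sub>L B) = factor_trace N (B o\<^sub>L A)"
  "factor_trace N id_blinfun = 1"
  "A \<in> N \<Longrightarrow> pos_op A \<Longrightarrow> factor_trace N A \<in> \<real>\<^sub>\<ge>\<^sub>0"
  using N.tracial by (simp_all add: tracial_state_def)

lemma matrix_trace_mat2:
  "A \<in> N \<Longrightarrow> B \<in> N \<Longrightarrow> C \<in> N \<Longrightarrow> D \<in> N \<Longrightarrow>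
    matrix_trace N (mat2 A B C D) = (factor_trace N A + factor_trace N D) / 2"
  by (simp add: matrix_trace_def mat2_mem_iff)

lemma matrix_trace_tracial: "tracial_state MN (matrix_trace N)"
  unfolding tracial_state_def
proof (intro conjI ballI allI impI)
  show "matrix_trace N \<in> extensional MN" by (simp add: matrix_trace_def)
  have "mat2 id_blinfun 0 0 id_blinfun \<in> MN" by (simp add: mat2_mem_iff)
  then show "matrix_trace N id_blinfun = 1"
    by (simp add: matrix_trace_mat2 N_linear flip: mat2_id)
  fix S assume S: "S \<in> MN"
  then obtain A B C D where S': "S = mat2 A B C D" "A \<in> N" "B \<in> N" "C \<in> N" "D \<in> N"
    by (auto simp: tensor_matrices_eq)
  show "matrix_trace N (scale_op c S) = c * matrix_trace N S" for c
    by (simp add: S' mat2_scale_op matrix_trace_mat2 N.M_scale_op N_linear ring_distribs)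
  show "matrix_trace N S \<in> \<real>\<^sub>\<ge>\<^sub>0" if "pos_op S"
    using pos_op_block[OF that, of 1] pos_op_block[OF that, of 2] N_linear(5)[of A] N_linear(5)[of D]
    by (simp add: S' matrix_trace_mat2 complex_nonneg_Reals_iff)
  fix T assume "T \<in> MN"
  then obtain A' B' C' D' where T': "T = mat2 A' B' C' D'" "A' \<in> N" "B' \<in> N" "C' \<in> N" "D' \<in> N"
    by (auto simp: tensor_matrices_eq)
  show "matrix_trace N (S + T) = matrix_trace N S + matrix_trace N T"
    by (simp add: S' T' mat2_add matrix_trace_mat2 N_linear add_divide_distrib)
  show "matrix_trace N (S o\<^sub>L T) = matrix_trace N (T o\<^sub>L S)"
    using N_linear(3)[of A A'] N_linear(3)[of B C'] N_linear(3)[of C B'] N_linear(3)[of D D']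
    by (simp add: S' T' mat2_compose matrix_trace_mat2 N_linear(1))
qed

lemma matrix_trace_faithful: "faithful MN (matrix_trace N)"
  unfolding faithful_def
proof (intro ballI impI, elim conjE)
  fix S assume "S \<in> MN" and pos: "pos_op S" and z: "matrix_trace N S = 0"
  then obtain A B C D where S: "S = mat2 A B C D" "A \<in> N" "B \<in> N" "C \<in> N" "D \<in> N"
    by (auto simp: tensor_matrices_eq)
  have AD: "pos_op A" "pos_op D"
    using pos_op_block[OF pos, of 1] pos_op_block[OF pos, of 2] by (simp_all add: S)
  then have "factor_trace N A \<in> \<real>\<^sub>\<ge>\<^sub>0" "factor_trace N D \<in> \<real>\<^sub>\<ge>\<^sub>0"
    using S by (simp_all add: N_linear)
  moreover have "factor_trace N A + factor_trace N D = 0"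
    using z S by (simp add: matrix_trace_mat2)
  ultimately have "factor_trace N A = 0" "factor_trace N D = 0"
    by (auto simp: complex_nonneg_Reals_iff complex_eq_iff)
  then have "A = 0" "D = 0"
    using N.faithful AD S by (auto simp: faithful_def)
  then show "S = 0"
    using pos pos_op_mat2_zero_diagonal by (simp add: S)
qed

lemma matrix_trace_normal: "normal_functional MN (matrix_trace N)"
  unfolding normal_functional_def
proof (intro allI impI, elim conjE)
  fix D S
  assume D: "D \<noteq> {}" "D \<subseteq> {A \<in> MN. selfadjoint A}"
    "\<forall>A\<in>D. \<forall>B\<in>D. \<exists>C\<in>D. pos_op (C - A) \<and> pos_op (C - B)" and S: "is_op_sup MN D S"
  then have dir: "op_directed D" and DM: "D \<subseteq> MN" by (auto simp: op_directed_def)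
  have SM: "S \<in> MN" using S by (simp add: is_op_sup_def)
  have lim: "op_monotone_limit D S"
    by (rule commutant_algebra.is_op_sup_imp_monotone_limit[OF MN_algebra dir DM S])
  define t where "t i T = Re (factor_trace N (block T i i))" for i :: 2 and T
  have sup: "t i S = (SUP T\<in>D. t i T)" for i
  proof -
    let ?f = "\<lambda>T. block T i i"
    have "Re (factor_trace N (?f S)) = (SUP A\<in>?f ` D. Re (factor_trace N A))"
    proof (rule normal_functional_monotone_limit)
      show "normal_functional N (factor_trace N)"
        using N.M_trace by (simp add: normal_trace_def)
      show "op_directed (?f ` D)"
        by (rule op_directed_image[OF dir selfadjoint_block pos_op_block block_diff])
      show "?f ` D \<subseteq> N" "?f S \<in> N" using DM SM block_mem by blast+
      show "op_monotone_limit (?f ` D) (?f S)"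
        by (rule op_monotone_limit_image[OF lim selfadjoint_block pos_op_block block_diff inner_block])
    qed
    then show ?thesis by (simp add: t_def image_image)
  qed
  have mono: "t i A \<le> t i B" if "A \<in> MN" "B \<in> MN" "pos_op (B - A)" for i A B
  proof -
    have m: "block A i i \<in> N" "block B i i \<in> N" using that block_mem by blast+
    have "0 \<le> N.tr (block B i i - block A i i)"
      by (rule N.tr_nonneg) (use m that(3) pos_op_block[of "B - A" i] in \<open>simp_all add: block_diff\<close>)
    then show ?thesis using m by (simp add: t_def N.tr_def[symmetric])
  qed
  have bdd: "bdd_above (t i ` D)" for i
    by (rule bdd_aboveI2[of _ _ "t i S"])
      (use mono DM SM S in \<open>auto simp: is_op_sup_def\<close>)
  have h: "Re (matrix_trace N T) = (t 1 T + t 2 T) / 2" if "T \<in> MN" for T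
    using that by (simp add: matrix_trace_def t_def)
  have "(t 1 S + t 2 S) / 2 = (SUP T\<in>D. (t 1 T + t 2 T) / 2)"
  proof (rule antisym)
    have "bdd_above ((\<lambda>T. (t 1 T + t 2 T) / 2) ` D)"
    proof (rule bdd_aboveI2)
      fix T assume "T \<in> D"
      then show "(t 1 T + t 2 T) / 2 \<le> (t 1 S + t 2 S) / 2"
        using cSUP_upper[OF _ bdd, of T] unfolding sup by (simp add: add_mono)
    qed
    note up = cSUP_upper[OF _ this]
    show "(t 1 S + t 2 S) / 2 \<le> (SUP T\<in>D. (t 1 T + t 2 T) / 2)"
    proof (rule field_le_epsilon)
      fix e :: real assume e: "e > 0"
      have "\<exists>T\<in>D. t i S - e < t i T" for i
      proof -
        have "t i S - e < (SUP T\<in>D. t i T)" using e by (simp add: sup)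
        then show ?thesis using less_cSUP_iff[OF D(1) bdd] by blast
      qed
      then obtain T1 T2 where T: "T1 \<in> D" "T2 \<in> D" "t 1 S - e < t 1 T1" "t 2 S - e < t 2 T2"
        by metis
      then obtain C where C: "C \<in> D" "pos_op (C - T1)" "pos_op (C - T2)" using D(3) by meson
      have "t 1 T1 \<le> t 1 C" "t 2 T2 \<le> t 2 C" using mono C T DM by blast+
      then show "(t 1 S + t 2 S) / 2 \<le> (SUP T\<in>D. (t 1 T + t 2 T) / 2) + e"
      proof -
        have "(t 1 S + t 2 S) / 2 - e \<le> (t 1 C + t 2 C) / 2"
          using T(3,4) \<open>t 1 T1 \<le> t 1 C\<close> \<open>t 2 T2 \<le> t 2 C\<close> by (simp add: field_simps)
        also note up[OF C(1)]
        finally show ?thesis by (simp only: diff_le_eq)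
      qed
    qed
    show "(SUP T\<in>D. (t 1 T + t 2 T) / 2) \<le> (t 1 S + t 2 S) / 2"
    proof (rule cSUP_least[OF D(1)])
      fix T assume "T \<in> D"
      then show "(t 1 T + t 2 T) / 2 \<le> (t 1 S + t 2 S) / 2"
        using cSUP_upper[OF _ bdd, of T] unfolding sup by (simp add: add_mono)
    qed
  qed
  moreover have "(SUP A\<in>D. Re (matrix_trace N A)) = (SUP T\<in>D. (t 1 T + t 2 T) / 2)"
    using h DM by (intro SUP_cong) auto
  ultimately show "Re (matrix_trace N S) = (SUP A\<in>D. Re (matrix_trace N A))"
    unfolding h[OF SM] by simp
qed

lemma matrix_trace_unique:
  assumes \<sigma>: "normal_trace MN \<sigma>"
  shows "\<sigma> = matrix_trace N"
proof -
  have tc: "tracial_state MN \<sigma>" "faithful MN \<sigma>" "normal_functional MN \<sigma>"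
    using \<sigma> by (simp_all add: normal_trace_def)
  have add: "\<sigma> (S + T) = \<sigma> S + \<sigma> T" and comm: "\<sigma> (S o\<^sub>L T) = \<sigma> (T o\<^sub>L S)"
    if "S \<in> MN" "T \<in> MN" for S T
    using tc(1) that by (simp_all add: tracial_state_def)
  have scale: "\<sigma> (scale_op c S) = c * \<sigma> S" if "S \<in> MN" for S c
    using tc(1) that by (simp add: tracial_state_def)
  have zero: "\<sigma> 0 = 0"
    using scale[of 0 0] mat2_mem_iff[of 0 0 0 0 N]
    by (simp add: mat2_zero scale_op_of_real[of 0, simplified])
  have off: "\<sigma> (mat2 0 B 0 0) = 0" "\<sigma> (mat2 0 0 B 0) = 0" if "B \<in> N" for B
    using comm[of "mat2 0 B 0 0" "mat2 0 0 0 id_blinfun"] comm[of "mat2 0 0 B 0" "mat2 id_blinfun 0 0 0"] that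
    by (simp_all add: mat2_mem_iff mat2_compose mat2_zero zero)
  have diag: "\<sigma> (mat2 0 0 0 D) = \<sigma> (corner D)" if "D \<in> N" for D
    using comm[of "mat2 0 0 id_blinfun 0" "mat2 0 D 0 0"] that
    by (simp add: mat2_mem_iff mat2_compose corner_def)
  define \<rho> where "\<rho> = restrict (\<lambda>A. 2 * \<sigma> (corner A)) N"
  have cm: "corner A \<in> MN \<longleftrightarrow> A \<in> N" for A
    by (simp add: corner_def mat2_mem_iff)
  have "normal_trace N \<rho>"
    unfolding normal_trace_def
  proof (intro conjI)
    show "tracial_state N \<rho>"
      unfolding tracial_state_def
    proof (intro conjI ballI allI impI)
      show "\<rho> \<in> extensional N" by (simp add: \<rho>_def)
      show "\<rho> id_blinfun = 1"
      proof -
        have "\<sigma> id_blinfun = 1" using tc(1) by (simp add: tracial_state_def)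
        moreover have id: "corner id_blinfun + mat2 0 0 0 id_blinfun = id_blinfun"
          by (simp add: corner_def mat2_add mat2_id)
        ultimately show ?thesis
          using add[of "corner id_blinfun" "mat2 0 0 0 id_blinfun"] diag[of id_blinfun]
          by (simp add: \<rho>_def cm mat2_mem_iff id)
      qed
      fix A assume A: "A \<in> N"
      show "\<rho> (scale_op c A) = c * \<rho> A" for c
      proof -
        have "corner (scale_op c A) = scale_op c (corner A)"
          by (simp add: corner_def mat2_scale_op mat2_eq_iff)
            (simp add: blinfun_eqI scale_op.rep_eq)
        then show ?thesis using scale[of "corner A" c] A by (simp add: \<rho>_def cm N.M_scale_op)
      qed
      show "\<rho> A \<in> \<real>\<^sub>\<ge>\<^sub>0" if "pos_op A"
      proof -
        have "\<sigma> (corner A) \<in> \<real>\<^sub>\<ge>\<^sub>0"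
          using tc(1) A pos_op_corner[OF that] cm unfolding tracial_state_def by blast
        then show ?thesis using A by (simp add: \<rho>_def complex_nonneg_Reals_iff)
      qed
      fix B assume B: "B \<in> N"
      show "\<rho> (A + B) = \<rho> A + \<rho> B"
        using add[of "corner A" "corner B"] A B
        by (simp add: \<rho>_def cm) (simp add: corner_def mat2_add ring_distribs)
      show "\<rho> (A o\<^sub>L B) = \<rho> (B o\<^sub>L A)"
        using comm[of "corner A" "corner B"] A B
        by (simp add: \<rho>_def cm) (simp add: corner_def mat2_compose)
    qed
    show "faithful N \<rho>"
      unfolding faithful_def
    proof (intro ballI impI, elim conjE)
      fix A assume A: "A \<in> N" "pos_op A" "\<rho> A = 0"
      then have "corner A = 0"
        using tc(2) pos_op_corner[of A] cm[of A] unfolding faithful_def by (simp add: \<rho>_def)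
      then show "A = 0" by (simp add: corner_def mat2_eq_iff flip: mat2_zero)
    qed
    show "normal_functional N \<rho>"
      unfolding normal_functional_def
    proof (intro allI impI, elim conjE)
      fix D S
      assume D: "D \<noteq> {}" "D \<subseteq> {A \<in> N. selfadjoint A}"
        "\<forall>A\<in>D. \<forall>B\<in>D. \<exists>C\<in>D. pos_op (C - A) \<and> pos_op (C - B)" and S: "is_op_sup N D S"
      then have dir: "op_directed D" and DN: "D \<subseteq> N" by (auto simp: op_directed_def)
      have SN: "S \<in> N" using S by (simp add: is_op_sup_def)
      have lim: "op_monotone_limit D S"
        by (rule commutant_algebra.is_op_sup_imp_monotone_limit[OF N_algebra dir DN S])
      have "Re (\<sigma> (corner S)) = (SUP T\<in>corner ` D. Re (\<sigma> T))"
      proof (rule normal_functional_monotone_limit[OF tc(3)])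
        show "op_directed (corner ` D)"
          by (rule op_directed_image[OF dir selfadjoint_corner pos_op_corner corner_diff])
        show "corner ` D \<subseteq> MN" "corner S \<in> MN" using DN SN cm by auto
        show "op_monotone_limit (corner ` D) (corner S)"
          by (rule op_monotone_limit_image[OF lim selfadjoint_corner pos_op_corner corner_diff inner_corner])
      qed
      then have eq: "Re (\<sigma> (corner S)) = (SUP T\<in>D. Re (\<sigma> (corner T)))" by (simp add: image_image)
      have "Re (\<rho> S) = 2 * (SUP T\<in>D. Re (\<sigma> (corner T)))"
        using SN by (simp add: \<rho>_def eq)
      also have "\<dots> = (SUP T\<in>D. 2 * Re (\<sigma> (corner T)))"
      proof (rule cSUP_double)
        show "D \<noteq> {}" by (rule D(1))
        show "bdd_above ((\<lambda>T. Re (\<sigma> (corner T))) ` D)"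
        proof (rule bdd_aboveI2)
          fix T assume T: "T \<in> D"
          have "\<sigma> (corner (S - T)) \<in> \<real>\<^sub>\<ge>\<^sub>0"
            using tc(1) T S DN SN pos_op_corner[of "S - T"] cm[of "S - T"]
            unfolding tracial_state_def is_op_sup_def by (meson N.M_diff subsetD)
          moreover have "\<sigma> (corner (S - T)) + \<sigma> (corner T) = \<sigma> (corner S)"
          proof -
            have "corner (S - T) \<in> MN" "corner T \<in> MN"
              using T DN SN unfolding cm by auto
            from add[OF this] show ?thesis by (simp add: corner_diff)
          qed
          ultimately show "Re (\<sigma> (corner T)) \<le> Re (\<sigma> (corner S))"
            by (metis add.commute add_le_same_cancel2 complex_nonneg_Reals_iff le_add_same_cancel1 plus_complex.sel(1))
        qed
      qed
      finally show "Re (\<rho> S) = (SUP A\<in>D. Re (\<rho> A))"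
        using DN by (simp add: \<rho>_def subset_iff cong: SUP_cong)
    qed
  qed
  then have \<rho>: "\<rho> = factor_trace N" by (rule finite_factor_trace(2)[OF N])
  then have half: "\<sigma> (corner A) = factor_trace N A / 2" if "A \<in> N" for A
    using that by (simp add: \<rho>_def flip: \<rho>)
  show ?thesis
  proof (rule extensionalityI[of _ MN])
    show "\<sigma> \<in> extensional MN" using tc(1) by (simp add: tracial_state_def)
    show "matrix_trace N \<in> extensional MN" by (simp add: matrix_trace_def)
    fix T assume "T \<in> MN"
    then obtain A B C D where T: "T = mat2 A B C D" "A \<in> N" "B \<in> N" "C \<in> N" "D \<in> N"
      by (auto simp: tensor_matrices_eq)
    have eq: "T = corner A + (mat2 0 B 0 0 + (mat2 0 0 C 0 + mat2 0 0 0 D))"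
      by (simp add: T corner_def mat2_add)
    have m: "corner A \<in> MN" "mat2 0 B 0 0 \<in> MN" "mat2 0 0 C 0 \<in> MN" "mat2 0 0 0 D \<in> MN"
      "mat2 0 0 C 0 + mat2 0 0 0 D \<in> MN" "mat2 0 B 0 0 + (mat2 0 0 C 0 + mat2 0 0 0 D) \<in> MN"
      using T(2-) by (simp_all add: mat2_add mat2_mem_iff cm)
    have "\<sigma> T = \<sigma> (corner A) + (\<sigma> (mat2 0 B 0 0) + (\<sigma> (mat2 0 0 C 0) + \<sigma> (mat2 0 0 0 D)))"
      by (simp only: eq add m)
    then show "\<sigma> T = matrix_trace N T"
      using T by (simp add: off diag half matrix_trace_mat2 add_divide_distrib)
  qed
qed

lemma factor_trace_tensor: "factor_trace MN = matrix_trace N" "normal_trace MN (matrix_trace N)"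
proof -
  show n: "normal_trace MN (matrix_trace N)"
    by (simp add: normal_trace_def matrix_trace_tracial matrix_trace_faithful matrix_trace_normal)
  show "factor_trace MN = matrix_trace N"
    unfolding factor_trace_def using n matrix_trace_unique by (rule the_equality)
qed

lemma MN_traced: "traced_algebra MN"
  by (rule commutant_algebra.traced_algebra[OF MN_algebra]) (simp add: factor_trace_tensor)

end

section \<open>Projections equiangular to the first coordinate\<close>

definition unitary_projection :: "('a::complex_hilbert_space \<Rightarrow>\<^sub>L 'a) \<Rightarrow> (('a ^ 2) \<Rightarrow>\<^sub>L ('a ^ 2))"
  where "unitary_projection V =
    (1/2) *\<^sub>R (id_blinfun \<otimes>\<^sub>o (E 1 1 + E 2 2) + V \<otimes>\<^sub>o E 1 2 + adj V \<otimes>\<^sub>o E 2 1)"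

lemma symmetric_op_adj: "A \<in> bop \<Longrightarrow> adj A = A \<longleftrightarrow> symmetric_op A"
  using selfadjoint_iff selfadjoint_def by blast

lemma unitary_projection_mat2: "unitary_projection V =
    mat2 ((1/2) *\<^sub>R id_blinfun) ((1/2) *\<^sub>R V) ((1/2) *\<^sub>R adj V) ((1/2) *\<^sub>R id_blinfun)"
  unfolding unitary_projection_def
  by (rule blinfun_vec2_eqI)
    (simp_all add: op_tensor.rep_eq E_def sum_2 blinfun_simps scaleR_add_right)

lemma first_coordinate_mat2: "id_blinfun \<otimes>\<^sub>o E 1 1 = corner id_blinfun"
  by (rule blinfun_vec2_eqI) (simp_all add: op_tensor.rep_eq E_def sum_2 corner_def)

lemma unitary_projection_inj: "unitary_projection V = unitary_projection W \<longleftrightarrow> V = W"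
  by (auto simp: unitary_projection_mat2 mat2_eq_iff)

lemma poly_op_mat2_diagonal: "poly_op q (mat2 A 0 0 D) = mat2 (poly_op q A) 0 0 (poly_op q D)"
proof (induction q)
  case (pCons a q)
  have "a *\<^sub>R id_blinfun = a *\<^sub>R mat2 id_blinfun 0 0 (id_blinfun :: 'a \<Rightarrow>\<^sub>L 'a)"
    by (simp add: mat2_id)
  then show ?case
    using pCons.IH by (simp add: mat2_scaleR mat2_compose mat2_add)
qed (simp add: mat2_zero)

lemma poly_op_intertwine: "B o\<^sub>L poly_op q (A o\<^sub>L B) = poly_op q (B o\<^sub>L A) o\<^sub>L B"
proof (induction q)
  case (pCons a q)
  have "B o\<^sub>L (A o\<^sub>L (B o\<^sub>L poly_op q (A o\<^sub>L B))) = B o\<^sub>L (A o\<^sub>L (poly_op q (B o\<^sub>L A) o\<^sub>L B))"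
    by (simp add: pCons.IH)
  then show ?case
    by (simp add: compose_simps blinfun_compose_assoc)
qed simp

lemma (in traced_algebra) tr_poly_commute:
  assumes "A \<in> M" "B \<in> M"
  shows "tr (poly_op q (A o\<^sub>L B)) = tr (poly_op q (B o\<^sub>L A))"
proof (induction q)
  case (pCons a q)
  have "tr (A o\<^sub>L (B o\<^sub>L poly_op q (A o\<^sub>L B))) = tr ((B o\<^sub>L poly_op q (A o\<^sub>L B)) o\<^sub>L A)"
    using assms by (intro tr_commute) simp_all
  also have "\<dots> = tr (poly_op q (B o\<^sub>L A) o\<^sub>L (B o\<^sub>L A))"
    by (simp add: poly_op_intertwine blinfun_compose_assoc)
  also have "\<dots> = tr ((B o\<^sub>L A) o\<^sub>L poly_op q (B o\<^sub>L A))"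
    using assms by (intro tr_commute) simp_all
  finally show ?case
    using assms by (simp add: blinfun_compose_assoc)
qed simp

context
  fixes N :: "('a::complex_hilbert_space \<Rightarrow>\<^sub>L 'a) set"
  assumes N: "finite_factor N"
begin

interpretation N: traced_algebra N by (rule N_traced[OF N])
interpretation M: traced_algebra "tensor_matrices N :: (('a ^ 2) \<Rightarrow>\<^sub>L ('a ^ 2)) set"
  by (rule MN_traced[OF N])

lemma tr_mat2:
  assumes "A \<in> N" "B \<in> N" "C \<in> N" "D \<in> N"
  shows "M.tr (mat2 A B C D) = (N.tr A + N.tr D) / 2"
  unfolding M.tr_def N.tr_def factor_trace_tensor(1)[OF N] matrix_trace_mat2[OF N assms] by simp

lemma first_coordinate_half: "corner id_blinfun \<in> half_projections (tensor_matrices N)"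
  unfolding M.half_projections_iff corner_def
  by (simp add: mat2_mem_iff mat2_compose tr_mat2 symmetric_op_corner[unfolded corner_def]
      N.tr_scaleR[OF N.M_id, of 0, simplified])

lemma unitary_projection_half:
  assumes "V \<in> unitaries N"
  shows "unitary_projection V \<in> half_projections (tensor_matrices N)"
    and "equiangular (unitary_projection V) (corner id_blinfun)"
proof -
  have V: "V \<in> N" "adj V o\<^sub>L V = id_blinfun" "V o\<^sub>L adj V = id_blinfun"
    using assms by (simp_all add: unitaries_def)
  have b: "V \<in> bop" "adj V \<in> bop" using V N.M_bop bop_adj by blast+
  have dbl: "(1/4) *\<^sub>R A + (1/4) *\<^sub>R A = (1/2) *\<^sub>R A" for A :: "'a \<Rightarrow>\<^sub>L 'a"
    by (simp flip: scaleR_add_left)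
  have "symmetric_op (unitary_projection V)"
    using b by (subst symmetric_op_adj[symmetric])
      (simp_all add: unitary_projection_mat2 mat2_bop bop_scaleR adj_mat2 adj_scaleR adj_adj)
  then show "unitary_projection V \<in> half_projections (tensor_matrices N)"
    using V by (simp add: M.half_projections_iff)
      (simp add: unitary_projection_mat2 mat2_mem_iff tr_mat2 mat2_compose compose_simps dbl)
  have "(1/2) *\<^sub>R id_blinfun - id_blinfun = - (1/2) *\<^sub>R (id_blinfun :: 'a \<Rightarrow>\<^sub>L 'a)"
    using scaleR_left_diff_distrib[of "1/2" 1 "id_blinfun :: 'a \<Rightarrow>\<^sub>L 'a"] by simp
  then show "equiangular (unitary_projection V) (corner id_blinfun)"
    unfolding equiangular_def corner_def unitary_projection_mat2
    by (simp add: mat2_diff mat2_compose compose_simps V dbl)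
      (simp add: mat2_scaleR flip: mat2_id)
qed

lemma equiangular_first_coordinate:
  assumes P: "P \<in> half_projections (tensor_matrices N)" and e: "equiangular P (corner id_blinfun)"
  shows "\<exists>V\<in>unitaries N. P = unitary_projection V"
proof -
  obtain A B C D where P': "P = mat2 A B C D" "A \<in> N" "B \<in> N" "C \<in> N" "D \<in> N"
    using M.half_projectionD(1)[OF P] by (auto simp: tensor_matrices_eq)
  have b: "A \<in> bop" "B \<in> bop" "C \<in> bop" "D \<in> bop" using P' N.M_bop by blast+
  have "adj P = P" using P by (simp add: half_projections_def)
  then have C: "C = adj B" using b by (simp add: P' adj_mat2 mat2_eq_iff)
  have "mat2 A B C D o\<^sub>L mat2 A B C D = mat2 A B C D"
    using M.half_projectionD(3)[OF P] by (simp add: P')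
  then have i: "(A o\<^sub>L A) + (B o\<^sub>L C) = A" "(C o\<^sub>L B) + (D o\<^sub>L D) = D"
    by (simp_all add: mat2_compose mat2_eq_iff)
  have "mat2 (A - id_blinfun) B C D o\<^sub>L mat2 (A - id_blinfun) B C D =
      mat2 ((1/2) *\<^sub>R id_blinfun) 0 0 ((1/2) *\<^sub>R id_blinfun)"
    using e by (simp add: equiangular_def P' corner_def mat2_diff)
      (simp add: mat2_scaleR flip: mat2_id)
  then have j: "((A - id_blinfun) o\<^sub>L (A - id_blinfun)) + (B o\<^sub>L C) = (1/2) *\<^sub>R id_blinfun"
      "(C o\<^sub>L B) + (D o\<^sub>L D) = (1/2) *\<^sub>R id_blinfun"
    by (simp_all add: mat2_compose mat2_eq_iff)
  have D: "D = (1/2) *\<^sub>R id_blinfun" using i(2) j(2) by simp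
  have "(1/2) *\<^sub>R id_blinfun = ((A o\<^sub>L A) + (B o\<^sub>L C)) - A - A + id_blinfun"
    unfolding j(1)[symmetric] by (simp add: compose_simps)
  then have "(1/2) *\<^sub>R id_blinfun = id_blinfun - A" unfolding i(1) by simp
  then have "A = id_blinfun - (1/2) *\<^sub>R id_blinfun" by (simp add: algebra_simps)
  then have A: "A = (1/2) *\<^sub>R id_blinfun"
    using scaleR_left_diff_distrib[of 1 "1/2" "id_blinfun :: 'a \<Rightarrow>\<^sub>L 'a"] by simp
  have quarter: "(1/2) *\<^sub>R id_blinfun - (1/4) *\<^sub>R id_blinfun = (1/4) *\<^sub>R (id_blinfun :: 'a \<Rightarrow>\<^sub>L 'a)"
    by (simp flip: scaleR_left_diff_distrib)
  have BC: "B o\<^sub>L C = (1/4) *\<^sub>R id_blinfun"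
    using i(1) quarter unfolding A by (simp add: compose_simps eq_diff_eq[symmetric] add.commute)
  have CB: "C o\<^sub>L B = (1/4) *\<^sub>R id_blinfun"
    using i(2) quarter unfolding D by (simp add: compose_simps eq_diff_eq[symmetric])
  let ?V = "2 *\<^sub>R B"
  have aV: "adj ?V = 2 *\<^sub>R C" using b by (simp add: C adj_scaleR)
  have "?V \<in> unitaries N"
    using P' by (simp add: unitaries_def aV compose_simps BC CB)
  moreover have "P = unitary_projection ?V"
    by (simp add: P' A D unitary_projection_mat2 aV)
  ultimately show ?thesis by blast
qed

lemma Lp_norm_unitary_projection_diff:
  assumes V: "V \<in> N" and W: "W \<in> N" and p: "0 < p"
  shows "Lp_norm p N (V - W) = 2 * Lp_norm p (tensor_matrices N) (unitary_projection V - unitary_projection W)"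
proof -
  let ?C = "V - W" and ?D = "unitary_projection V - unitary_projection W"
  have b: "V \<in> bop" "W \<in> bop" using V W N.M_bop by blast+
  have D: "?D = mat2 0 ((1/2) *\<^sub>R ?C) ((1/2) *\<^sub>R adj ?C) 0"
    using b by (simp add: unitary_projection_mat2 mat2_diff adj_diff scaleR_diff_right)
  have DM: "?D \<in> tensor_matrices N" using V W by (simp add: D mat2_mem_iff)
  have aD: "adj ?D = ?D"
    using b unfolding D by (simp add: adj_mat2 bop_diff bop_scaleR bop_adj adj_scaleR adj_adj)
  have trq: "M.tr (poly_op q (adj ?D o\<^sub>L ?D)) = N.tr (poly_op q ((1/4) *\<^sub>R (adj ?C o\<^sub>L ?C)))" for q
  proof -
    have "adj ?D o\<^sub>L ?D = mat2 (?C o\<^sub>L (1/4) *\<^sub>R adj ?C) 0 0 ((1/4) *\<^sub>R adj ?C o\<^sub>L ?C)"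
      unfolding aD unfolding D by (simp add: mat2_compose blinfun_compose.scaleR_left blinfun_compose.scaleR_right)
    then have "M.tr (poly_op q (adj ?D o\<^sub>L ?D)) =
        (N.tr (poly_op q (?C o\<^sub>L (1/4) *\<^sub>R adj ?C)) + N.tr (poly_op q ((1/4) *\<^sub>R adj ?C o\<^sub>L ?C))) / 2"
      using V W by (simp only: poly_op_mat2_diagonal) (rule tr_mat2; simp)
    also have "N.tr (poly_op q (?C o\<^sub>L (1/4) *\<^sub>R adj ?C)) = N.tr (poly_op q ((1/4) *\<^sub>R adj ?C o\<^sub>L ?C))"
      using V W by (intro N.tr_poly_commute) simp_all
    finally show ?thesis by (simp add: blinfun_compose.scaleR_left)
  qed
  define R where "R = max (norm ?C) (norm ?D)"
  have R: "norm ?C \<le> 2 * R" "norm ?D \<le> R" "0 \<le> R"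
    using norm_ge_zero[of ?C] norm_ge_zero[of ?D] unfolding R_def by linarith+
  obtain q where q: "uniform_limit {0..R\<^sup>2} (\<lambda>n. poly (q n)) (\<lambda>t. t powr (p / 2)) sequentially"
    using powr_approx[OF p] .
  let ?r = "\<lambda>n. smult (2 powr p) (q n \<circ>\<^sub>p [:0, 1/4:])"
  have r: "uniform_limit {0..(2 * R)\<^sup>2} (\<lambda>n. poly (?r n)) (\<lambda>t. t powr (p / 2)) sequentially"
  proof (rule uniform_limit_cong'[THEN iffD1])
    have "uniform_limit {0..(2 * R)\<^sup>2} (\<lambda>n t. poly (q n) (t / 4)) (\<lambda>t. (t / 4) powr (p / 2)) sequentially"
      by (rule uniform_limit_compose'[OF q]) (auto simp: power_mult_distrib)
    then show "uniform_limit {0..(2 * R)\<^sup>2} (\<lambda>n t. 2 powr p * poly (q n) (t / 4))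
        (\<lambda>t. 2 powr p * (t / 4) powr (p / 2)) sequentially"
      by (intro uniform_limit_intros)
    fix t assume "t \<in> {0..(2 * R)\<^sup>2}"
    have "(4::real) powr (p / 2) = 2 powr p"
      using powr_powr[of 2 2 "p / 2"] by simp
    then show "2 powr p * (t / 4) powr (p / 2) = t powr (p / 2)"
      using \<open>t \<in> _\<close> by (simp add: powr_divide)
  qed (simp add: poly_pcompose)
  have eq: "N.tr (poly_op (?r n) (adj ?C o\<^sub>L ?C)) = 2 powr p * M.tr (poly_op (q n) (adj ?D o\<^sub>L ?D))" for n
    unfolding trq using V W by (simp add: poly_op_smult poly_op_pcompose blinfun_compose.scaleR_right)
  have l1: "(\<lambda>n. N.tr (poly_op (?r n) (adj ?C o\<^sub>L ?C))) \<longlonglongrightarrow> N.tr_powr p ?C"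
    using V W by (intro N.tr_poly_tendsto[OF _ R(1) p r]) simp
  have l2: "(\<lambda>n. 2 powr p * M.tr (poly_op (q n) (adj ?D o\<^sub>L ?D))) \<longlonglongrightarrow> 2 powr p * M.tr_powr p ?D"
    by (intro tendsto_intros M.tr_poly_tendsto[OF DM R(2) p q])
  have "N.tr_powr p ?C = 2 powr p * M.tr_powr p ?D"
    by (rule LIMSEQ_unique[OF l1[unfolded eq] l2])
  then show ?thesis
    using p M.tr_powr_nonneg[OF DM p] by (simp add: N.Lp_norm_eq M.Lp_norm_eq powr_mult powr_powr)
qed

end

theorem lemma3p2:
  fixes p :: real
    and N1 :: "('a::complex_hilbert_space \<Rightarrow>\<^sub>L 'a) set"
    and N2 :: "('b::complex_hilbert_space \<Rightarrow>\<^sub>L 'b) set"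
    and M1 :: "(('a ^ 2) \<Rightarrow>\<^sub>L ('a ^ 2)) set"
    and M2 :: "(('b ^ 2) \<Rightarrow>\<^sub>L ('b ^ 2)) set"
    and \<phi> :: "(('a ^ 2) \<Rightarrow>\<^sub>L ('a ^ 2)) \<Rightarrow> (('b ^ 2) \<Rightarrow>\<^sub>L ('b ^ 2))"
  assumes "0 < p"
    and "finite_factor N1" and "finite_factor N2"
    and "M1 = tensor_matrices N1" and "M2 = tensor_matrices N2"
    and "Lp_isometry_on p M1 M2 (half_projections M1) \<phi>"
    and "\<phi> ` half_projections M1 = half_projections M2"
    and "\<phi> (id_blinfun \<otimes>\<^sub>o E 1 1) = id_blinfun \<otimes>\<^sub>o E 1 1"
  shows "\<exists>\<psi>. Lp_isometry_on p N1 N2 (unitaries N1) \<psi> \<and>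
    \<psi> ` unitaries N1 = unitaries N2 \<and>
    (\<forall>V\<in>unitaries N1.
      \<phi> ((1 / 2) *\<^sub>R (id_blinfun \<otimes>\<^sub>o (E 1 1 + E 2 2) + V \<otimes>\<^sub>o E 1 2 + adj V \<otimes>\<^sub>o E 2 1)) =
      (1 / 2) *\<^sub>R (id_blinfun \<otimes>\<^sub>o (E 1 1 + E 2 2) + \<psi> V \<otimes>\<^sub>o E 1 2 + adj (\<psi> V) \<otimes>\<^sub>o E 2 1))"
proof -
  note N1 = \<open>finite_factor N1\<close> and N2 = \<open>finite_factor N2\<close>
  note onto = \<open>\<phi> ` half_projections M1 = half_projections M2\<close>
  note iso = \<open>Lp_isometry_on p M1 M2 (half_projections M1) \<phi>\<close>
  note M = \<open>M1 = tensor_matrices N1\<close> \<open>M2 = tensor_matrices N2\<close>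
  let ?P = "corner id_blinfun"
  have fixP: "\<phi> ?P = ?P"
    using \<open>\<phi> (id_blinfun \<otimes>\<^sub>o E 1 1) = id_blinfun \<otimes>\<^sub>o E 1 1\<close> by (simp only: first_coordinate_mat2)
  have P: "?P \<in> half_projections M1"
    unfolding M by (rule first_coordinate_half[OF N1])
  have eqa: "equiangular (\<phi> Q) ?P \<longleftrightarrow> equiangular Q ?P" if "Q \<in> half_projections M1" for Q
    using Lp_isometry_equiangular[OF _ _ \<open>0 < p\<close> iso onto that P] MN_traced[OF N1] MN_traced[OF N2]
    by (simp add: M fixP)
  have up: "unitary_projection V \<in> half_projections M1" "equiangular (unitary_projection V) ?P"
    if "V \<in> unitaries N1" for V
    using unitary_projection_half[OF N1 that] by (simp_all add: M)
  have "\<exists>W\<in>unitaries N2. \<phi> (unitary_projection V) = unitary_projection W" if "V \<in> unitaries N1" for V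
    using up[OF that] eqa onto by (intro equiangular_first_coordinate[OF N2]) (auto simp: M)
  then obtain \<psi> where \<psi>: "\<And>V. V \<in> unitaries N1 \<Longrightarrow> \<psi> V \<in> unitaries N2"
    "\<And>V. V \<in> unitaries N1 \<Longrightarrow> \<phi> (unitary_projection V) = unitary_projection (\<psi> V)"
    by metis
  have "Lp_isometry_on p N1 N2 (unitaries N1) \<psi>"
    unfolding Lp_isometry_on_def
  proof (intro ballI)
    fix V W assume V: "V \<in> unitaries N1" and W: "W \<in> unitaries N1"
    have "Lp_norm p M1 (unitary_projection V - unitary_projection W) =
        Lp_norm p M2 (unitary_projection (\<psi> V) - unitary_projection (\<psi> W))"
      using iso up V W by (simp add: Lp_isometry_on_def flip: \<psi>(2))
    then show "Lp_norm p N1 (V - W) = Lp_norm p N2 (\<psi> V - \<psi> W)"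
      using V W \<psi>(1)[OF V] \<psi>(1)[OF W] \<open>0 < p\<close>
      by (simp add: Lp_norm_unitary_projection_diff[OF N1] Lp_norm_unitary_projection_diff[OF N2]
          unitaries_def M)
  qed
  moreover have "\<psi> ` unitaries N1 = unitaries N2"
  proof (intro equalityI subsetI)
    fix W assume W: "W \<in> unitaries N2"
    then have "unitary_projection W \<in> \<phi> ` half_projections M1"
      unfolding onto using unitary_projection_half[OF N2 W] by (simp add: M)
    then obtain Q where Q: "Q \<in> half_projections M1" "\<phi> Q = unitary_projection W" by auto
    then have "equiangular Q ?P"
      using eqa[OF Q(1)] unitary_projection_half[OF N2 W] by simp
    then obtain V where V: "V \<in> unitaries N1" "Q = unitary_projection V"
      using equiangular_first_coordinate[OF N1] Q(1) M by blast
    then have "\<psi> V = W" using Q(2) \<psi>(2) by (simp add: unitary_projection_inj)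
    then show "W \<in> \<psi> ` unitaries N1" using V by blast
  qed (use \<psi>(1) in blast)
  ultimately show ?thesis
    using \<psi>(2) unfolding unitary_projection_def by blast
qed

end
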